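(* Given a directed or undirected graph with $n$ vertices and $m$ edges, its vertices can be output in a BFS order starting at a given vertex using $n\lg 3+O(\lg^2 n)$ bits of working space and $O(mn)$ time.
   Context: Model: the input graph is stored in read-only memory as a standard adjacency list, output goes to write-only memory, and only the additional random-access workspace is counted, in bits; the workspace is a word RAM with words of $\Omega(\lg n)$ bits. As a standing assumption of the paper, the input graph is connected (so $m\ge n-1$). *)

theory Defs
  imports Complex_Main "Graph_Theory.Graph_Theory"
begin

section \<open>A word RAM with read-only input and write-only output\<close>

text \<open>
  Programs are structured register programs in three-address form.  Every instruction and every
  test takes one unit of time.  Programs are fixed finite objects: the number of registers and
  the immediate constants cannot depend on the input.
\<close>

datatype operand = Reg nat | Imm nat

datatype binop = Add | Sub | Mul | Div | Mod | And | Or | Xor | Shl | Shr | Eq | Lt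

datatype com =
    Skip
  | Move nat operand                    \<comment> \<open>destination register, source\<close>
  | Arith nat binop operand operand
  | Read_Input nat operand              \<comment> \<open>destination register, address in the read-only memory\<close>
  | Load nat operand operand            \<comment> \<open>destination register, bit address, number of bits\<close>
  | Store operand operand operand       \<comment> \<open>bit address, number of bits, value\<close>
  | Output operand
  | Seq com com
  | If_Nonzero operand com com
  | While_Nonzero operand com

record ram_state =
  regs :: "nat \<Rightarrow> nat"
  work :: "nat \<Rightarrow> bool"
  outp :: "nat list"

fun operand_val :: "nat \<Rightarrow> ram_state \<Rightarrow> operand \<Rightarrow> nat" where
  "operand_val w \<sigma> (Reg r) = regs \<sigma> r"
| "operand_val w \<sigma> (Imm k) = take_bit w k"

text \<open>
  Results are reduced modulo \<open>2 ^ w\<close> when they are written to a register; adding \<open>2 ^ w\<close> in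
  the case of \<^const>\<open>Sub\<close> only avoids the truncated subtraction of natural numbers.
\<close>

fun binop_val :: "nat \<Rightarrow> binop \<Rightarrow> nat \<Rightarrow> nat \<Rightarrow> nat" where
  "binop_val w Add x y = x + y"
| "binop_val w Sub x y = x + 2 ^ w - y"
| "binop_val w Mul x y = x * y"
| "binop_val w Div x y = x div y"
| "binop_val w Mod x y = x mod y"
| "binop_val w And x y = and x y"
| "binop_val w Or x y = or x y"
| "binop_val w Xor x y = xor x y"
| "binop_val w Shl x y = push_bit y x"
| "binop_val w Shr x y = drop_bit y x"
| "binop_val w Eq x y = of_bool (x = y)"
| "binop_val w Lt x y = of_bool (x < y)"

definition set_reg :: "nat \<Rightarrow> nat \<Rightarrow> nat \<Rightarrow> ram_state \<Rightarrow> ram_state" where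
  "set_reg w r x \<sigma> = \<sigma>\<lparr>regs := (regs \<sigma>)(r := take_bit w x)\<rparr>"

definition get_field :: "(nat \<Rightarrow> bool) \<Rightarrow> nat \<Rightarrow> nat \<Rightarrow> nat" where
  "get_field f a l = (\<Sum>i<l. of_bool (f (a + i)) * 2 ^ i)"

definition set_field :: "nat \<Rightarrow> nat \<Rightarrow> nat \<Rightarrow> (nat \<Rightarrow> bool) \<Rightarrow> (nat \<Rightarrow> bool)" where
  "set_field a l x f = (\<lambda>i. if a \<le> i \<and> i < a + l then bit x (i - a) else f i)"

text \<open>
  One step on a machine with words of \<open>w\<close> bits, \<open>S\<close> bits of random-access workspace and the
  read-only memory \<open>rom\<close>.  The workspace is addressed by bits, and one instruction accesses up
  to \<open>w\<close> consecutive bits; such a field meets at most two aligned words, so that this is a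
  constant number of operations of a word-addressed machine.  Accesses outside the workspace or
  the input, and accesses to more than \<open>w\<close> bits, get stuck.
\<close>

fun step :: "nat \<Rightarrow> nat \<Rightarrow> nat list \<Rightarrow> com \<times> ram_state \<Rightarrow> (com \<times> ram_state) option" where
  "step w S rom (Skip, \<sigma>) = None"
| "step w S rom (Move r x, \<sigma>) = Some (Skip, set_reg w r (operand_val w \<sigma> x) \<sigma>)"
| "step w S rom (Arith r f x y, \<sigma>) =
    Some (Skip, set_reg w r (binop_val w f (operand_val w \<sigma> x) (operand_val w \<sigma> y)) \<sigma>)"
| "step w S rom (Read_Input r a, \<sigma>) =
    (if operand_val w \<sigma> a < length rom
     then Some (Skip, set_reg w r (rom ! operand_val w \<sigma> a) \<sigma>) else None)"
| "step w S rom (Load r a l, \<sigma>) =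
    (if operand_val w \<sigma> l \<le> w \<and> operand_val w \<sigma> a + operand_val w \<sigma> l \<le> S
     then Some (Skip, set_reg w r (get_field (work \<sigma>) (operand_val w \<sigma> a) (operand_val w \<sigma> l)) \<sigma>)
     else None)"
| "step w S rom (Store a l x, \<sigma>) =
    (if operand_val w \<sigma> l \<le> w \<and> operand_val w \<sigma> a + operand_val w \<sigma> l \<le> S
     then Some (Skip, \<sigma>\<lparr>work := set_field (operand_val w \<sigma> a) (operand_val w \<sigma> l)
                                    (operand_val w \<sigma> x) (work \<sigma>)\<rparr>)
     else None)"
| "step w S rom (Output x, \<sigma>) = Some (Skip, \<sigma>\<lparr>outp := outp \<sigma> @ [operand_val w \<sigma> x]\<rparr>)"
| "step w S rom (Seq c d, \<sigma>) =
    (if c = Skip then Some (d, \<sigma>)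
     else map_option (\<lambda>(c', \<sigma>'). (Seq c' d, \<sigma>')) (step w S rom (c, \<sigma>)))"
| "step w S rom (If_Nonzero x c d, \<sigma>) = Some (if operand_val w \<sigma> x \<noteq> 0 then c else d, \<sigma>)"
| "step w S rom (While_Nonzero x c, \<sigma>) =
    Some (if operand_val w \<sigma> x \<noteq> 0 then Seq c (While_Nonzero x c) else Skip, \<sigma>)"

primrec steps :: "nat \<Rightarrow> nat \<Rightarrow> nat list \<Rightarrow> nat \<Rightarrow> com \<times> ram_state \<Rightarrow> (com \<times> ram_state) option" where
  "steps w S rom 0 cfg = Some cfg"
| "steps w S rom (Suc t) cfg = Option.bind (step w S rom cfg) (steps w S rom t)"

fun operand_regs :: "operand \<Rightarrow> nat set" where
  "operand_regs (Reg r) = {r}"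
| "operand_regs (Imm k) = {}"

fun regs_of :: "com \<Rightarrow> nat set" where
  "regs_of Skip = {}"
| "regs_of (Move r x) = {r} \<union> operand_regs x"
| "regs_of (Arith r f x y) = {r} \<union> operand_regs x \<union> operand_regs y"
| "regs_of (Read_Input r a) = {r} \<union> operand_regs a"
| "regs_of (Load r a l) = {r} \<union> operand_regs a \<union> operand_regs l"
| "regs_of (Store a l x) = operand_regs a \<union> operand_regs l \<union> operand_regs x"
| "regs_of (Output x) = operand_regs x"
| "regs_of (Seq c d) = regs_of c \<union> regs_of d"
| "regs_of (If_Nonzero x c d) = operand_regs x \<union> regs_of c \<union> regs_of d"
| "regs_of (While_Nonzero x c) = operand_regs x \<union> regs_of c"

text \<open>
  The vertex count and the start vertex are passed in registers 0 and 1.  Nothing is assumed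
  about the initial contents of the workspace.
\<close>

definition init_state :: "nat \<Rightarrow> nat \<Rightarrow> (nat \<Rightarrow> bool) \<Rightarrow> ram_state" where
  "init_state n s f = \<lparr>regs = (\<lambda>_. 0)(0 := n, 1 := s), work = f, outp = []\<rparr>"

text \<open>
  A halting run of exactly \<open>t\<close> steps with output \<open>xs\<close> that uses at most \<open>space\<close> bits.  The
  \<open>S\<close> bits of memory and all registers count, a register being charged with the \<open>b\<close> bits
  that suffice for every register throughout the run; \<open>b\<close> may be smaller than the word length
  \<open>w\<close> of the machine, which is only bounded from below.  The control state takes one of finitely
  many values that depend on the program alone, i.e. a constant number of bits.
\<close>

definition halts_within ::
  "nat \<Rightarrow> nat list \<Rightarrow> com \<Rightarrow> ram_state \<Rightarrow> nat \<Rightarrow> nat \<Rightarrow> nat list \<Rightarrow> bool" where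
  "halts_within w rom P \<sigma> t space xs \<longleftrightarrow>
    (\<exists>S b. card (regs_of P) * b + S \<le> space \<and>
      (\<exists>\<sigma>'. steps w S rom t (P, \<sigma>) = Some (Skip, \<sigma>') \<and> outp \<sigma>' = xs) \<and>
      (\<forall>i\<le>t. \<forall>c' \<sigma>'. steps w S rom i (P, \<sigma>) = Some (c', \<sigma>') \<longrightarrow>
         (\<forall>r\<in>regs_of P. regs \<sigma>' r < 2 ^ b)))"

section \<open>Input graphs\<close>

text \<open>
  An undirected graph is a symmetric digraph; each edge then appears as two opposite arcs (a loop
  as a single arc) but counts once.
\<close>

definition undirected_edges :: "'a pair_pre_digraph \<Rightarrow> 'a set set" where
  "undirected_edges G = (\<lambda>(u, v). {u, v}) ` parcs G"

definition graph_with_edge_count :: "nat pair_pre_digraph \<Rightarrow> nat \<Rightarrow> bool" where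
  "graph_with_edge_count G m \<longleftrightarrow>
    pair_fin_digraph G \<and> m = card (parcs G) \<or>
    pair_pseudo_graph G \<and> m = card (undirected_edges G)"

text \<open>
  Singly linked adjacency lists in word-addressed memory: cells \<open>0, \<dots>, n - 1\<close> hold the list
  heads; a list node at address \<open>p \<ge> n\<close> consists of a neighbour in cell \<open>p\<close> and the address of
  the next node in cell \<open>p + 1\<close>; address 0 is the null pointer.  The order of the neighbours and
  the placement of the nodes are arbitrary.
\<close>

inductive linked_list :: "nat list \<Rightarrow> nat \<Rightarrow> nat \<Rightarrow> nat list \<Rightarrow> bool" for rom n where
  "linked_list rom n 0 []"
| "p \<noteq> 0 \<Longrightarrow> n \<le> p \<Longrightarrow> p + 1 < length rom \<Longrightarrow> linked_list rom n (rom ! (p + 1)) vs \<Longrightarrow>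
   linked_list rom n p (rom ! p # vs)"

definition adjacency_list :: "nat pair_pre_digraph \<Rightarrow> nat \<Rightarrow> nat list \<Rightarrow> bool" where
  "adjacency_list G n rom \<longleftrightarrow>
    pverts G = {..<n} \<and>
    length rom = n + 2 * card (parcs G) \<and>
    (\<forall>u<n. \<exists>vs. linked_list rom n (rom ! u) vs \<and> distinct vs \<and> set vs = {v. (u, v) \<in> parcs G})"

text \<open>
  A BFS order from \<open>s\<close> lists the vertices reachable from \<open>s\<close> by nondecreasing distance; the
  order within one level is free.  Distances are \<open>wf_digraph.\<mu>\<close> for unit arc weights.
\<close>

definition bfs_order :: "'a pair_pre_digraph \<Rightarrow> 'a \<Rightarrow> 'a list \<Rightarrow> bool" where
  "bfs_order G s xs \<longleftrightarrow>
    distinct xs \<and>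
    set xs = {v. s \<rightarrow>\<^sup>*\<^bsub>with_proj G\<^esub> v} \<and>
    sorted (map (wf_digraph.\<mu> (with_proj G) (\<lambda>_. 1) s) xs)"

end

theory Submission
  imports Defs
begin

text \<open>
  Colour the vertices white, or with the parity of their level.  A level is found by scanning all
  vertices with the parity of the previous one: those from older levels have no white neighbours
  any more and do no harm.  So three colours are enough.  With \<open>q\<close> the least positive number such
  that \<open>n \<le> 2 ^ q\<close>, the colours live in a binary tree of depth \<open>q\<close>, where two sibling numbers are
  combined into one, the low bits of the result are stored and its high part, a number of about
  \<open>q\<close> bits, goes to the parent.  This takes \<open>n * log 2 3 + O(q\<^sup>2)\<close> bits and \<open>O(q)\<close> time per
  access.  The factor \<open>q\<close> is absorbed as follows: levels with at most \<open>q\<close> vertices are kept in an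
  explicit queue of \<open>O(q\<^sup>2)\<close> bits, and there are at most \<open>n / q\<close> levels that need a scan of the
  whole graph.
\<close>

section \<open>Weakest preconditions with a step counter\<close>

text \<open>The tree reconciles two demands. Numbers must have \<open>O(q)\<close> bits to be
  handled in constant time, yet cutting bits off a range that is no power of two means rounding up,
  and this is cheap only for large ranges. Bases of about \<open>2 ^ q\<close> make the loss
  \<open>O(1 / 2 ^ q)\<close> bits per node, hence \<open>O(1)\<close> bits over about
  \<open>n <= 2 ^ q\<close> nodes; one incomplete node per level accounts for \<open>O(q)\<close>
  more bits each. Time is amortised over vertices. With \<open>e\<close> arcs a full sweep costs
  \<open>O(q * (n + e))\<close>, but the at least \<open>q + 1\<close> vertices of its level share
  it, so each pays \<open>O(n + e)\<close>. The resulting \<open>O(n * (n + e))\<close> is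
  \<open>O(m * n + 1)\<close> only because connectedness bounds \<open>n\<close> by
  \<open>2 * e + 1\<close>; the summand 1 is for a single vertex without arcs. All addresses and
  numbers are polynomial in \<open>2 ^ q\<close>. Cells of \<open>15 * q\<close> bits hold them, and
  registers of \<open>36 * q\<close> bits hold products of two of them. The constantly many
  registers are charged with \<open>36 * q\<close> bits each, so the space bound does not depend on
  how long the machine words are.\<close>

locale word_ram =
  fixes w S :: nat and rom :: "nat list" and b :: nat
  assumes b_le_w: "b \<le> w" and four_le_b: "4 \<le> b"
begin

text \<open>Measured by \<open>b\<close> and not by the word length, since
  \<open>halts_within\<close> charges the bits that registers really use. It ranges over all
  registers, so that no set of program registers has to be carried along.\<close>

definition bounded :: "(nat \<Rightarrow> nat) \<Rightarrow> bool" where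
  "bounded g \<longleftrightarrow> (\<forall>r. g r < 2 ^ b)"

text \<open>The bound is attached to every configuration because \<open>halts_within\<close> demands
  it throughout the run and not only at the end.\<close>

inductive run :: "nat \<Rightarrow> com \<times> ram_state \<Rightarrow> ram_state \<Rightarrow> bool" where
  run_Skip: "bounded (regs \<sigma>) \<Longrightarrow> run 0 (Skip, \<sigma>) \<sigma>"
| run_step: "bounded (regs \<sigma>) \<Longrightarrow> step w S rom (c, \<sigma>) = Some cfg \<Longrightarrow> run t cfg \<sigma>' \<Longrightarrow>
    run (Suc t) (c, \<sigma>) \<sigma>'"

lemma run_steps: "run t cfg \<sigma>' \<Longrightarrow> steps w S rom t cfg = Some (Skip, \<sigma>')"
  by (induction rule: run.induct) auto

lemma run_bounded:
  "run t cfg \<sigma>' \<Longrightarrow> i \<le> t \<Longrightarrow> steps w S rom i cfg = Some (c', \<tau>) \<Longrightarrow> bounded (regs \<tau>)"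
proof (induction arbitrary: i rule: run.induct)
  case (run_step \<sigma> c cfg t \<sigma>')
  then show ?case by (cases i) auto
qed auto

text \<open>The extra step discards the \<open>Skip\<close> to which the first command has been
  reduced.\<close>

lemma run_Seq:
  "run t cfg \<sigma>' \<Longrightarrow> run t' (d, \<sigma>') \<tau> \<Longrightarrow> run (Suc (t + t')) (Seq (fst cfg) d, snd cfg) \<tau>"
proof (induction rule: run.induct)
  case (run_Skip \<sigma>)
  then show ?case by (auto intro: run.run_step)
next
  case (run_step \<sigma> c cfg t \<sigma>')
  then have "c \<noteq> Skip" by auto
  with run_step show ?case by (auto intro!: run.run_step[where cfg = "(Seq (fst cfg) d, snd cfg)"]
        simp: case_prod_unfold)
qed

text \<open>
  The counter \<open>k\<close> is the number of steps made before \<open>c\<close> starts, so that the postcondition of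
  a whole program can refer to the total number of steps.
\<close>

definition wp ::
  "com \<Rightarrow> (nat \<Rightarrow> (nat \<Rightarrow> nat) \<Rightarrow> (nat \<Rightarrow> bool) \<Rightarrow> nat list \<Rightarrow> bool) \<Rightarrow>
   nat \<Rightarrow> (nat \<Rightarrow> nat) \<Rightarrow> (nat \<Rightarrow> bool) \<Rightarrow> nat list \<Rightarrow> bool" where
  "wp c Q k g f out \<longleftrightarrow> (bounded g \<longrightarrow> (\<exists>t g' f' out'.
     run t (c, \<lparr>regs = g, work = f, outp = out\<rparr>) \<lparr>regs = g', work = f', outp = out'\<rparr> \<and>
     Q (k + t) g' f' out'))"

text \<open>A run ends in a bounded state and never lowers the counter, so both facts may be assumed
  when the postcondition is weakened.\<close>

lemma wp_mono:
  assumes "wp c R k g f out"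
    and "\<And>k' g f out. k \<le> k' \<Longrightarrow> bounded g \<Longrightarrow> R k' g f out \<Longrightarrow> Q k' g f out"
  shows "wp c Q k g f out"
proof -
  have "bounded (regs \<sigma>')" if "run t cfg \<sigma>'" for t cfg \<sigma>'
    using that by (induction rule: run.induct) auto
  then have "bounded g" if "run t cfg \<lparr>regs = g, work = f, outp = out\<rparr>" for t cfg g f out
    using that by fastforce
  with assms show ?thesis unfolding wp_def by (meson le_add1)
qed

lemma wp_single:
  assumes "bounded g \<Longrightarrow> step w S rom (c, \<lparr>regs = g, work = f, outp = out\<rparr>) =
      Some (Skip, \<lparr>regs = g', work = f', outp = out'\<rparr>)"
    and "bounded g \<Longrightarrow> bounded g'" and "Q (k + 1) g' f' out'"
  shows "wp c Q k g f out"
  unfolding wp_def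
proof
  assume g: "bounded g"
  then have "run (Suc 0) (c, \<lparr>regs = g, work = f, outp = out\<rparr>)
      \<lparr>regs = g', work = f', outp = out'\<rparr>"
    using assms by (auto intro!: run_step run_Skip)
  with assms(3) show "\<exists>t g' f' out'. run t (c, \<lparr>regs = g, work = f, outp = out\<rparr>)
      \<lparr>regs = g', work = f', outp = out'\<rparr> \<and> Q (k + t) g' f' out'"
    by (intro exI[of _ "Suc 0"] exI[of _ g'] exI[of _ f'] exI[of _ out']) simp
qed

lemma wp_step:
  assumes "step w S rom (c, \<lparr>regs = g, work = f, outp = out\<rparr>) =
      Some (c', \<lparr>regs = g, work = f, outp = out\<rparr>)"
    and "wp c' Q (k + 1) g f out"
  shows "wp c Q k g f out"
  unfolding wp_def
proof
  assume g: "bounded g"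
  then obtain t g' f' out' where "run t (c', \<lparr>regs = g, work = f, outp = out\<rparr>)
      \<lparr>regs = g', work = f', outp = out'\<rparr>" "Q (k + 1 + t) g' f' out'"
    using assms(2) by (auto simp: wp_def)
  with g assms(1) have "run (Suc t) (c, \<lparr>regs = g, work = f, outp = out\<rparr>)
      \<lparr>regs = g', work = f', outp = out'\<rparr> \<and> Q (k + Suc t) g' f' out'"
    by (auto intro!: run_step)
  then show "\<exists>t g' f' out'. run t (c, \<lparr>regs = g, work = f, outp = out\<rparr>)
      \<lparr>regs = g', work = f', outp = out'\<rparr> \<and> Q (k + t) g' f' out'"
    by blast
qed

text \<open>The reduction modulo 16 lets \<open>val_less\<close> hold for every operand without a
  side condition.\<close>

fun val :: "(nat \<Rightarrow> nat) \<Rightarrow> operand \<Rightarrow> nat" where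
  "val g (Reg r) = g r"
| "val g (Imm k) = k mod 16"

text \<open>
  Only immediates below 16 are used, so that their value does not depend on the word length.
\<close>

fun small_operand :: "operand \<Rightarrow> bool" where
  "small_operand (Reg r) = True"
| "small_operand (Imm k) = (k < 16)"

lemma sixteen_le: "(16 :: nat) \<le> 2 ^ b"
  using power_increasing[OF four_le_b, of "2 :: nat"] by simp

lemma less_word: "x < 2 ^ b \<Longrightarrow> x < (2 :: nat) ^ w"
  using b_le_w by (auto intro: less_le_trans)

lemma val_eq:
  "small_operand x \<Longrightarrow> operand_val w \<lparr>regs = g, work = f, outp = out\<rparr> x = val g x"
  using sixteen_le by (cases x) (auto simp: take_bit_nat_eq_self less_word)

lemma val_less: "bounded g \<Longrightarrow> val g x < 2 ^ b"
  using sixteen_le by (cases x) (auto simp: bounded_def intro: less_le_trans[OF mod_less_divisor])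

lemma set_reg_eq:
  "v < 2 ^ b \<Longrightarrow> set_reg w r v \<lparr>regs = g, work = f, outp = out\<rparr> =
    \<lparr>regs = g(r := v), work = f, outp = out\<rparr>"
  by (auto simp: set_reg_def take_bit_nat_eq_self less_word)

lemma bounded_upd: "bounded g \<Longrightarrow> v < 2 ^ b \<Longrightarrow> bounded (g(r := v))"
  by (auto simp: bounded_def)

lemma wp_Skip: "Q k g f out \<Longrightarrow> wp Skip Q k g f out"
  unfolding wp_def by (auto intro!: exI[of _ 0] exI[of _ g] exI[of _ f] exI[of _ out] run_Skip)

lemma wp_Seq: "wp c (wp d Q) (k + 1) g f out \<Longrightarrow> wp (Seq c d) Q k g f out"
proof -
  assume *: "wp c (wp d Q) (k + 1) g f out"
  then have "wp c (\<lambda>k g f out. bounded g \<and> wp d Q k g f out) (k + 1) g f out"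
    by (rule wp_mono) auto
  show ?thesis unfolding wp_def[of "Seq c d"]
  proof
    assume "bounded g"
    with \<open>wp c (\<lambda>k g f out. bounded g \<and> wp d Q k g f out) (k + 1) g f out\<close>
    obtain t g' f' out' where 1: "run t (c, \<lparr>regs = g, work = f, outp = out\<rparr>)
        \<lparr>regs = g', work = f', outp = out'\<rparr>" "bounded g'" "wp d Q (k + 1 + t) g' f' out'"
      unfolding wp_def[of c] by blast
    then obtain t' g'' f'' out'' where 2: "run t' (d, \<lparr>regs = g', work = f', outp = out'\<rparr>)
        \<lparr>regs = g'', work = f'', outp = out''\<rparr>" "Q (k + 1 + t + t') g'' f'' out''"
      by (auto simp: wp_def)
    show "\<exists>t g' f' out'. run t (Seq c d, \<lparr>regs = g, work = f, outp = out\<rparr>)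
      \<lparr>regs = g', work = f', outp = out'\<rparr> \<and> Q (k + t) g' f' out'"
      using run_Seq[OF 1(1) 2(1)] 2(2)
      by (intro exI[of _ "Suc (t + t')"] exI[of _ g''] exI[of _ f''] exI[of _ out'']) (simp add: add_ac)
  qed
qed

lemma wp_Move:
  assumes "small_operand x" and "Q (k + 1) (g(r := val g x)) f out"
  shows "wp (Move r x) Q k g f out"
  by (rule wp_single[where g' = "g(r := val g x)" and f' = f and out' = out])
    (use assms in \<open>simp_all add: val_eq set_reg_eq val_less bounded_upd\<close>)

lemma wp_Arith:
  assumes "small_operand x" "small_operand y"
    and "bounded g \<Longrightarrow> v < 2 ^ b"
    and "bounded g \<Longrightarrow> take_bit w (binop_val w p (val g x) (val g y)) = v"
    and "Q (k + 1) (g(r := v)) f out"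
  shows "wp (Arith r p x y) Q k g f out"
  by (rule wp_single[where g' = "g(r := v)" and f' = f and out' = out])
    (use assms in \<open>simp_all add: val_eq set_reg_def bounded_upd\<close>)

lemma wp_Arith':
  assumes "small_operand x" "small_operand y"
    and "bounded g \<Longrightarrow> binop_val w p (val g x) (val g y) < 2 ^ b"
    and "Q (k + 1) (g(r := binop_val w p (val g x) (val g y))) f out"
  shows "wp (Arith r p x y) Q k g f out"
  by (rule wp_Arith[where v = "binop_val w p (val g x) (val g y)"])
    (use assms in \<open>simp_all add: take_bit_nat_eq_self less_word\<close>)

lemmas wp_Add = wp_Arith'[where p = Add, simplified binop_val.simps]
  and wp_Mul = wp_Arith'[where p = Mul, simplified binop_val.simps]
  and wp_Shl = wp_Arith'[where p = Shl, simplified binop_val.simps]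

lemma wp_Sub:
  assumes "small_operand x" "small_operand y" and "val g y \<le> val g x"
    and "Q (k + 1) (g(r := val g x - val g y)) f out"
  shows "wp (Arith r Sub x y) Q k g f out"
proof (rule wp_Arith[where v = "val g x - val g y"])
  show "val g x - val g y < 2 ^ b" if "bounded g"
    using val_less[OF that, of x] by simp
  \<comment> \<open>As nothing is borrowed, the machine value is the true difference plus
    \<open>2 ^ w\<close>, and \<open>take_bit\<close> removes the latter.\<close>
  then show "take_bit w (binop_val w Sub (val g x) (val g y)) = val g x - val g y" if "bounded g"
    using that assms(3) by (simp add: take_bit_eq_mod less_word flip: add_diff_assoc2)
qed (use assms in auto)

lemma wp_Div:
  assumes "small_operand x" "small_operand y" and "Q (k + 1) (g(r := val g x div val g y)) f out"
  shows "wp (Arith r Div x y) Q k g f out"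
  using assms val_less
  by (intro wp_Arith'[where p = Div]) (auto intro: le_less_trans[OF div_le_dividend])

lemma wp_Mod:
  assumes "small_operand x" "small_operand y" and "Q (k + 1) (g(r := val g x mod val g y)) f out"
  shows "wp (Arith r Mod x y) Q k g f out"
  using assms val_less
  by (intro wp_Arith'[where p = Mod]) (auto intro: le_less_trans[OF mod_less_eq_dividend])

lemma wp_Shr:
  assumes "small_operand x" "small_operand y" and "Q (k + 1) (g(r := val g x div 2 ^ val g y)) f out"
  shows "wp (Arith r Shr x y) Q k g f out"
  using assms val_less
  by (intro wp_Arith'[where p = Shr])
    (auto simp: drop_bit_eq_div intro: le_less_trans[OF div_le_dividend])

lemma one_less: "(1 :: nat) < 2 ^ b" "0 < (2 :: nat) ^ b"
  using sixteen_le by linarith+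

lemma wp_Eq:
  assumes "small_operand x" "small_operand y"
    and "Q (k + 1) (g(r := of_bool (val g x = val g y))) f out"
  shows "wp (Arith r Eq x y) Q k g f out"
  using assms one_less by (intro wp_Arith'[where p = Eq]) auto

lemma wp_Lt:
  assumes "small_operand x" "small_operand y"
    and "Q (k + 1) (g(r := of_bool (val g x < val g y))) f out"
  shows "wp (Arith r Lt x y) Q k g f out"
  using assms one_less by (intro wp_Arith'[where p = Lt]) auto

lemma wp_Read:
  assumes "small_operand x" and "val g x < length rom" and "rom ! val g x < 2 ^ b"
    and "Q (k + 1) (g(r := rom ! val g x)) f out"
  shows "wp (Read_Input r x) Q k g f out"
  by (rule wp_single[where g' = "g(r := rom ! val g x)" and f' = f and out' = out])
    (use assms in \<open>simp_all add: val_eq set_reg_eq bounded_upd\<close>)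

lemma get_field_less: "get_field f a l < 2 ^ l"
proof (induction l)
  case (Suc l)
  then show ?case by (auto simp: get_field_def)
qed (simp add: get_field_def)

lemma wp_Load:
  assumes "small_operand x" "small_operand y" and "val g y \<le> b" "val g x + val g y \<le> S"
    and "Q (k + 1) (g(r := get_field f (val g x) (val g y))) f out"
  shows "wp (Load r x y) Q k g f out"
proof -
  have "get_field f (val g x) (val g y) < 2 ^ b"
    using get_field_less by (rule less_le_trans) (use assms(3) in simp)
  then show ?thesis using assms b_le_w
    by (intro wp_single[where g' = "g(r := get_field f (val g x) (val g y))" and f' = f and out' = out])
      (simp_all add: val_eq set_reg_eq bounded_upd)
qed

lemma wp_Store:
  assumes "small_operand x" "small_operand y" "small_operand z"
    and "val g y \<le> b" "val g x + val g y \<le> S"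
    and "Q (k + 1) g (set_field (val g x) (val g y) (val g z) f) out"
  shows "wp (Store x y z) Q k g f out"
  using assms b_le_w
  by (intro wp_single[where g' = g and f' = "set_field (val g x) (val g y) (val g z) f" and out' = out])
    (simp_all add: val_eq)

lemma wp_Output:
  assumes "small_operand x" and "Q (k + 1) g f (out @ [val g x])"
  shows "wp (Output x) Q k g f out"
  using assms by (intro wp_single[where g' = g and f' = f and out' = "out @ [val g x]"])
    (simp_all add: val_eq)

lemma wp_If:
  assumes "small_operand x"
    and "val g x \<noteq> 0 \<Longrightarrow> wp c Q (k + 1) g f out" and "val g x = 0 \<Longrightarrow> wp d Q (k + 1) g f out"
  shows "wp (If_Nonzero x c d) Q k g f out"
  by (rule wp_step[where c' = "if val g x \<noteq> 0 then c else d"]) (use assms in \<open>auto simp: val_eq\<close>)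

text \<open>The potential \<open>m\<close> pays for the steps and yields termination.\<close>

lemma wp_While:
  assumes "small_operand x" and "I m g f out"
    and "\<And>m k g f out. I m g f out \<Longrightarrow> val g x \<noteq> 0 \<Longrightarrow>
      wp c (\<lambda>k' g' f' out'. \<exists>m'. I m' g' f' out' \<and> k' + 2 + m' \<le> k + m) k g f out"
    and "\<And>m' k' g' f' out'. I m' g' f' out' \<Longrightarrow> val g' x = 0 \<Longrightarrow>
      k' + m' \<le> k + 1 + m \<Longrightarrow> Q k' g' f' out'"
  shows "wp (While_Nonzero x c) Q k g f out"
  using assms(2,4)
proof (induction m arbitrary: k g f out rule: less_induct)
  case (less m)
  show ?case
  proof (cases "val g x = 0")
    case True
    then show ?thesis
      using less.prems assms(1) by (intro wp_step[OF _ wp_Skip]) (auto simp: val_eq)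
  next
    case False
    show ?thesis
    proof (rule wp_step[where c' = "Seq c (While_Nonzero x c)"])
      show "wp (Seq c (While_Nonzero x c)) Q (k + 1) g f out"
      proof (rule wp_Seq, rule wp_mono[OF assms(3)])
        fix k' g' f' out'
        assume "k + 1 + 1 \<le> k'"
          and "\<exists>m'. I m' g' f' out' \<and> k' + 2 + m' \<le> (k + 1 + 1) + m"
        \<comment> \<open>The two units pay for the loop test and for dropping the finished body.
          The counter has grown by at least two, so the potential has strictly decreased, as the
          induction requires.\<close>
        then obtain m' where m': "I m' g' f' out'" "k' + m' \<le> k + m" "m' < m" by auto
        show "wp (While_Nonzero x c) Q k' g' f' out'"
          by (rule less.IH[OF m'(3,1)]) (use m' less.prems(2) in auto)
      qed (use less.prems False in auto)
    qed (use False assms(1) in \<open>auto simp: val_eq\<close>)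
  qed
qed

end

section \<open>Bit fields\<close>

lemma get_field_set_field: "get_field (set_field a l x f) a l = x mod 2 ^ l"
proof -
  have "get_field (set_field a l x f) a l = (\<Sum>i<l. of_bool (bit x i) * 2 ^ i)"
    unfolding get_field_def set_field_def by (intro sum.cong) auto
  also have "\<dots> = take_bit l x"
    by (simp add: take_bit_sum push_bit_eq_mult atLeast0LessThan)
  finally show ?thesis by (simp add: take_bit_eq_mod)
qed

lemma get_field_set_field_disjoint:
  "a + l \<le> a' \<or> a' + l' \<le> a \<Longrightarrow> get_field (set_field a l x f) a' l' = get_field f a' l'"
  unfolding get_field_def set_field_def by (intro sum.cong) auto

definition cell :: "nat \<Rightarrow> (nat \<Rightarrow> bool) \<Rightarrow> nat \<Rightarrow> nat" where
  "cell W f k = get_field f (k * W) W"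

definition set_cell :: "nat \<Rightarrow> nat \<Rightarrow> nat \<Rightarrow> (nat \<Rightarrow> bool) \<Rightarrow> (nat \<Rightarrow> bool)" where
  "set_cell W k x f = set_field (k * W) W x f"

lemma cell_set_cell: "x < 2 ^ W \<Longrightarrow> cell W (set_cell W k x f) k' = (if k' = k then x else cell W f k')"
proof (cases "k' = k")
  case False
  then have "k * W + W \<le> k' * W \<or> k' * W + W \<le> k * W"
    using mult_le_mono1[of "Suc k" k' W] mult_le_mono1[of "Suc k'" k W] by (auto simp: neq_iff)
  with False show ?thesis by (simp add: cell_def set_cell_def get_field_set_field_disjoint)
qed (simp add: cell_def set_cell_def get_field_set_field)

lemma get_field_set_cell:
  "Suc k * W \<le> a \<Longrightarrow> get_field (set_cell W k x f) a l = get_field f a l"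
  by (simp add: set_cell_def get_field_set_field_disjoint)

lemma cell_set_field:
  "Suc k * W \<le> a \<Longrightarrow> cell W (set_field a l x f) k = cell W f k"
  by (simp add: cell_def get_field_set_field_disjoint)

section \<open>Arrays of trits with little redundancy\<close>

text \<open>Its \<open>m\<close>-th iterate is the ceiling of \<open>y / 2 ^ m\<close>: the number
  of possible high parts once \<open>m\<close> low bits are cut off a number below \<open>y\<close>.
  The next two lemmas are the two halves of this fact.\<close>

definition halve_up :: "nat \<Rightarrow> nat" where
  "halve_up y = (y + 1) div 2"

lemma halve_up_ge: "y \<le> (halve_up ^^ m) y * 2 ^ m"
proof (induction m)
  case (Suc m)
  have "(halve_up ^^ m) y \<le> (halve_up ^^ Suc m) y * 2" by (simp add: halve_up_def)
  then have "(halve_up ^^ m) y * 2 ^ m \<le> (halve_up ^^ Suc m) y * 2 * 2 ^ m"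
    by (rule mult_le_mono1)
  also have "\<dots> = (halve_up ^^ Suc m) y * 2 ^ Suc m"
    by (simp only: power_Suc mult.assoc)
  finally show ?case using Suc by linarith
qed simp

lemma halve_up_less: "(halve_up ^^ m) y * 2 ^ m < y + 2 ^ m"
proof (induction m)
  case (Suc m)
  have "(halve_up ^^ Suc m) y * 2 \<le> (halve_up ^^ m) y + 1" by (simp add: halve_up_def)
  then have "(halve_up ^^ Suc m) y * 2 * 2 ^ m \<le> ((halve_up ^^ m) y + 1) * 2 ^ m"
    by (rule mult_le_mono1)
  with Suc show ?case by (simp add: algebra_simps)
qed simp

text \<open>The upper limit keeps the remaining number short. Minimality keeps the remaining range
  above \<open>2 ^ q\<close> whenever anything is cut off, which makes the rounding
  harmless.\<close>

definition shift :: "nat \<Rightarrow> nat \<Rightarrow> nat" where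
  "shift q y = (LEAST m. (halve_up ^^ m) y \<le> 2 ^ (q + 1))"

lemma shift_exists: "\<exists>m. (halve_up ^^ m) y \<le> 2 ^ (q + 1)"
proof
  have "(halve_up ^^ y) y * 2 ^ y < 2 * 2 ^ y"
    using halve_up_less[of y y] less_exp[of y] by linarith
  then have "(halve_up ^^ y) y < 2" by simp
  then show "(halve_up ^^ y) y \<le> 2 ^ (q + 1)" by (simp add: le_trans[of _ 1])
qed

lemma shift_le: "(halve_up ^^ shift q y) y \<le> 2 ^ (q + 1)"
  unfolding shift_def using shift_exists by (rule LeastI_ex)

lemma shift_greater: "m < shift q y \<Longrightarrow> 2 ^ (q + 1) < (halve_up ^^ m) y"
  unfolding shift_def using not_less_Least by (meson not_le)

text \<open>One halving earlier the value still exceeded \<open>2 ^ (q + 1)\<close>. The result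
  bounds the relative rounding error \<open>2 ^ shift q y / y\<close> by
  \<open>2 / 2 ^ q\<close>.\<close>

lemma shift_bound:
  assumes "shift q y \<noteq> 0"
  shows "2 ^ shift q y * 2 ^ q \<le> 2 * y"
proof -
  define m where "m = shift q y - 1"
  \<comment> \<open>Strictness in \<open>shift_greater\<close> yields the extra
    \<open>2 ^ m\<close>, just enough to cancel the rounding term of
    \<open>halve_up_less\<close>.\<close>
  have "(2 ^ (q + 1)) * 2 ^ m + 2 ^ m \<le> (halve_up ^^ m) y * 2 ^ m"
    using shift_greater[of m q y] assms mult_le_mono1[of "2 ^ (q + 1) + 1" "(halve_up ^^ m) y" "2 ^ m"]
    by (simp add: m_def algebra_simps)
  also have "\<dots> < y + 2 ^ m" by (rule halve_up_less)
  finally have "2 ^ (q + 1) * 2 ^ m \<le> y" by simp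
  moreover have "shift q y = Suc m" using assms by (simp add: m_def)
  ultimately show ?thesis by (simp add: mult_ac)
qed

text \<open>
  A node at height \<open>j\<close> of a binary tree carries a number below \<open>base q j\<close>.  The pair of the
  numbers of two siblings is cut into its low \<open>width q j\<close> bits, which are stored, and the number
  of the parent.  Since the bases stay above \<open>2 ^ q\<close> once bits are stored, rounding costs
  only \<open>O(2 powr - q)\<close> bits per node.
\<close>

primrec base :: "nat \<Rightarrow> nat \<Rightarrow> nat" where
  "base q 0 = 3"
| "base q (Suc j) = (halve_up ^^ shift q (base q j * base q j)) (base q j * base q j)"

text \<open>It is 0 as long as the square of the base is at most \<open>2 ^ (q + 1)\<close>; on such
  levels nothing is stored and siblings merely merge into a larger digit.\<close>

definition width :: "nat \<Rightarrow> nat \<Rightarrow> nat" where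
  "width q j = shift q (base q j * base q j)"

primrec node :: "nat \<Rightarrow> (nat \<Rightarrow> nat) \<Rightarrow> nat \<Rightarrow> nat \<Rightarrow> nat" where
  "node q col 0 i = col i"
| "node q col (Suc j) i =
     (node q col j (2 * i) * base q j + node q col j (2 * i + 1)) div 2 ^ width q j"

definition pair :: "nat \<Rightarrow> (nat \<Rightarrow> nat) \<Rightarrow> nat \<Rightarrow> nat \<Rightarrow> nat" where
  "pair q col j i = node q col j (2 * i) * base q j + node q col j (2 * i + 1)"

lemma node_Suc: "node q col (Suc j) i = pair q col j i div 2 ^ width q j"
  by (simp add: pair_def)

declare node.simps(2) [simp del]

text \<open>Height \<open>i\<close> has a field for each index up to
  \<open>n div 2 ^ (i + 1)\<close>. The \<open>+ 1\<close> provides for the last, possibly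
  incomplete node and costs only the sum of all widths, which is \<open>O(q ^ 2)\<close>
  bits.\<close>

definition addr :: "nat \<Rightarrow> nat \<Rightarrow> nat \<Rightarrow> nat \<Rightarrow> nat" where
  "addr q n D j = D + (\<Sum>i<j. width q i * (n div 2 ^ (i + 1) + 1))"

text \<open>
  The state in the middle of a change from \<open>col\<close> to \<open>col'\<close>: levels below \<open>k\<close> already hold
  \<open>col'\<close>.
\<close>

definition stored ::
  "nat \<Rightarrow> nat \<Rightarrow> nat \<Rightarrow> nat \<Rightarrow> (nat \<Rightarrow> nat) \<Rightarrow> (nat \<Rightarrow> nat) \<Rightarrow> (nat \<Rightarrow> bool) \<Rightarrow> bool" where
  "stored q n D k col col' f \<longleftrightarrow> (\<forall>j<q. \<forall>p\<le>n div 2 ^ (j + 1).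
     get_field f (addr q n D j + p * width q j) (width q j) =
       pair q (if j < k then col' else col) j p mod 2 ^ width q j)"

section \<open>Size and decoding of the numbers in the tree\<close>

lemma base_le: "1 \<le> q \<Longrightarrow> base q j \<le> 2 ^ (q + 1)"
proof (cases j)
  case 0
  assume "1 \<le> q"
  then have "(2 :: nat) ^ (1 + 1) \<le> 2 ^ (q + 1)" by (intro power_increasing) auto
  with 0 show ?thesis by simp
next
  case (Suc k)
  then show ?thesis using shift_le by simp
qed

lemma base_pos: "0 < base q j"
proof (induction j)
  case (Suc j)
  then show ?case
    using halve_up_ge[of "base q j * base q j" "shift q (base q j * base q j)"]
    by (auto intro: gr0I)
qed simp

lemma base_square_le: "1 \<le> q \<Longrightarrow> base q j * base q j \<le> 2 ^ (2 * q + 2)"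
  using mult_le_mono[OF base_le base_le, of q q j j] by (simp flip: power_add add: mult_2 del: power_Suc)

lemma width_le: assumes "1 \<le> q" shows "width q j \<le> q + 3"
proof (cases "width q j = 0")
  case False
  then have "2 ^ width q j * 2 ^ q \<le> 2 * (base q j * base q j)"
    unfolding width_def by (rule shift_bound)
  also have "\<dots> \<le> 2 * 2 ^ (2 * q + 2)" using base_square_le[OF assms] by simp
  finally have "(2 :: nat) ^ (width q j + q) \<le> 2 ^ (2 * q + 3)" by (simp add: power_add)
  then show ?thesis by (simp add: power_increasing_iff)
qed simp

context
  fixes q :: nat and col :: "nat \<Rightarrow> nat"
  assumes col_less: "\<And>i. col i < 3"
begin

lemma mult_add_less: "x < a \<Longrightarrow> y < a \<Longrightarrow> x * a + y < a * (a :: nat)"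
  using mult_le_mono1[of "Suc x" a a] by simp

lemma node_less: "node q col j i < base q j"
proof (induction j arbitrary: i)
  case (Suc j)
  have "pair q col j i < base q j * base q j"
    unfolding pair_def by (intro mult_add_less Suc)
  also have "\<dots> \<le> base q (Suc j) * 2 ^ width q j"
    by (simp add: halve_up_ge width_def)
  finally show ?case by (simp only: node_Suc less_mult_imp_div_less)
qed (simp add: col_less)

lemma pair_less: "pair q col j i < base q j * base q j"
  unfolding pair_def by (intro mult_add_less node_less)

text \<open>Both children are below the base, hence they are the two digits of the pair; this is how
  reading descends.\<close>

lemma node_pair:
  "node q col j u = (if even u then pair q col j (u div 2) div base q j
     else pair q col j (u div 2) mod base q j)"
proof -
  have "(x * base q j + node q col j i) div base q j = x"
    "(x * base q j + node q col j i) mod base q j = node q col j i" for x i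
    using node_less[of j i] by auto
  note * = this
  show ?thesis
  proof (cases "even u")
    case True
    then have "2 * (u div 2) = u" by simp
    then show ?thesis using True * by (simp add: pair_def)
  next
    case False
    then have "2 * (u div 2) + 1 = u" by (rule odd_two_times_div_two_succ)
    then show ?thesis using False * by (simp add: pair_def)
  qed
qed

lemma pair_even: "even u \<Longrightarrow>
    pair q col j (u div 2) = node q col j u * base q j + pair q col j (u div 2) mod base q j"
  and pair_odd: "odd u \<Longrightarrow>
    pair q col j (u div 2) = pair q col j (u div 2) div base q j * base q j + node q col j u"
  by (simp_all only: node_pair if_True if_False div_mult_mod_eq)

end

text \<open>A leaf influences only its ancestors, so that a write changes one field per
  level.\<close>

lemma node_upd_other: "i \<noteq> u div 2 ^ j \<Longrightarrow> node q (col(u := t)) j i = node q col j i"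
proof (induction j arbitrary: i)
  case (Suc j)
  have "2 * i \<noteq> u div 2 ^ j" "2 * i + 1 \<noteq> u div 2 ^ j"
    using Suc.prems by (auto simp: div_mult2_eq mult.commute[of 2])
  with Suc.IH show ?case by (simp add: node.simps(2))
qed simp

lemma pair_upd_other: "i \<noteq> u div 2 ^ (j + 1) \<Longrightarrow> pair q (col(u := t)) j i = pair q col j i"
proof -
  assume "i \<noteq> u div 2 ^ (j + 1)"
  then have "2 * i \<noteq> u div 2 ^ j" "2 * i + 1 \<noteq> u div 2 ^ j"
    by (auto simp: div_mult2_eq mult.commute[of 2])
  then show ?thesis by (simp add: pair_def node_upd_other)
qed

text \<open>The unchanged sibling is still a digit of the old pair, so replacing the other digit
  suffices. This is why reading leaves the pairs of the path behind for the write that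
  follows.\<close>

lemma pair_upd:
  fixes q j u t and col :: "nat \<Rightarrow> nat"
  assumes "\<And>i. col i < 3" "t < 3"
  defines "z \<equiv> pair q col j (u div 2 ^ j div 2)" and "new \<equiv> node q (col(u := t)) j (u div 2 ^ j)"
  shows "pair q (col(u := t)) j (u div 2 ^ j div 2) =
    (if even (u div 2 ^ j) then new * base q j + z mod base q j else z div base q j * base q j + new)"
proof -
  have less: "(col(u := t)) i < 3" for i using assms by simp
  define v where "v = u div 2 ^ j"
  show ?thesis
  proof (cases "even v")
    case True
    then have "node q (col(u := t)) j (v + 1) = node q col j (v + 1)"
      by (intro node_upd_other) (simp add: v_def)
    then have "pair q (col(u := t)) j (v div 2) mod base q j = pair q col j (v div 2) mod base q j"
      using True node_less[OF less] node_less[OF assms(1)] by (auto simp: pair_def elim!: evenE)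
    then show ?thesis
      using pair_even[of "col(u := t)" v q j, OF less True] True by (simp add: z_def new_def v_def)
  next
    case False
    then have "node q (col(u := t)) j (v - 1) = node q col j (v - 1)"
      by (intro node_upd_other) (auto simp: v_def elim!: oddE)
    then have "pair q (col(u := t)) j (v div 2) div base q j = pair q col j (v div 2) div base q j"
      using False node_less[of "col(u := t)" q j v, OF less] node_less[of col q j v, OF assms(1)]
      by (auto simp: pair_def elim!: oddE)
    then show ?thesis
      using pair_odd[of "col(u := t)" v q j, OF less False] False by (simp add: z_def new_def v_def)
  qed
qed

lemma addr_Suc: "addr q n D (Suc j) = addr q n D j + width q j * (n div 2 ^ (j + 1) + 1)"
  by (simp add: addr_def)

lemma addr_mono: "i \<le> j \<Longrightarrow> addr q n D i \<le> addr q n D j"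
  unfolding addr_def by (auto intro: sum_mono2)

lemma addr_ge: "D \<le> addr q n D j"
  by (simp add: addr_def)

lemma field_end:
  assumes "p \<le> n div 2 ^ (j + 1)"
  shows "addr q n D j + p * width q j + width q j \<le> addr q n D (Suc j)"
  using mult_le_mono1[of "p + 1" "n div 2 ^ (j + 1) + 1" "width q j"] assms
  by (simp add: addr_Suc algebra_simps)

lemma fields_disjoint:
  fixes q n D
  assumes "p \<le> n div 2 ^ (j + 1)" "p' \<le> n div 2 ^ (j' + 1)" "(j, p) \<noteq> (j', p')"
  defines "a \<equiv> addr q n D j + p * width q j" and "a' \<equiv> addr q n D j' + p' * width q j'"
  shows "a + width q j \<le> a' \<or> a' + width q j' \<le> a"
proof (cases j j' rule: linorder_cases)
  case less
  then show ?thesis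
    using field_end[OF assms(1), of q D] addr_mono[of "Suc j" j' q n D] by (simp add: a_def a'_def)
next
  case greater
  then show ?thesis
    using field_end[OF assms(2), of q D] addr_mono[of "Suc j'" j q n D] by (simp add: a_def a'_def)
next
  case equal
  with assms(3) consider "p < p'" | "p' < p" by fastforce
  then show ?thesis
    using equal mult_le_mono1[of "Suc p" p' "width q j"] mult_le_mono1[of "Suc p'" p "width q j"]
    by cases (auto simp: a_def a'_def)
qed

text \<open>On level \<open>k\<close> the two colourings differ at most in the pair above
  \<open>u\<close>, so overwriting its field moves the border between new and old levels up by
  one.\<close>

lemma stored_upd:
  assumes "stored q n D k col (col(u := t)) f" and "k < q" "u < n"
  defines "p \<equiv> u div 2 ^ (k + 1)"
  shows "stored q n D (Suc k) col (col(u := t))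
    (set_field (addr q n D k + p * width q k) (width q k) (pair q (col(u := t)) k p) f)"
  unfolding stored_def
proof (intro allI impI)
  fix j p' assume j: "j < q" and p': "p' \<le> n div 2 ^ (j + 1)"
  have p: "p \<le> n div 2 ^ (k + 1)" unfolding p_def using assms(3) by (intro div_le_mono) simp
  let ?g = "set_field (addr q n D k + p * width q k) (width q k) (pair q (col(u := t)) k p) f"
  have old: "get_field f (addr q n D j + p' * width q j) (width q j) =
       pair q (if j < k then col(u := t) else col) j p' mod 2 ^ width q j"
    using assms(1) j p' by (simp add: stored_def)
  show "get_field ?g (addr q n D j + p' * width q j) (width q j) =
       pair q (if j < Suc k then col(u := t) else col) j p' mod 2 ^ width q j"
  proof (cases "(k, p) = (j, p')")
    case True
    \<comment> \<open>The whole pair is handed to \<open>set_field\<close>, which keeps just its low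
      \<open>width q k\<close> bits; the rest belongs to the parent.\<close>
    then show ?thesis by (auto simp: get_field_set_field)
  next
    case False
    have "get_field ?g (addr q n D j + p' * width q j) (width q j) =
        get_field f (addr q n D j + p' * width q j) (width q j)"
      by (rule get_field_set_field_disjoint, rule fields_disjoint[OF p p' False])
    then show ?thesis using False old by (auto simp: less_Suc_eq p_def pair_upd_other)
  qed
qed

lemma stored_set_cell:
  "Suc i * W \<le> D \<Longrightarrow> stored q n D k col col' (set_cell W i x f) = stored q n D k col col' f"
proof -
  assume "Suc i * W \<le> D"
  then have "Suc i * W \<le> addr q n D j + l" for j l
    using addr_ge[of D q n j] by linarith
  then show ?thesis by (simp add: stored_def get_field_set_cell)
qed

lemma stored_finish: "stored q n D q col col' f = stored q n D 0 col' col'' f"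
  by (simp add: stored_def)

lemma node_zero: "node q (\<lambda>_. 0) j i = 0"
  by (induction j arbitrary: i) (simp_all add: node.simps(2))

lemma pair_zero: "pair q (\<lambda>_. 0) j i = 0"
  by (simp add: pair_def node_zero)

text \<open>White is 0 and zeros combine to zeros, so clearing the memory initialises the array
  without any tree operations.\<close>

lemma stored_zero:
  assumes "\<And>i. D \<le> i \<Longrightarrow> i < addr q n D q \<Longrightarrow> \<not> f i"
  shows "stored q n D 0 (\<lambda>_. 0) col' f"
  unfolding stored_def
proof (intro allI impI)
  fix j p assume j: "j < q" and p: "p \<le> n div 2 ^ (j + 1)"
  have "\<not> f (addr q n D j + p * width q j + i)" if "i < width q j" for i
    using that field_end[OF p, of q D] addr_mono[of "Suc j" q q n D] j addr_ge[of D q n j]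
    by (intro assms) auto
  then show "get_field f (addr q n D j + p * width q j) (width q j) =
       pair q (if j < 0 then col' else (\<lambda>_. 0)) j p mod 2 ^ width q j"
    by (simp add: get_field_def pair_zero)
qed

text \<open>By \<open>shift_bound\<close>, rounding up enlarges the exact quotient by a factor of at
  most \<open>1 + 2 / 2 ^ q\<close>. Its logarithm is the information wasted at one node.\<close>

lemma log_halve_up:
  assumes "0 < y"
  shows "log 2 (real ((halve_up ^^ shift q y) y)) + shift q y \<le> log 2 y + 4 / 2 ^ q"
proof (cases "shift q y = 0")
  case False
  define m where "m = shift q y"
  define h where "h = (halve_up ^^ m) y"
  have pos: "0 < 1 + 2 / (2 :: real) ^ q" by (intro add_pos_nonneg) simp_all
  have h0: "0 < h" using assms halve_up_ge[of y m] by (auto simp: h_def intro: gr0I)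
  have "real (2 ^ m * 2 ^ q) \<le> real (2 * y)"
    using shift_bound[OF False] unfolding m_def by (simp only: of_nat_le_iff)
  then have 1: "2 ^ m / real y \<le> 2 / 2 ^ q" using assms by (simp add: field_simps)
  have "real (h * 2 ^ m) \<le> real (y + 2 ^ m)"
    using halve_up_less[of m y] unfolding h_def by (simp only: of_nat_le_iff less_imp_le)
  also have "real (y + 2 ^ m) = real y * (1 + 2 ^ m / real y)"
    using assms by (simp add: distrib_left)
  finally have "real h * 2 ^ m \<le> real y * (1 + 2 ^ m / real y)" by simp
  also have "real y * (1 + 2 ^ m / real y) \<le> real y * (1 + 2 / 2 ^ q)" using 1 by (intro mult_left_mono) auto
  finally have "log 2 (real h * 2 ^ m) \<le> log 2 (real y * (1 + 2 / 2 ^ q))"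
    using h0 assms pos by (subst log_le_cancel_iff) (simp_all add: zero_less_mult_iff)
  also have "\<dots> = log 2 y + log 2 (1 + 2 / 2 ^ q)"
    using assms pos by (subst log_mult) simp_all
  also have "log 2 (1 + 2 / 2 ^ q) = ln (1 + 2 / 2 ^ q) / ln 2"
    by (simp add: log_def)
  also have "\<dots> \<le> (2 / 2 ^ q) / ln 2"
    by (intro divide_right_mono ln_add_one_self_le_self) auto
  \<comment> \<open>\<open>ln 2 >= 1 / 2\<close> is \<open>ln x <= x - 1\<close> at
    \<open>x = 1 / 2\<close>.\<close>
  also have "\<dots> \<le> (2 / 2 ^ q) / (1 / 2)"
    using ln_le_minus_one[of "1 / 2"] by (intro divide_left_mono) (auto simp: ln_div)
  finally show ?thesis
    using h0 by (simp add: log_mult log_nat_power h_def m_def)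
qed simp

text \<open>\<open>log 2 (base q k) / 2 ^ k\<close> is the number of bits per leaf still passed on
  at height \<open>k\<close>. It starts at \<open>log 2 3\<close>, and each level converts a part of
  it into stored bits, losing at most \<open>4 / 2 ^ q\<close> bits per node; the sum
  telescopes.\<close>

lemma sum_width_le:
  assumes "n \<le> 2 ^ q"
  shows "real (\<Sum>j<q. width q j * (n div 2 ^ (j + 1))) \<le> n * log 2 3 + 4"
proof -
  have "(\<Sum>j<k. width q j / 2 ^ (j + 1)) \<le>
      log 2 3 - log 2 (base q k) / 2 ^ k + (4 / 2 ^ q) * (1 - 1 / 2 ^ k)" for k
  proof (induction k)
    case (Suc k)
    have "log 2 (base q (Suc k)) + width q k \<le> log 2 (base q k * base q k) + 4 / 2 ^ q"
      using log_halve_up[of "base q k * base q k" q] base_pos[of q k] by (simp add: width_def)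
    also have "log 2 (base q k * base q k) = 2 * log 2 (base q k)"
      using base_pos[of q k] by (simp add: log_mult)
    finally have "width q k / 2 ^ (k + 1) \<le>
        (2 * log 2 (base q k) + 4 / 2 ^ q - log 2 (base q (Suc k))) / 2 ^ (k + 1)"
      by (intro divide_right_mono) auto
    also have "\<dots> = log 2 (base q k) / 2 ^ k - log 2 (base q (Suc k)) / 2 ^ Suc k
        + (4 / 2 ^ q) * (1 / 2 ^ k - 1 / 2 ^ Suc k)"
      by (simp add: field_simps del: base.simps)
    finally have *: "width q k / 2 ^ (k + 1) \<le> log 2 (base q k) / 2 ^ k
        - log 2 (base q (Suc k)) / 2 ^ Suc k + (4 / 2 ^ q) * (1 / 2 ^ k - 1 / 2 ^ Suc k)" .
    have "(4 / 2 ^ q) * (1 - 1 / 2 ^ k) + (4 / 2 ^ q) * (1 / 2 ^ k - 1 / 2 ^ Suc k) =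
        (4 / 2 ^ q) * (1 - 1 / 2 ^ Suc k :: real)"
      by (simp only: flip: distrib_left) simp
    with Suc * show ?case unfolding sum.lessThan_Suc by linarith
  qed simp
  from this[of q] have *: "(\<Sum>j<q. width q j / 2 ^ (j + 1)) \<le> log 2 3 + 4 / 2 ^ q"
  proof -
    have "0 \<le> log 2 (base q q) / 2 ^ q"
      using base_pos[of q q] by (intro divide_nonneg_pos) (auto simp: Suc_le_eq)
    moreover have "(4 / 2 ^ q) * (1 - 1 / 2 ^ q :: real) \<le> (4 / 2 ^ q) * 1"
      by (intro mult_left_mono) auto
    ultimately show ?thesis using \<open>_ \<le> log 2 3 - log 2 (base q q) / 2 ^ q + _\<close> by linarith
  qed
  have "real (\<Sum>j<q. width q j * (n div 2 ^ (j + 1))) \<le> (\<Sum>j<q. width q j * (n / 2 ^ (j + 1)))"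
    unfolding of_nat_sum of_nat_mult
    by (intro sum_mono mult_left_mono) (auto intro: order_trans[OF of_nat_div_le_of_nat])
  also have "\<dots> = n * (\<Sum>j<q. width q j / 2 ^ (j + 1))"
    by (simp add: sum_distrib_left mult_ac)
  also have "\<dots> \<le> n * (log 2 3 + 4 / 2 ^ q)"
    by (intro mult_left_mono *) simp
  also have "\<dots> = n * log 2 3 + 4 * (n / 2 ^ q)" by (simp add: algebra_simps)
  \<comment> \<open>Here the choice of \<open>q\<close> makes the total loss constant.\<close>
  also have "n / 2 ^ q \<le> 1" using of_nat_mono[OF assms, where 'a = real] by simp
  finally show ?thesis by simp
qed

section \<open>The program\<close>

fun seq :: "com list \<Rightarrow> com" where
  "seq [] = Skip"
| "seq [c] = c"
| "seq (c # cs) = Seq c (seq cs)"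

text \<open>
  Registers: 0 vertex count, 1 vertex being expanded, 2 \<open>q\<close>, 3 cell width, 4 scratch,
  5 array index, 6 to 13 array access, 14 colour to be written, 15 size of the level,
  16 colour of the level, 17 and 24 offsets of the current and the next queue, 18 size of the
  next level, 19 to 21 and 25 loop over the level, 22 list node, 23 test results.

  The workspace starts with \<open>q + 1\<close> records of eight cells: base, width and address of a
  level, the pair last read on that level (in the last record: the number at the root), an unused
  cell, one cell for each of the two queues, and another unused cell.
\<close>

definition load_cell :: "nat \<Rightarrow> nat \<Rightarrow> operand \<Rightarrow> com" where
  "load_cell r j x = seq [Arith 4 Mul (Reg j) (Imm 8), Arith 4 Add (Reg 4) x,
     Arith 4 Mul (Reg 4) (Reg 3), Load r (Reg 4) (Reg 3)]"

definition store_cell :: "nat \<Rightarrow> operand \<Rightarrow> operand \<Rightarrow> com" where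
  "store_cell j x y = seq [Arith 4 Mul (Reg j) (Imm 8), Arith 4 Add (Reg 4) x,
     Arith 4 Mul (Reg 4) (Reg 3), Store (Reg 4) (Reg 3) y]"

text \<open>Common to reading and writing, for the vertex in register 5 at the height in register 7:
  afterwards 8 is the width, 9 the base, 10 the address of the field on its path, and 12 tells on
  which side the child lies.\<close>

definition level_info :: com where
  "level_info = seq [load_cell 9 7 (Imm 0), load_cell 8 7 (Imm 1), load_cell 10 7 (Imm 2),
     Arith 11 Shr (Reg 5) (Reg 7), Arith 12 Shr (Reg 11) (Imm 1), Arith 12 Mul (Reg 12) (Reg 8),
     Arith 10 Add (Reg 10) (Reg 12), Arith 12 Mod (Reg 11) (Imm 2)]"

definition read_level :: com where
  "read_level = seq [Arith 7 Sub (Reg 7) (Imm 1), level_info,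
     Arith 6 Shl (Reg 6) (Reg 8), Load 13 (Reg 10) (Reg 8), Arith 13 Add (Reg 13) (Reg 6),
     store_cell 7 (Imm 3) (Reg 13),
     If_Nonzero (Reg 12) (Arith 6 Mod (Reg 13) (Reg 9)) (Arith 6 Div (Reg 13) (Reg 9))]"

definition read_trit :: com where
  "read_trit = seq [load_cell 6 2 (Imm 3), Move 7 (Reg 2), While_Nonzero (Reg 7) read_level]"

definition write_level :: com where
  "write_level = seq [level_info, load_cell 13 7 (Imm 3),
     If_Nonzero (Reg 12)
       (seq [Arith 11 Div (Reg 13) (Reg 9), Arith 11 Mul (Reg 11) (Reg 9),
          Arith 13 Add (Reg 11) (Reg 6)])
       (seq [Arith 13 Mod (Reg 13) (Reg 9), Arith 6 Mul (Reg 6) (Reg 9),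
          Arith 13 Add (Reg 6) (Reg 13)]),
     Store (Reg 10) (Reg 8) (Reg 13), Arith 6 Shr (Reg 13) (Reg 8),
     Arith 7 Add (Reg 7) (Imm 1), Arith 23 Lt (Reg 7) (Reg 2)]"

text \<open>To be run only after \<open>read_trit\<close> for the same vertex: it climbs along the
  pairs that the read has saved in the fourth cells.\<close>

definition write_trit :: com where
  "write_trit = seq [Move 7 (Imm 0), Move 6 (Reg 14), Arith 23 Lt (Reg 7) (Reg 2),
     While_Nonzero (Reg 23) write_level, store_cell 2 (Imm 3) (Reg 6)]"

text \<open>Register 18 keeps counting after the queue has its \<open>q\<close> entries, so the
  overflow is recognised later from the count alone.\<close>

definition visit_node :: com where
  "visit_node = seq [Read_Input 5 (Reg 22), read_trit,
     If_Nonzero (Reg 6) Skip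
       (seq [write_trit, Output (Reg 5), Arith 23 Lt (Reg 18) (Reg 2),
          If_Nonzero (Reg 23) (store_cell 18 (Reg 24) (Reg 5)) Skip,
          Arith 18 Add (Reg 18) (Imm 1)]),
     Arith 22 Add (Reg 22) (Imm 1), Read_Input 22 (Reg 22)]"

definition expand :: com where
  "expand = seq [Read_Input 22 (Reg 1), While_Nonzero (Reg 22) visit_node]"

definition level_step :: com where
  "level_step = seq [
     If_Nonzero (Reg 21)
       (seq [Move 1 (Reg 20), Move 5 (Reg 20), read_trit, Arith 12 Eq (Reg 6) (Reg 16)])
       (seq [load_cell 1 20 (Reg 17), Move 12 (Imm 1)]),
     If_Nonzero (Reg 12) expand Skip,
     Arith 20 Add (Reg 20) (Imm 1), Arith 25 Lt (Reg 20) (Reg 19)]"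

text \<open>The subtractions from 3 and from 11 swap the colours 1 and 2 and the queue cells 5 and
  6.\<close>

definition level_loop :: com where
  "level_loop = seq [Arith 14 Sub (Imm 3) (Reg 16), Arith 24 Sub (Imm 11) (Reg 17),
     Move 18 (Imm 0), Move 20 (Imm 0), Arith 21 Lt (Reg 2) (Reg 15),
     If_Nonzero (Reg 21) (Move 19 (Reg 0)) (Move 19 (Reg 15)), Arith 25 Lt (Reg 20) (Reg 19),
     While_Nonzero (Reg 25) level_step,
     Move 15 (Reg 18), Move 16 (Reg 14), Move 17 (Reg 24)]"

text \<open>Doubling finds \<open>q\<close>; one more doubling leaves the threshold
  \<open>2 ^ (q + 1)\<close> of \<open>shift\<close> in register 24 for
  \<open>table_level\<close>.\<close>

definition init_params :: com where
  "init_params = seq [Move 2 (Imm 1), Move 24 (Imm 2), Arith 23 Lt (Reg 24) (Reg 0),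
     While_Nonzero (Reg 23)
       (seq [Arith 24 Add (Reg 24) (Reg 24), Arith 2 Add (Reg 2) (Imm 1),
          Arith 23 Lt (Reg 24) (Reg 0)]),
     Arith 24 Add (Reg 24) (Reg 24), Arith 3 Mul (Reg 2) (Imm 15)]"

definition data_start :: "nat \<Rightarrow> com" where
  "data_start r = seq [Arith r Add (Reg 2) (Imm 1), Arith r Mul (Reg r) (Imm 8),
     Arith r Mul (Reg r) (Reg 3)]"

definition halving :: com where
  "halving = seq [Arith 13 Add (Reg 13) (Imm 1), Arith 13 Shr (Reg 13) (Imm 1),
     Arith 8 Add (Reg 8) (Imm 1), Arith 12 Lt (Reg 24) (Reg 13)]"

definition table_level :: com where
  "table_level = seq [store_cell 7 (Imm 0) (Reg 9), store_cell 7 (Imm 2) (Reg 10),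
     Arith 13 Mul (Reg 9) (Reg 9), Move 8 (Imm 0), Arith 12 Lt (Reg 24) (Reg 13),
     While_Nonzero (Reg 12) halving,
     store_cell 7 (Imm 1) (Reg 8), Move 9 (Reg 13), Arith 7 Add (Reg 7) (Imm 1),
     Arith 11 Shr (Reg 0) (Reg 7), Arith 11 Add (Reg 11) (Imm 1),
     Arith 11 Mul (Reg 11) (Reg 8), Arith 10 Add (Reg 10) (Reg 11),
     Arith 23 Lt (Reg 7) (Reg 2)]"

definition init_table :: com where
  "init_table = seq [Move 7 (Imm 0), Move 9 (Imm 3), data_start 10, Arith 23 Lt (Reg 7) (Reg 2),
     While_Nonzero (Reg 23) table_level]"

definition init_zero :: com where
  "init_zero = seq [data_start 12, Arith 23 Lt (Reg 12) (Reg 10),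
     While_Nonzero (Reg 23)
       (seq [Store (Reg 12) (Imm 1) (Imm 0), Arith 12 Add (Reg 12) (Imm 1),
          Arith 23 Lt (Reg 12) (Reg 10)]),
     store_cell 2 (Imm 3) (Imm 0)]"

definition init_search :: com where
  "init_search = seq [Output (Reg 1), Move 5 (Reg 1), Move 14 (Imm 1), read_trit, write_trit,
     Move 7 (Imm 0), store_cell 7 (Imm 5) (Reg 1), Move 15 (Imm 1), Move 16 (Imm 1),
     Move 17 (Imm 5)]"

definition bfs_program :: com where
  "bfs_program = seq [init_params, init_table, init_zero, init_search,
     While_Nonzero (Reg 15) level_loop]"

section \<open>Access to the array\<close>

locale bfs_ram = word_ram w S rom b for w S rom b +
  fixes q n :: nat
  assumes q_pos: "1 \<le> q" and n_pos: "0 < n" and n_le: "n \<le> 2 ^ q"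
    and b_eq: "b = 36 * q" and S_eq: "S = addr q n (8 * (q + 1) * (15 * q)) q"
begin

section \<open>Estimates that exclude overflow\<close>

definition W :: nat where "W = 15 * q"

definition D :: nat where "D = 8 * (q + 1) * W"

text \<open>Fits into one cell. A product of two such numbers has at most \<open>30 * q\<close> bits
  and thus fits into a register, so most overflow conditions reduce to smallness of the factors or
  of the result.\<close>

definition small :: "nat \<Rightarrow> bool" where "small x \<longleftrightarrow> x < 2 ^ W"

lemma S_eq': "S = addr q n D q"
  by (simp add: S_eq D_def W_def)

lemma small_less: "small x \<Longrightarrow> x < 2 ^ b"
  unfolding small_def by (erule less_le_trans) (simp add: W_def b_eq)

lemma small_le: "small y \<Longrightarrow> x \<le> y \<Longrightarrow> small x"
  by (simp add: small_def)

lemma small_mult: "small x \<Longrightarrow> small y \<Longrightarrow> x * y < 2 ^ b"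
proof -
  assume "small x" "small y"
  then have "x * y < 2 ^ W * 2 ^ W" unfolding small_def by (intro mult_strict_mono) auto
  also have "\<dots> \<le> 2 ^ b" by (simp add: W_def b_eq flip: power_add)
  finally show ?thesis .
qed

lemma small_add: "small x \<Longrightarrow> small y \<Longrightarrow> x + y < 2 ^ b"
proof -
  assume "small x" "small y"
  then have "x + y < 2 * 2 ^ W" by (simp add: small_def)
  also have "\<dots> = 2 ^ Suc W" by simp
  also have "\<dots> \<le> 2 ^ b" using q_pos by (intro power_increasing) (auto simp: W_def b_eq)
  finally show ?thesis .
qed

lemma two_le: "(2 :: nat) \<le> 2 ^ q"
  using power_increasing[OF q_pos, of "2 :: nat"] by simp

lemma q_less: "q + 1 \<le> 2 ^ q"
  using Suc_leI[OF less_exp[of q]] by simp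

text \<open>With \<open>P = 2 ^ q >= 2\<close> the left-hand side is at most
  \<open>72 * P ^ 3\<close>, and \<open>72 < 2 ^ 7 <= P ^ 7\<close>, so \<open>P ^ 10\<close>
  suffices. The middle summand covers squares of bases and, later, the length of the input.\<close>

lemma S_bound: "S + 4 * 2 ^ q * 2 ^ q + 16 < 2 ^ W"
proof -
  define P :: nat where "P = 2 ^ q"
  have P: "2 \<le> P" "q + 1 \<le> P" "n \<le> P" using two_le q_less n_le by (simp_all add: P_def)
  have "(\<Sum>i<q. width q i * (n div 2 ^ (i + 1) + 1)) \<le> (\<Sum>i<q. (4 * P) * (2 * P))"
  proof (intro sum_mono mult_le_mono)
    fix i
    show "width q i \<le> 4 * P" using width_le[OF q_pos, of i] P by linarith
    show "n div 2 ^ (i + 1) + 1 \<le> 2 * P" using P div_le_dividend[of n "2 ^ (i + 1)"] by linarith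
  qed
  also have "\<dots> \<le> P * (8 * P * P)" using P by (simp add: mult_le_mono1)
  finally have 1: "S \<le> D + 8 * P * P * P" by (simp add: S_eq' addr_def mult_ac)
  have "D \<le> 8 * P * (15 * P)" unfolding D_def W_def using P by (intro mult_le_mono) auto
  also have "\<dots> \<le> 60 * P * P * P" using P by simp
  finally have "S \<le> 68 * P * P * P" using 1 by linarith
  moreover have "4 * P * P \<le> 2 * P * P * P" using P by simp
  moreover have "2 * 2 * 2 \<le> P * P * P" using P by (intro mult_le_mono) auto
  ultimately have "S + 4 * P * P + 16 \<le> 72 * (P * P * P)" by linarith
  also have "\<dots> < 2 ^ 7 * (P * P * P)" using P by simp
  also have "\<dots> \<le> P ^ 7 * (P * P * P)" using P by (intro mult_le_mono power_mono) auto
  also have "P ^ 7 * (P * P * P) = P ^ (7 + 3)" by (simp only: power_add power3_eq_cube)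
  also have "\<dots> = 2 ^ (q * 10)" by (simp add: P_def flip: power_mult)
  also have "\<dots> \<le> 2 ^ W" by (simp add: W_def)
  finally show ?thesis by (simp add: P_def)
qed

lemma small_S: "x \<le> S \<Longrightarrow> small x"
  and small_const: "x \<le> 16 \<Longrightarrow> small x"
  and small_square: "x \<le> 4 * 2 ^ q * 2 ^ q \<Longrightarrow> small x"
  using S_bound by (simp_all add: small_def)

lemma D_le_S: "D \<le> S"
  by (simp add: S_eq' addr_ge)

lemma small_width: "small (width q j)"
proof (rule small_square)
  have "width q j \<le> 4 * 2 ^ q * 1" using width_le[OF q_pos, of j] q_less by linarith
  also have "\<dots> \<le> 4 * 2 ^ q * 2 ^ q" by (intro mult_le_mono2) simp
  finally show "width q j \<le> 4 * 2 ^ q * 2 ^ q" .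
qed

lemma base_square: "base q j * base q j \<le> 4 * 2 ^ q * 2 ^ q"
  using base_square_le[OF q_pos, of j] by (simp add: power_add mult_2)

lemma small_base: "small (base q j)"
  by (rule small_square, rule order_trans[OF le_square base_square])

lemma W_pos: "0 < W" using q_pos by (simp add: W_def)

lemma W_le_b: "W \<le> b" by (simp add: W_def b_eq)

lemma width_le_b: "width q j \<le> b"
  using width_le[OF q_pos, of j] q_pos by (simp add: b_eq)

lemma cell_bound: "k < 8 * (q + 1) \<Longrightarrow> k * W + W \<le> D"
  using mult_le_mono1[of "Suc k" "8 * (q + 1)" W] by (simp add: D_def)

lemma small_q: "small q"
proof (rule small_square)
  have "q \<le> 2 ^ q * 1" using q_less by simp
  also have "\<dots> \<le> 2 ^ q * (4 * 2 ^ q)" by (intro mult_le_mono2) simp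
  finally show "q \<le> 4 * 2 ^ q * 2 ^ q" by (simp add: mult_ac)
qed

lemma small_index: "j \<le> q \<Longrightarrow> i < 8 \<Longrightarrow> small (8 * j + i)"
proof -
  assume "j \<le> q" "i < 8"
  then have "8 * j + i \<le> D"
    using mult_le_mono[of "8 * j + i" "8 * (q + 1)" 1 W] W_pos by (simp add: D_def)
  then show ?thesis using D_le_S by (intro small_S) simp
qed

text \<open>As in all derived rules, the continuation is required for every counter up to a bound,
  since only upper bounds on time matter, and for every value \<open>v\<close> of the scratch
  register 4.\<close>

lemma wp_load_cell:
  assumes "small_operand x" "x \<noteq> Reg 4" "j \<noteq> 4" and "g 3 = W" "g j \<le> q" "val g x < 8"
    and "\<And>k' v. k' \<le> k + 7 \<Longrightarrow> Q k' (g(4 := v, r := cell W f (8 * g j + val g x))) f out"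
  shows "wp (load_cell r j x) Q k g f out"
proof -
  have small: "small (8 * g j + val g x)" using assms by (intro small_index)
  then have b: "g j * 8 < 2 ^ b" "g j * 8 + val g x < 2 ^ b"
    by (auto dest: small_less simp: mult.commute)
  have v: "val (g(4 := y)) x = val g x" for y using assms(2) by (cases x) auto
  have "small W" using q_pos by (intro small_S) (use D_le_S cell_bound[of 0] in simp)
  with small have c: "(g j * 8 + val g x) * W < 2 ^ b" by (simp add: small_mult mult.commute[of _ 8])
  show ?thesis
    unfolding load_cell_def seq.simps
    apply (rule wp_Seq, rule wp_Mul, simp, simp, simp add: b)
    apply (rule wp_Seq, rule wp_Add, simp, simp add: assms, simp add: v b)
    apply (rule wp_Seq, rule wp_Mul, simp, simp, simp add: v c assms(4,6))
    apply (rule wp_Load, simp, simp)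
    using W_le_b assms(4) apply simp
    using assms(3-6) D_le_S cell_bound[of "8 * g j + val g x"]
     apply (simp add: v mult.commute[of _ 8])
    using assms(3-4) apply (simp add: v mult.commute[of _ 8])
    by (rule assms(7)[unfolded cell_def]) simp
qed

lemma wp_store_cell:
  assumes "small_operand x" "x \<noteq> Reg 4" "j \<noteq> 4" "small_operand y" "y \<noteq> Reg 4"
    and "g 3 = W" "g j \<le> q" "val g x < 8"
    and "\<And>k' v. k' \<le> k + 7 \<Longrightarrow> Q k' (g(4 := v)) (set_cell W (8 * g j + val g x) (val g y) f) out"
  shows "wp (store_cell j x y) Q k g f out"
proof -
  have small: "small (8 * g j + val g x)" using assms by (intro small_index)
  then have b: "g j * 8 < 2 ^ b" "g j * 8 + val g x < 2 ^ b"
    by (auto dest: small_less simp: mult.commute)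
  have v: "val (g(4 := z)) x = val g x" "val (g(4 := z)) y = val g y" for z
    using assms(2,5) by (cases x; auto; cases y; auto)+
  have "small W" using q_pos by (intro small_S) (use D_le_S cell_bound[of 0] in simp)
  with small have c: "(g j * 8 + val g x) * W < 2 ^ b" by (simp add: small_mult mult.commute[of _ 8])
  show ?thesis
    unfolding store_cell_def seq.simps
    apply (rule wp_Seq, rule wp_Mul, simp, simp, simp add: b)
    apply (rule wp_Seq, rule wp_Add, simp, simp add: assms, simp add: v b)
    apply (rule wp_Seq, rule wp_Mul, simp, simp, simp add: v c assms(6))
    apply (rule wp_Store, simp, simp, simp add: assms)
    using W_le_b assms(6) apply simp
    using assms(3-8) D_le_S cell_bound[of "8 * g j + val g x"]
     apply (simp add: v mult.commute[of _ 8])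
    using assms(3-6) apply (simp add: v mult.commute[of _ 8])
    by (rule assms(9)[unfolded set_cell_def]) simp
qed

section \<open>Invariants and rules for reading and writing the array\<close>

definition table_ok :: "(nat \<Rightarrow> bool) \<Rightarrow> bool" where
  "table_ok f \<longleftrightarrow> (\<forall>j<q. cell W f (8 * j) = base q j \<and> cell W f (8 * j + 1) = width q j \<and>
     cell W f (8 * j + 2) = addr q n D j)"

lemma wp_level_info:
  assumes "table_ok f" "g 3 = W" "g 7 < q" "g 5 < n"
    and Q: "\<And>k' g'. k' \<le> k + 40 \<Longrightarrow> g' 8 = width q (g 7) \<Longrightarrow> g' 9 = base q (g 7) \<Longrightarrow>
      g' 10 = addr q n D (g 7) + g 5 div 2 ^ g 7 div 2 * width q (g 7) \<Longrightarrow>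
      g' 11 = g 5 div 2 ^ g 7 \<Longrightarrow> g' 12 = g 5 div 2 ^ g 7 mod 2 \<Longrightarrow>
      (\<And>r. r \<notin> {4, 8, 9, 10, 11, 12} \<Longrightarrow> g' r = g r) \<Longrightarrow> Q k' g' f out"
  shows "wp level_info Q k g f out"
proof -
  have cells: "cell W f (8 * g 7) = base q (g 7)" "cell W f (8 * g 7 + 1) = width q (g 7)"
     "cell W f (8 * g 7 + 2) = addr q n D (g 7)"
    using assms by (auto simp: table_ok_def)
  define p where "p = g 5 div 2 ^ g 7 div 2"
  have p: "p \<le> n div 2 ^ (g 7 + 1)"
    unfolding p_def using assms(4) by (simp add: div_le_mono flip: div_mult2_eq power_Suc2)
  have "addr q n D (g 7) + p * width q (g 7) + width q (g 7) \<le> addr q n D (Suc (g 7))"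
    by (rule field_end[OF p])
  also have "\<dots> \<le> S" unfolding S_eq' using assms(3) by (intro addr_mono) simp
  finally have "small (addr q n D (g 7) + p * width q (g 7))" "small (p * width q (g 7))"
    by (auto intro: small_S)
  note bounds = this[THEN small_less]
  show ?thesis
    unfolding level_info_def seq.simps
    apply (rule wp_Seq, rule wp_load_cell, simp, simp, simp, simp add: assms, use assms in simp, simp)
    apply (rule wp_Seq, rule wp_load_cell, simp, simp, simp, simp add: assms, use assms in simp, simp)
    apply (rule wp_Seq, rule wp_load_cell, simp, simp, simp, simp add: assms, use assms in simp, simp)
    apply (rule wp_Seq, rule wp_Shr, simp, simp)
    apply (rule wp_Seq, rule wp_Shr, simp, simp)
    apply (rule wp_Seq, rule wp_Mul, simp, simp)
    using bounds cells apply (simp add: p_def)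
    apply (rule wp_Seq, rule wp_Add, simp, simp)
    using bounds cells apply (simp add: p_def)
    apply (rule wp_Mod, simp, simp)
    using cells by (intro Q) simp_all
qed

text \<open>The fourth cell of each record is scratch space; all others survive array accesses.\<close>

definition same_cells :: "(nat \<Rightarrow> bool) \<Rightarrow> (nat \<Rightarrow> bool) \<Rightarrow> bool" where
  "same_cells f f' \<longleftrightarrow> (\<forall>k<8 * (q + 1). k mod 8 \<noteq> 3 \<longrightarrow> cell W f' k = cell W f k)"

definition array_ok :: "(nat \<Rightarrow> nat) \<Rightarrow> (nat \<Rightarrow> bool) \<Rightarrow> bool" where
  "array_ok col f \<longleftrightarrow> table_ok f \<and> (\<forall>i. col i < 3) \<and> stored q n D 0 col col f \<and>
     cell W f (8 * q + 3) = node q col q 0"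

text \<open>The interface between a read and the following write: the descent fills these cells from
  the root downwards, hence the lower limit \<open>l\<close>.\<close>

definition path_saved :: "(nat \<Rightarrow> nat) \<Rightarrow> nat \<Rightarrow> nat \<Rightarrow> (nat \<Rightarrow> bool) \<Rightarrow> bool" where
  "path_saved col u l f \<longleftrightarrow>
     (\<forall>j. l \<le> j \<longrightarrow> j < q \<longrightarrow> cell W f (8 * j + 3) = pair q col j (u div 2 ^ (j + 1)))"

lemma same_cells_refl: "same_cells f f"
  by (simp add: same_cells_def)

lemma same_cells_trans: "same_cells f f' \<Longrightarrow> same_cells f' f'' \<Longrightarrow> same_cells f f''"
  by (simp add: same_cells_def)

lemma same_cells_set_cell: "x < 2 ^ W \<Longrightarrow> same_cells f (set_cell W (8 * j + 3) x f)"
  by (auto simp: same_cells_def cell_set_cell)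

lemma cell_set_data:
  "k < 8 * (q + 1) \<Longrightarrow> D \<le> a \<Longrightarrow> cell W (set_field a l x f) k = cell W f k"
  using cell_bound[of k] by (intro cell_set_field) simp

lemma same_cells_table: "same_cells f f' \<Longrightarrow> table_ok f \<Longrightarrow> table_ok f'"
proof -
  assume *: "same_cells f f'" "table_ok f"
  have "cell W f' (8 * j) = cell W f (8 * j)" "cell W f' (8 * j + 1) = cell W f (8 * j + 1)"
    "cell W f' (8 * j + 2) = cell W f (8 * j + 2)" if "j < q" for j
    using that by (intro *(1)[unfolded same_cells_def, rule_format]; simp; presburger)+
  with *(2) show ?thesis by (simp add: table_ok_def)
qed

lemma index_le: "u < n \<Longrightarrow> u div 2 ^ j div 2 \<le> n div 2 ^ (j + 1)"
  by (simp add: div_le_mono flip: div_mult2_eq power_Suc2)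

lemma field_le_S:
  assumes "u < n" "j < q"
  shows "addr q n D j + u div 2 ^ j div 2 * width q j + width q j \<le> S"
  using field_end[OF index_le[OF assms(1)], of q D j] addr_mono[of "Suc j" q q n D] assms(2)
  by (simp add: S_eq')

lemma small_pair: "(\<And>i. col i < 3) \<Longrightarrow> small (pair q col j i)"
  using pair_less[of col q j i] base_square[of j] by (intro small_square) simp

lemma small_node: "(\<And>i. col i < 3) \<Longrightarrow> small (node q col j i)"
  using node_less[of col q j i] by (intro small_le[OF small_base[of j]]) simp

lemma wp_read_level:
  assumes "table_ok f" "stored q n D 0 col col f" and col: "\<And>i. col i < 3"
    and g: "g 3 = W" "g 7 \<noteq> 0" "g 7 \<le> q" "g 5 < n" "g 6 = node q col (g 7) (g 5 div 2 ^ g 7)"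
    and Q: "\<And>k' g'. k' \<le> k + 80 \<Longrightarrow> g' 7 = g 7 - 1 \<Longrightarrow>
      g' 6 = node q col (g 7 - 1) (g 5 div 2 ^ (g 7 - 1)) \<Longrightarrow>
      (\<And>r. r \<notin> {4, 6, 7, 8, 9, 10, 11, 12, 13} \<Longrightarrow> g' r = g r) \<Longrightarrow>
      Q k' g' (set_cell W (8 * (g 7 - 1) + 3) (pair q col (g 7 - 1) (g 5 div 2 ^ g 7)) f) out"
  shows "wp read_level Q k g f out"
proof -
  define j where "j = g 7 - 1"
  have j: "j < q" "g 7 = Suc j" using g by (auto simp: j_def)
  define u where "u = g 5"
  have u: "u < n" using g by (simp add: u_def)
  define z where "z = pair q col j (u div 2 ^ j div 2)"
  have u2: "u div 2 ^ g 7 = u div 2 ^ j div 2"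
    by (simp add: j(2) flip: div_mult2_eq power_Suc2)
  \<comment> \<open>The field holds the low part of the pair and the parent is its high part;
    together they restore it.\<close>
  have g6: "z mod 2 ^ width q j + g 6 * 2 ^ width q j = z"
  proof -
    have "g 6 = z div 2 ^ width q j"
      using g(5) unfolding u_def[symmetric] u2 unfolding j(2) node_Suc z_def .
    then show ?thesis by (simp only: mod_div_mult_eq)
  qed
  have small_z: "small z" unfolding z_def using col by (rule small_pair)
  have field: "get_field f (addr q n D j + u div 2 ^ j div 2 * width q j) (width q j) =
      z mod 2 ^ width q j"
    using assms(2) j(1) index_le[OF u] by (simp add: stored_def z_def)
  have le: "g 6 * 2 ^ width q j \<le> z" using g6 by linarith
  note b = small_less[OF small_z] small_less[OF small_le[OF small_z le]]
  have node: "node q col j (u div 2 ^ j) =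
      (if u div 2 ^ j mod 2 \<noteq> 0 then z mod base q j else z div base q j)"
    using node_pair[of col, OF col] by (simp add: z_def even_iff_mod_2_eq_zero)
  have Q': "Q k' g' (set_cell W (8 * j + 3) z f) out"
    if "k' \<le> k + 80" "g' 7 = j" "g' 6 = node q col j (u div 2 ^ j)"
      "\<And>r. r \<notin> {4, 6, 7, 8, 9, 10, 11, 12, 13} \<Longrightarrow> g' r = g r" for k' g'
    using Q[of k' g', folded j_def u_def, unfolded u2, folded z_def] that by simp
  show ?thesis
    unfolding read_level_def seq.simps
    apply (rule wp_Seq, rule wp_Sub, simp, simp, use g in simp)
    apply (rule wp_Seq, rule wp_level_info, rule assms(1), simp add: g, simp add: j, simp add: g)
    subgoal for k' g'
      using g(1-4) j u field g6 b
      apply (simp add: u_def[symmetric])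
      apply (rule wp_Seq, rule wp_Shl, simp, simp, simp add: push_bit_eq_mult)
      apply (rule wp_Seq, rule wp_Load, simp, simp, simp add: width_le_b)
       apply (simp add: field_le_S)
      apply (rule wp_Seq, rule wp_Add, simp, simp)
       apply (simp add: push_bit_eq_mult)
      apply (rule wp_Seq, rule wp_store_cell)
              apply (simp_all add: push_bit_eq_mult)
      apply (rule wp_If, simp)
      subgoal
        by (rule wp_Mod, simp, simp, rule Q') (simp_all add: node)
      subgoal
        by (rule wp_Div, simp, simp, rule Q') (simp_all add: node)
      done
    done
qed


lemma array_ok_set_path:
  assumes "array_ok col f" "j < q" "x < 2 ^ W"
  shows "array_ok col (set_cell W (8 * j + 3) x f)"
proof -
  have "Suc (8 * j + 3) * W \<le> D" using cell_bound[of "8 * j + 3"] assms(2) by (simp add: algebra_simps)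
  then have "stored q n D 0 col col (set_cell W (8 * j + 3) x f)"
    using assms(1) by (simp add: array_ok_def stored_set_cell)
  moreover have "table_ok (set_cell W (8 * j + 3) x f)"
    using assms by (intro same_cells_table[OF same_cells_set_cell]) (auto simp: array_ok_def)
  ultimately show ?thesis using assms by (simp add: array_ok_def cell_set_cell)
qed

lemma wp_read_trit:
  assumes "array_ok col f" and g: "g 3 = W" "g 2 = q" "g 5 < n"
    and Q: "\<And>k' g' f'. k' \<le> k + 90 * (q + 1) \<Longrightarrow> g' 6 = col (g 5) \<Longrightarrow>
      (\<And>r. r \<notin> {4, 6, 7, 8, 9, 10, 11, 12, 13} \<Longrightarrow> g' r = g r) \<Longrightarrow>
      array_ok col f' \<Longrightarrow> path_saved col (g 5) 0 f' \<Longrightarrow> same_cells f f' \<Longrightarrow> Q k' g' f' out"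
  shows "wp read_trit Q k g f out"
proof -
  define u where "u = g 5"
  \<comment> \<open>As \<open>n <= 2 ^ q\<close>, node 0 at height \<open>q\<close> is an ancestor
    of every vertex, so the descent starts at the number kept in the last record.\<close>
  have u: "u < n" "u div 2 ^ q = 0" using g n_le by (auto simp: u_def)
  have col: "col i < 3" for i using assms(1) by (simp add: array_ok_def)
  \<comment> \<open>Per level 80 steps for the body and 2 for the loop. At height 0 the number of
    the node is the colour itself.\<close>
  define I where "I m g' f' out' \<longleftrightarrow> m = 82 * g' 7 \<and> g' 7 \<le> q \<and>
    g' 6 = node q col (g' 7) (u div 2 ^ g' 7) \<and>
    (\<forall>r. r \<notin> {4, 6, 7, 8, 9, 10, 11, 12, 13} \<longrightarrow> g' r = g r) \<and>
    array_ok col f' \<and> path_saved col u (g' 7) f' \<and> same_cells f f' \<and> out' = out"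
    for m :: nat and g' f' out'
  have step: "wp read_level (\<lambda>k' g' f' out'. \<exists>m'. I m' g' f' out' \<and> k' + 2 + m' \<le> k + m) k g' f' out'"
    if I: "I m g' f' out'" and "val g' (Reg 7) \<noteq> 0" for m k g' f' out'
  proof (rule wp_read_level[where col = col])
    show "table_ok f'" "stored q n D 0 col col f'" "g' 7 \<le> q" "col i < 3" for i
      using I by (auto simp: I_def array_ok_def)
    show "g' 3 = W" "g' 7 \<noteq> 0" "g' 5 < n" "g' 6 = node q col (g' 7) (g' 5 div 2 ^ g' 7)"
      using that g by (auto simp: I_def u_def)
    have g5: "g' 5 = u" using I by (simp add: I_def u_def)
    define j where "j = g' 7 - 1"
    have j: "j < q" "g' 7 = Suc j" using that by (auto simp: I_def j_def)
    fix k' g''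
    define x where "x = pair q col (g' 7 - 1) (g' 5 div 2 ^ g' 7)"
    assume *: "k' \<le> k + 80" "g'' 7 = g' 7 - 1"
      "g'' 6 = node q col (g' 7 - 1) (g' 5 div 2 ^ (g' 7 - 1))"
      "\<And>r. r \<notin> {4, 6, 7, 8, 9, 10, 11, 12, 13} \<Longrightarrow> g'' r = g' r"
    have x: "x = pair q col j (u div 2 ^ (j + 1))" "x < 2 ^ W"
      using small_pair[of col, OF col] by (simp_all add: x_def j(2) g5 small_def)
    have "path_saved col u j (set_cell W (8 * j + 3) x f')"
      using I x by (auto simp: path_saved_def I_def cell_set_cell j(2) Suc_le_eq)
    moreover have "array_ok col (set_cell W (8 * j + 3) x f')"
      using I x(2) j(1) by (intro array_ok_set_path) (auto simp: I_def)
    moreover have "same_cells f (set_cell W (8 * j + 3) x f')"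
      using I same_cells_set_cell[OF x(2)] by (auto simp: I_def intro: same_cells_trans)
    ultimately have "I (82 * j) g'' (set_cell W (8 * (g' 7 - 1) + 3) x f') out'"
      using I * j by (auto simp: I_def g5)
    then show "\<exists>m'. I m' g'' (set_cell W (8 * (g' 7 - 1) + 3)
        (pair q col (g' 7 - 1) (g' 5 div 2 ^ g' 7)) f') out' \<and> k' + 2 + m' \<le> k + m"
      unfolding x_def[symmetric] using I[unfolded I_def] *(1) j
      by (intro exI[of _ "82 * j"] conjI) simp_all
  qed
  have start: "I (82 * q) (g(4 := v, 6 := cell W f (8 * q + 3), 7 := q)) f out" for v
    using assms(1) g u by (auto simp: I_def array_ok_def path_saved_def same_cells_refl)
  show ?thesis
    unfolding read_trit_def seq.simps
    apply (rule wp_Seq, rule wp_load_cell, simp, simp, simp, simp add: g, simp add: g, simp)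
    apply (rule wp_Seq, rule wp_Move, simp)
    apply (rule wp_While[where I = I and m = "82 * q"], simp)
    using start g(2) apply simp
     apply (rule step, assumption, assumption)
    apply (clarsimp simp: I_def)
    apply (rule Q)
         apply (auto simp: u_def)
    done
qed

lemma wp_write_level:
  assumes "table_ok f" and col: "\<And>i. col i < 3" and t: "t < 3"
    and g: "g 3 = W" "g 7 < q" "g 5 < n" "g 6 = node q (col(g 5 := t)) (g 7) (g 5 div 2 ^ g 7)"
    and saved: "cell W f (8 * g 7 + 3) = pair q col (g 7) (g 5 div 2 ^ (g 7 + 1))"
    and stored: "stored q n D (g 7) col (col(g 5 := t)) f"
    and Q: "\<And>k' g' f'. k' \<le> k + 90 \<Longrightarrow> g' 7 = g 7 + 1 \<Longrightarrow>
      g' 6 = node q (col(g 5 := t)) (g 7 + 1) (g 5 div 2 ^ (g 7 + 1)) \<Longrightarrow>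
      g' 23 = of_bool (g 7 + 1 < g 2) \<Longrightarrow>
      (\<And>r. r \<notin> {4, 6, 7, 8, 9, 10, 11, 12, 13, 23} \<Longrightarrow> g' r = g r) \<Longrightarrow>
      (\<And>i. i < 8 * (q + 1) \<Longrightarrow> cell W f' i = cell W f i) \<Longrightarrow>
      stored q n D (g 7 + 1) col (col(g 5 := t)) f' \<Longrightarrow> Q k' g' f' out"
  shows "wp write_level Q k g f out"
proof -
  define j where "j = g 7"
  define u where "u = g 5"
  have gj: "g 7 = j" "g 5 = u" by (simp_all add: j_def u_def)
  have u: "u < n" and j: "j < q" using g by (simp_all add: u_def j_def)
  define col' where "col' = col(u := t)"
  have col': "col' i < 3" for i using col t by (simp add: col'_def)
  define p where "p = u div 2 ^ j div 2"
  define z where "z = pair q col j p"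
  define z' where "z' = pair q col' j p"
  define a where "a = addr q n D j + p * width q j"
  define f' where "f' = set_field a (width q j) z' f"
  have p: "p = u div 2 ^ (j + 1)" by (simp add: p_def flip: div_mult2_eq power_Suc2)
  have z': "z' = (if u div 2 ^ j mod 2 \<noteq> 0 then z div base q j * base q j + g 6
      else g 6 * base q j + z mod base q j)"
    using pair_upd[where col = col and t = t and q = q and j = j and u = u] col t g(4)
    by (simp add: z'_def z_def p_def col'_def u_def j_def even_iff_mod_2_eq_zero)
  have small: "small z'" "small (z mod base q j)" "small (g 6)"
    unfolding z'_def using small_pair[of col', OF col'] small_node[of col', OF col'] g(4)
      small_le[OF small_base mod_le_divisor[OF base_pos]] by (auto simp: col'_def u_def)
  \<comment> \<open>The intermediate product is a summand of the new pair, so one bound covers all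
    the arithmetic of the update.\<close>
  have "z' < 2 ^ b" using small(1) by (rule small_less)
  then have b: "u div 2 ^ j mod 2 \<noteq> 0 \<Longrightarrow> z div base q j * base q j + g 6 < 2 ^ b"
    "u div 2 ^ j mod 2 \<noteq> 0 \<Longrightarrow> z div base q j * base q j < 2 ^ b"
    "u div 2 ^ j mod 2 = 0 \<Longrightarrow> g 6 * base q j + z mod base q j < 2 ^ b"
    "u div 2 ^ j mod 2 = 0 \<Longrightarrow> g 6 * base q j < 2 ^ b"
    unfolding z' by (auto split: if_splits)
  have zz: "u div 2 ^ j mod 2 = Suc 0 \<Longrightarrow> z div base q j * base q j + g 6 = z'"
    "u div 2 ^ j mod 2 = 0 \<Longrightarrow> g 6 * base q j + z mod base q j = z'"
    unfolding z' by auto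
  have j2: "small (j + 1)" using j by (intro small_le[OF small_q]) simp
  have cells: "cell W f' i = cell W f i" if "i < 8 * (q + 1)" for i
    unfolding f'_def using that addr_ge[of D q n j] by (intro cell_set_data) (auto simp: a_def)
  have st: "stored q n D (j + 1) col col' f'"
    using stored_upd[of q n D j col u t f] stored u j
    by (simp add: j_def u_def col'_def f'_def a_def z'_def p)
  have field: "a + width q j \<le> S" using field_le_S[OF u j] by (simp add: a_def p_def)
  have Q': "Q k' g' f' out"
    if "k' \<le> k + 90" "g' 7 = j + 1" "g' 6 = z' div 2 ^ width q j" "g' 23 = of_bool (j + 1 < g 2)"
      "\<And>r. r \<notin> {4, 6, 7, 8, 9, 10, 11, 12, 13, 23} \<Longrightarrow> g' r = g r" for k' g'
  proof (rule Q)
    show "g' 6 = node q (col(g 5 := t)) (g 7 + 1) (g 5 div 2 ^ (g 7 + 1))"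
      using that(3) by (simp add: node_Suc z'_def p col'_def u_def j_def)
  qed (use that cells st in \<open>simp_all add: j_def u_def col'_def\<close>)
  show ?thesis
    unfolding write_level_def seq.simps
    apply (rule wp_Seq, rule wp_level_info, rule assms(1), simp add: g, simp add: g, simp add: g)
    subgoal for k' g'
      using g(1-3) saved
      apply (simp only: u_def[symmetric] j_def[symmetric] p[symmetric] p_def[symmetric] z_def[symmetric] a_def[symmetric])
      using gj
      apply -
      apply (rule wp_Seq, rule wp_load_cell, simp, simp, simp, simp, simp, simp)
      subgoal for k'' v
        apply (rule wp_Seq, rule wp_If, simp)
        subgoal
          apply simp
          apply (rule wp_Seq, rule wp_Div, simp, simp)
          apply (rule wp_Seq, rule wp_Mul, simp, simp, simp add: b)
          apply (rule wp_Add, simp, simp, simp add: b)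
          apply (rule wp_Seq, rule wp_Store, simp, simp, simp, simp add: width_le_b, simp add: field)
          apply (rule wp_Seq, rule wp_Shr, simp, simp)
          apply (rule wp_Seq, rule wp_Add, simp, simp)
          using small_less[OF j2] apply simp
          apply (rule wp_Lt, simp, simp)
          apply (simp add: zz flip: f'_def)
          by (intro conjI impI; rule Q'; simp)
        subgoal
          apply simp
          apply (rule wp_Seq, rule wp_Mod, simp, simp)
          apply (rule wp_Seq, rule wp_Mul, simp, simp, simp add: b)
          apply (rule wp_Add, simp, simp, simp add: b)
          apply (rule wp_Seq, rule wp_Store, simp, simp, simp, simp add: width_le_b, simp add: field)
          apply (rule wp_Seq, rule wp_Shr, simp, simp)
          apply (rule wp_Seq, rule wp_Add, simp, simp)
          using small_less[OF j2] apply simp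
          apply (rule wp_Lt, simp, simp)
          apply (simp add: zz flip: f'_def)
          by (intro conjI impI; rule Q'; simp)
        done
      done
    done
qed

lemma wp_write_trit:
  assumes "array_ok col f" and g: "g 3 = W" "g 2 = q" "g 5 < n" and t: "g 14 < 3"
    and "path_saved col (g 5) 0 f"
    and Q: "\<And>k' g' f'. k' \<le> k + 110 * (q + 1) \<Longrightarrow>
      (\<And>r. r \<notin> {4, 6, 7, 8, 9, 10, 11, 12, 13, 23} \<Longrightarrow> g' r = g r) \<Longrightarrow>
      array_ok (col(g 5 := g 14)) f' \<Longrightarrow> same_cells f f' \<Longrightarrow> Q k' g' f' out"
  shows "wp write_trit Q k g f out"
proof -
  define u where "u = g 5"
  define col' where "col' = col(u := g 14)"
  have u: "u < n" "u div 2 ^ q = 0" using g n_le by (auto simp: u_def)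
  have col: "col i < 3" for i using assms(1) by (simp add: array_ok_def)
  have col': "col' i < 3" for i using col t by (simp add: col'_def)
  define I where "I m g' f' out' \<longleftrightarrow> m = 92 * (q - g' 7) \<and> g' 7 \<le> q \<and>
    g' 6 = node q col' (g' 7) (u div 2 ^ g' 7) \<and> g' 23 = of_bool (g' 7 < q) \<and>
    (\<forall>r. r \<notin> {4, 6, 7, 8, 9, 10, 11, 12, 13, 23} \<longrightarrow> g' r = g r) \<and>
    (\<forall>i<8 * (q + 1). cell W f' i = cell W f i) \<and> stored q n D (g' 7) col col' f' \<and> out' = out"
    for m :: nat and g' f' out'
  have step: "wp write_level (\<lambda>k' g' f' out'. \<exists>m'. I m' g' f' out' \<and> k' + 2 + m' \<le> k + m) k g' f' out'"
    if I: "I m g' f' out'" and "val g' (Reg 23) \<noteq> 0" for m k g' f' out'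
  proof -
    have 1: "g' 5 = u" "g' 7 < q" "g' 3 = W" "g' 2 = q" "g' 14 = g 14"
      using that g by (auto simp: I_def u_def split: if_splits)
    have cells: "cell W f' i = cell W f i" if "i < 8 * (q + 1)" for i
      using I that by (simp add: I_def)
    show ?thesis
    proof (rule wp_write_level[where col = col and t = "g 14"])
      show "table_ok f'"
        by (rule same_cells_table[of f]) (use assms(1) cells in \<open>auto simp: same_cells_def array_ok_def\<close>)
      show "cell W f' (8 * g' 7 + 3) = pair q col (g' 7) (g' 5 div 2 ^ (g' 7 + 1))"
        using assms(6) 1 cells[of "8 * g' 7 + 3"] by (simp add: path_saved_def u_def)
      show "g' 6 = node q (col(g' 5 := g 14)) (g' 7) (g' 5 div 2 ^ g' 7)"
        "stored q n D (g' 7) col (col(g' 5 := g 14)) f'"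
        using I 1 by (simp_all add: I_def col'_def)
    next
      fix k' g'' f''
      assume *: "k' \<le> k + 90" "g'' 7 = g' 7 + 1"
        "g'' 6 = node q (col(g' 5 := g 14)) (g' 7 + 1) (g' 5 div 2 ^ (g' 7 + 1))"
        "g'' 23 = of_bool (g' 7 + 1 < g' 2)"
        "\<And>r. r \<notin> {4, 6, 7, 8, 9, 10, 11, 12, 13, 23} \<Longrightarrow> g'' r = g' r"
        "\<And>i. i < 8 * (q + 1) \<Longrightarrow> cell W f'' i = cell W f' i"
        "stored q n D (g' 7 + 1) col (col(g' 5 := g 14)) f''"
      have "I (92 * (q - g'' 7)) g'' f'' out'"
        using I 1 * by (simp add: I_def col'_def)
      moreover have "k' + 2 + 92 * (q - g'' 7) \<le> k + m"
        using I 1(2) *(1,2) by (simp add: I_def)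
      ultimately show "\<exists>m'. I m' g'' f'' out' \<and> k' + 2 + m' \<le> k + m" by blast
    qed (use 1 u col t in auto)
  qed
  have start: "I (92 * q) (g(7 := 0, 6 := g 14, 23 := of_bool (0 < q))) f out"
    using assms(1) by (auto simp: I_def array_ok_def stored_def col'_def)
  have fin: "array_ok col' (set_cell W (8 * q + 3) (node q col' q 0) f')" (is ?A)
    "same_cells f (set_cell W (8 * q + 3) (node q col' q 0) f')" (is ?S)
    if "stored q n D q col col' f'" "\<forall>i<8 * (q + 1). cell W f' i = cell W f i" for f'
  proof -
    let ?f = "set_cell W (8 * q + 3) (node q col' q 0) f'"
    have x: "node q col' q 0 < 2 ^ W" using small_node[of col', OF col'] by (simp add: small_def)
    show ?S
      using same_cells_set_cell[OF x, of f' q] that(2)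
      by (auto simp: same_cells_def)
    have "Suc (8 * q + 3) * W \<le> D" using cell_bound[of "8 * q + 3"] by (simp add: algebra_simps)
    then have "stored q n D 0 col' col' ?f"
      using that(1) by (simp add: stored_set_cell stored_finish[of _ _ _ col col' _ col'])
    then show ?A
      using assms(1) same_cells_table[OF \<open>?S\<close>] x col' by (auto simp: array_ok_def cell_set_cell)
  qed
  show ?thesis
    unfolding write_trit_def seq.simps
    apply (rule wp_Seq, rule wp_Move, simp)
    apply (rule wp_Seq, rule wp_Move, simp)
    apply (rule wp_Seq, rule wp_Lt, simp, simp)
    apply (rule wp_Seq, rule wp_While[where I = I and m = "92 * q"], simp)
    using start g(2) apply simp
     apply (rule step, assumption, assumption)
    subgoal premises p for m' k' g' f' out'
    proof -
      have 1: "g' 7 = q" "out' = out" using p(1,2) by (auto simp: I_def split: if_splits)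
      have 2: "g' 6 = node q col' q 0" "g' 3 = W" "g' 2 = q" "stored q n D q col col' f'"
        "\<forall>i<8 * (q + 1). cell W f' i = cell W f i" "k' \<le> k + 10 + 92 * q"
        using p g by (simp_all add: I_def 1 u)
      have 3: "g' r = g r" if "r \<notin> {4, 6, 7, 8, 9, 10, 11, 12, 13, 23}" for r
        using p(1) that by (simp add: I_def)
      show ?thesis
      proof (rule wp_store_cell)
        fix k'' v
        assume "k'' \<le> k' + 7"
        then show "Q k'' (g'(4 := v)) (set_cell W (8 * g' 2 + val g' (Imm 3)) (val g' (Reg 6)) f') out'"
          unfolding 1(2) using 2 3 fin[OF 2(4,5)] by (intro Q) (simp_all add: col'_def u_def)
      qed (use 2 in simp_all)
    qed
    done
qed

end

section \<open>Breadth-first search by levels\<close>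

text \<open>Functional model of \<open>expand\<close>; the second component collects the newly found
  vertices in the order of output.\<close>

fun scan :: "nat \<Rightarrow> nat list \<Rightarrow> (nat \<Rightarrow> nat) \<times> nat list \<Rightarrow> (nat \<Rightarrow> nat) \<times> nat list" where
  "scan t [] st = st"
| "scan t (u # us) (col, ys) =
    scan t us (if col u = 0 then (col(u := t), ys @ [u]) else (col, ys))"

text \<open>One model for both modes of a level. On a queue the colour test always succeeds, and
  there the program omits it.\<close>

fun sweep :: "nat \<Rightarrow> nat \<Rightarrow> (nat \<Rightarrow> nat list) \<Rightarrow> nat list \<Rightarrow> (nat \<Rightarrow> nat) \<times> nat list \<Rightarrow>
    (nat \<Rightarrow> nat) \<times> nat list" where
  "sweep c t adj [] st = st"
| "sweep c t adj (x # xs) (col, ys) =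
    sweep c t adj xs (if col x = c then scan t (adj x) (col, ys) else (col, ys))"

text \<open>Meaningless for unreachable \<open>v\<close>, which is why the sets below demand
  reachability separately.\<close>

definition level :: "('a \<times> 'a) set \<Rightarrow> 'a \<Rightarrow> 'a \<Rightarrow> nat" where
  "level E s v = (LEAST k. (s, v) \<in> E ^^ k)"

definition levels_upto :: "('a \<times> 'a) set \<Rightarrow> 'a \<Rightarrow> nat \<Rightarrow> 'a set" where
  "levels_upto E s d = {v. (s, v) \<in> E\<^sup>* \<and> level E s v \<le> d}"

definition level_set :: "('a \<times> 'a) set \<Rightarrow> 'a \<Rightarrow> nat \<Rightarrow> 'a set" where
  "level_set E s d = {v. (s, v) \<in> E\<^sup>* \<and> level E s v = d}"

lemma level_relpow: "(s, v) \<in> E\<^sup>* \<Longrightarrow> (s, v) \<in> E ^^ level E s v"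
  unfolding level_def by (rule LeastI_ex) (simp add: rtrancl_imp_relpow)

lemma level_le: "(s, v) \<in> E ^^ k \<Longrightarrow> level E s v \<le> k"
  unfolding level_def by (rule Least_le)

lemma level_start: "level E s s = 0"
  using level_le[of s s 0 E] by simp

lemma level_zero: "(s, v) \<in> E\<^sup>* \<Longrightarrow> level E s v = 0 \<Longrightarrow> v = s"
  using level_relpow[of s v E] by simp

lemma level_step: "(s, u) \<in> E\<^sup>* \<Longrightarrow> (u, v) \<in> E \<Longrightarrow> level E s v \<le> Suc (level E s u)"
  using level_relpow[of s u E] by (intro level_le) auto

lemma level_pred:
  assumes "(s, v) \<in> E\<^sup>*" "level E s v = Suc d"
  obtains u where "(s, u) \<in> E\<^sup>*" "level E s u = d" "(u, v) \<in> E"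
proof -
  obtain u where u: "(s, u) \<in> E ^^ d" "(u, v) \<in> E"
    using level_relpow[OF assms(1)] assms(2) by auto
  then have "(s, u) \<in> E\<^sup>*" by (simp add: relpow_imp_rtrancl)
  moreover from this have "level E s u = d"
    using level_step[OF _ u(2)] level_le[OF u(1)] assms(2) by fastforce
  ultimately show thesis using that u(2) by blast
qed

lemma level_set_downward: "v \<in> level_set E s (d + k) \<Longrightarrow> level_set E s d \<noteq> {}"
proof (induction k arbitrary: v)
  case (Suc k)
  then have "(s, v) \<in> E\<^sup>*" "level E s v = Suc (d + k)" by (auto simp: level_set_def)
  then obtain u where "(s, u) \<in> E\<^sup>*" "level E s u = d + k" by (rule level_pred)
  then show ?case by (intro Suc.IH[of u]) (simp add: level_set_def)
qed auto

text \<open>Levels have no gaps, by \<open>level_set_downward\<close>; so the search may stop at the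
  first empty one.\<close>

lemma levels_upto_empty:
  assumes "level_set E s d = {}"
  shows "levels_upto E s d = {v. (s, v) \<in> E\<^sup>*}"
proof -
  have "level E s v \<le> d" if "(s, v) \<in> E\<^sup>*" for v
  proof (rule ccontr)
    assume "\<not> level E s v \<le> d"
    then have "v \<in> level_set E s (d + (level E s v - d))" using that by (simp add: level_set_def)
    from level_set_downward[OF this] assms show False by simp
  qed
  then show ?thesis by (auto simp: levels_upto_def)
qed

lemma levels_upto_Suc: "levels_upto E s (Suc d) = levels_upto E s d \<union> level_set E s (Suc d)"
  by (auto simp: levels_upto_def level_set_def)

text \<open>
  Colour 0 means unvisited.  Two colours suffice for the visited vertices, since a vertex on
  an earlier level of the same parity has no unvisited successor.
\<close>

definition colour :: "(nat \<times> nat) set \<Rightarrow> nat \<Rightarrow> nat \<Rightarrow> nat \<Rightarrow> nat" where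
  "colour E s d v = (if v \<in> levels_upto E s d then 1 + level E s v mod 2 else 0)"

definition bfs_state ::
  "(nat \<times> nat) set \<Rightarrow> nat \<Rightarrow> nat \<Rightarrow> (nat \<Rightarrow> nat) \<Rightarrow> nat list \<Rightarrow> nat list \<Rightarrow> bool" where
  "bfs_state E s d col cur xs \<longleftrightarrow> col = colour E s d \<and> distinct cur \<and> set cur = level_set E s d \<and>
     distinct xs \<and> set xs = levels_upto E s d \<and> sorted (map (level E s) xs)"

lemma bfs_state_start: "bfs_state E s 0 ((\<lambda>_. 0)(s := 1)) [s] [s]"
  using level_zero[of s] by (auto simp: bfs_state_def colour_def fun_eq_iff levels_upto_def
      level_set_def level_start)

context
  fixes E :: "(nat \<times> nat) set" and s d :: nat
begin

definition partial_state :: "(nat \<Rightarrow> nat) \<Rightarrow> nat list \<Rightarrow> bool" where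
  "partial_state col ys \<longleftrightarrow> distinct ys \<and> set ys \<subseteq> level_set E s (Suc d) \<and>
     col = (\<lambda>v. if v \<in> set ys then 1 + Suc d mod 2 else colour E s d v)"

lemma scan_correct:
  assumes "partial_state col ys" "set us \<subseteq> levels_upto E s (Suc d)"
    and "scan (1 + Suc d mod 2) us (col, ys) = (col', ys')"
  shows "partial_state col' ys' \<and> set ys \<subseteq> set ys' \<and> set us \<subseteq> levels_upto E s d \<union> set ys'"
  using assms
proof (induction us arbitrary: col ys)
  case (Cons u us)
  show ?case
  proof (cases "col u = 0")
    case True
    then have "u \<notin> set ys" "u \<notin> levels_upto E s d"
      using Cons.prems(1) by (auto simp: partial_state_def colour_def split: if_splits)
    then have "partial_state (col(u := 1 + Suc d mod 2)) (ys @ [u])"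
      using Cons.prems(1,2) by (auto simp: partial_state_def levels_upto_Suc fun_eq_iff)
    moreover have "scan (1 + Suc d mod 2) us (col(u := 1 + Suc d mod 2), ys @ [u]) = (col', ys')"
      using Cons.prems(3) True by simp
    ultimately show ?thesis using Cons.IH[of "col(u := 1 + Suc d mod 2)" "ys @ [u]"] Cons.prems(2)
      by (auto simp del: fun_upd_apply)
  next
    case False
    then have "u \<in> levels_upto E s d \<union> set ys"
      using Cons.prems(1) by (auto simp: partial_state_def colour_def split: if_splits)
    moreover from Cons.IH[OF Cons.prems(1)] Cons.prems(2,3) False
    have "partial_state col' ys' \<and> set ys \<subseteq> set ys' \<and> set us \<subseteq> levels_upto E s d \<union> set ys'"
      by simp
    ultimately show ?thesis by auto
  qed
qed auto

text \<open>A vertex that passes the colour test is only known to lie on some level up to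
  \<open>d\<close>. That is enough: its successors lie on levels up to \<open>Suc d\<close>, so
  whatever is still white among them belongs to the next level.\<close>

lemma sweep_partial:
  assumes "partial_state col ys" "\<And>x. x \<in> set todo \<Longrightarrow> set (adj x) = {v. (x, v) \<in> E}"
    and "sweep (1 + d mod 2) (1 + Suc d mod 2) adj todo (col, ys) = (col', ys')"
  shows "partial_state col' ys' \<and> set ys \<subseteq> set ys' \<and>
    (\<forall>x\<in>set todo \<inter> level_set E s d. \<forall>v. (x, v) \<in> E \<longrightarrow> v \<in> levels_upto E s d \<union> set ys')"
  using assms
proof (induction todo arbitrary: col ys)
  case (Cons x todo)
  have col: "col = (\<lambda>v. if v \<in> set ys then 1 + Suc d mod 2 else colour E s d v)"
    and ys: "set ys \<subseteq> level_set E s (Suc d)"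
    using Cons.prems(1) by (auto simp: partial_state_def)
  show ?case
  proof (cases "col x = 1 + d mod 2")
    case True
    \<comment> \<open>Vertices coloured during this sweep carry the other colour and are not
      mistaken for the current level.\<close>
    have "1 + Suc d mod 2 \<noteq> 1 + d mod 2" by presburger
    with True have x: "x \<in> levels_upto E s d" by (auto simp: col colour_def split: if_splits)
    obtain col1 ys1 where 1: "scan (1 + Suc d mod 2) (adj x) (col, ys) = (col1, ys1)"
      by (cases "scan (1 + Suc d mod 2) (adj x) (col, ys)")
    have "set (adj x) \<subseteq> levels_upto E s (Suc d)"
      using x Cons.prems(2)[of x] level_step[of s x E]
      by (fastforce simp: levels_upto_def intro: rtrancl_into_rtrancl)
    from scan_correct[OF Cons.prems(1) this 1]
    have 2: "partial_state col1 ys1" "set ys \<subseteq> set ys1"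
      "\<And>v. (x, v) \<in> E \<Longrightarrow> v \<in> levels_upto E s d \<union> set ys1"
      using Cons.prems(2)[of x] by auto
    have 3: "sweep (1 + d mod 2) (1 + Suc d mod 2) adj todo (col1, ys1) = (col', ys')"
      using Cons.prems(3) True 1 by simp
    from Cons.IH[OF 2(1) Cons.prems(2) 3] 2(2,3) show ?thesis by auto
  next
    case False
    then have "x \<notin> level_set E s d"
      using ys by (auto simp: col colour_def levels_upto_def level_set_def split: if_splits)
    moreover have "sweep (1 + d mod 2) (1 + Suc d mod 2) adj todo (col, ys) = (col', ys')"
      using Cons.prems(3) False by simp
    ultimately show ?thesis using Cons.IH[OF Cons.prems(1,2)] by auto
  qed
qed auto

lemma sweep_correct:
  assumes "bfs_state E s d col cur xs" "set cur \<subseteq> set todo"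
    and "\<And>x. x \<in> set todo \<Longrightarrow> set (adj x) = {v. (x, v) \<in> E}"
    and "sweep (1 + d mod 2) (1 + Suc d mod 2) adj todo (col, []) = (col', ys)"
  shows "bfs_state E s (Suc d) col' ys (xs @ ys)"
proof -
  have "partial_state col []" using assms(1) by (auto simp: partial_state_def bfs_state_def)
  from sweep_partial[OF this assms(3,4)]
  have 1: "partial_state col' ys"
    and 2: "\<And>x v. x \<in> level_set E s d \<Longrightarrow> (x, v) \<in> E \<Longrightarrow> v \<in> levels_upto E s d \<union> set ys"
    using assms(1,2) by (auto simp: bfs_state_def)
  have ys: "set ys = level_set E s (Suc d)"
  proof
    show "level_set E s (Suc d) \<subseteq> set ys"
    proof
      fix v assume v: "v \<in> level_set E s (Suc d)"
      then have "(s, v) \<in> E\<^sup>*" "level E s v = Suc d" by (auto simp: level_set_def)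
      then obtain u where "(s, u) \<in> E\<^sup>*" "level E s u = d" "(u, v) \<in> E" by (rule level_pred)
      then have "v \<in> levels_upto E s d \<union> set ys" by (intro 2[of u]) (auto simp: level_set_def)
      with v show "v \<in> set ys" by (auto simp: level_set_def levels_upto_def)
    qed
  qed (use 1 in \<open>auto simp: partial_state_def\<close>)
  have "col' = colour E s (Suc d)"
    using 1 ys by (auto simp: partial_state_def colour_def levels_upto_Suc fun_eq_iff level_set_def)
  moreover have "set xs \<inter> set ys = {}"
    using assms(1) ys by (auto simp: bfs_state_def levels_upto_def level_set_def)
  moreover have "sorted (map (level E s) (xs @ ys))"
  proof -
    have "map (level E s) ys = map (\<lambda>_. Suc d) ys" using ys by (auto simp: level_set_def)
    then have "sorted (map (level E s) ys)" by (simp only: map_replicate_const sorted_replicate)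
    then show ?thesis
      using assms(1) ys by (auto simp: sorted_append bfs_state_def levels_upto_def level_set_def)
  qed
  ultimately show ?thesis
    using 1 assms(1) ys by (auto simp: bfs_state_def partial_state_def levels_upto_Suc)
qed

end

section \<open>Distances\<close>

context pair_wf_digraph
begin

lemma awalk_relpow: "awalk u p v \<Longrightarrow> (u, v) \<in> parcs G ^^ length p"
proof (induction p arbitrary: u)
  case (Cons e p)
  then have "(u, snd e) \<in> parcs G" "(snd e, v) \<in> parcs G ^^ length p"
    by (auto simp: awalk_Cons_iff)
  then show ?case by (simp add: relpow_commute[symmetric]) blast
qed (auto simp: awalk_Nil_iff)

lemma relpow_awalk: "(u, v) \<in> parcs G ^^ k \<Longrightarrow> u \<in> pverts G \<Longrightarrow> \<exists>p. awalk u p v \<and> length p = k"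
proof (induction k arbitrary: u)
  case (Suc k)
  then obtain x where x: "(u, x) \<in> parcs G" "(x, v) \<in> parcs G ^^ k"
    by (metis relpow_Suc_D2)
  then obtain p where "awalk x p v" "length p = k" using Suc.IH in_arcsD2 by blast
  with x have "awalk u ((u, x) # p) v" "length ((u, x) # p) = Suc k"
    by (auto simp: awalk_Cons_iff)
  then show ?case by blast
qed (auto simp: awalk_Nil_iff)

lemma reachable_iff_rtrancl:
  assumes "s \<in> pverts G"
  shows "s \<rightarrow>\<^sup>*\<^bsub>with_proj G\<^esub> v \<longleftrightarrow> (s, v) \<in> (parcs G)\<^sup>*"
proof
  assume "(s, v) \<in> (parcs G)\<^sup>*"
  then obtain k where "(s, v) \<in> parcs G ^^ k" using rtrancl_imp_relpow by blast
  with assms obtain p where "awalk s p v" using relpow_awalk by blast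
  then show "s \<rightarrow>\<^sup>*\<^bsub>with_proj G\<^esub> v" by (rule reachable_awalkI)
qed (use reachable_rtranclI[of "with_proj G"] in simp)

text \<open>With unit weights the cost of a walk is its length, and the infimum is attained by a
  walk with the fewest arcs.\<close>

lemma mu_eq_level:
  assumes "s \<in> pverts G" "(s, v) \<in> (parcs G)\<^sup>*"
  shows "\<mu> (\<lambda>_. 1) s v = ereal (level (parcs G) s v)"
proof -
  have cost: "awalk_cost (\<lambda>_. 1) p = length p" for p
    by (induction p) auto
  obtain p where p: "awalk s p v" "length p = level (parcs G) s v"
    using relpow_awalk[OF level_relpow[OF assms(2)] assms(1)] by blast
  show ?thesis
    unfolding \<mu>_def
  proof (rule antisym)
    show "(INF p\<in>{p. awalk s p v}. ereal (awalk_cost (\<lambda>_. 1) p)) \<le> ereal (level (parcs G) s v)"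
      using p by (intro INF_lower2[of p]) (auto simp: cost)
    show "ereal (level (parcs G) s v) \<le> (INF p\<in>{p. awalk s p v}. ereal (awalk_cost (\<lambda>_. 1) p))"
      using level_le[OF awalk_relpow] by (intro INF_greatest) (auto simp: cost)
  qed
qed

lemma bfs_order_levels:
  assumes "s \<in> pverts G" "distinct xs" "set xs = {v. (s, v) \<in> (parcs G)\<^sup>*}"
    and "sorted (map (level (parcs G) s) xs)"
  shows "bfs_order G s xs"
proof -
  have "map (\<mu> (\<lambda>_. 1) s) xs = map (ereal \<circ> real) (map (level (parcs G) s) xs)"
    using assms(3) mu_eq_level[OF assms(1)] by auto
  then have "sorted (map (\<mu> (\<lambda>_. 1) s) xs)"
    using assms(4) by (simp only:) (simp add: sorted_map)
  then show ?thesis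
    using assms(1-3) by (auto simp: bfs_order_def reachable_iff_rtrancl)
qed

end

section \<open>The search loop\<close>

lemma linked_list_zero: "linked_list rom n 0 vs \<Longrightarrow> vs = []"
  by (erule linked_list.cases) auto

lemma linked_list_nonzero:
  assumes "linked_list rom n p vs" "p \<noteq> 0"
  obtains us where "vs = rom ! p # us" "n \<le> p" "p + 1 < length rom"
    "linked_list rom n (rom ! (p + 1)) us"
  using assms by (auto elim: linked_list.cases)

lemma linked_list_less: "linked_list rom n p vs \<Longrightarrow> p \<le> length rom"
  by (erule linked_list.cases) auto

locale bfs_input = bfs_ram w S rom b q n for w S rom b q n +
  fixes E :: "(nat \<times> nat) set" and adj :: "nat \<Rightarrow> nat list"
  assumes adj_list: "\<And>u. u < n \<Longrightarrow> linked_list rom n (rom ! u) (adj u)"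
    and set_adj: "\<And>u. u < n \<Longrightarrow> set (adj u) = {v. (u, v) \<in> E}"
    and E_subset: "E \<subseteq> {..<n} \<times> {..<n}"
    and rom_length: "n \<le> length rom" "length rom \<le> 4 * 2 ^ q * 2 ^ q"
begin

text \<open>Entries from index \<open>q\<close> on are not recorded: a longer level is swept by
  colour and its queue is never read.\<close>

definition queue :: "nat \<Rightarrow> nat list \<Rightarrow> (nat \<Rightarrow> bool) \<Rightarrow> bool" where
  "queue i zs f \<longleftrightarrow> (\<forall>k<length zs. k < q \<longrightarrow> cell W f (8 * k + i) = zs ! k)"

text \<open>Besides the scratch cells only the queue under construction, in cells \<open>i\<close>,
  may change; the queue being read survives.\<close>

definition keeps_cells :: "nat \<Rightarrow> (nat \<Rightarrow> bool) \<Rightarrow> (nat \<Rightarrow> bool) \<Rightarrow> bool" where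
  "keeps_cells i f f' \<longleftrightarrow>
     (\<forall>k<8 * (q + 1). k mod 8 \<noteq> 3 \<longrightarrow> k mod 8 \<noteq> i \<longrightarrow> cell W f' k = cell W f k)"

text \<open>Distinct vertices below \<open>n\<close> bound the counter in register 18 by
  \<open>n\<close>, and their nonzero colours keep \<open>ys\<close> distinct when a white vertex is
  appended.\<close>

definition search_inv :: "nat \<Rightarrow> nat \<Rightarrow> nat list \<Rightarrow> (nat \<Rightarrow> bool) \<Rightarrow> (nat \<Rightarrow> nat) \<times> nat list \<Rightarrow>
    (nat \<Rightarrow> nat) \<Rightarrow> (nat \<Rightarrow> bool) \<Rightarrow> nat list \<Rightarrow> bool" where
  "search_inv t i out0 f0 st g f out \<longleftrightarrow> (case st of (col, ys) \<Rightarrow>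
     array_ok col f \<and> g 2 = q \<and> g 3 = W \<and> g 14 = t \<and> g 24 = i \<and> g 18 = length ys \<and>
     queue i ys f \<and> keeps_cells i f0 f \<and> out = out0 @ ys \<and> distinct ys \<and> set ys \<subseteq> {..<n} \<and>
     (\<forall>u\<in>set ys. col u \<noteq> 0))"

lemma small_n: "small n"
  using n_le by (intro small_square) (simp add: order_trans[of n "2 ^ q"])

lemma small_vertex: "u \<le> n \<Longrightarrow> small u"
  using small_n small_le by blast

lemma small_pointer: "p \<le> length rom \<Longrightarrow> small p"
  using rom_length(2) by (intro small_square) simp

lemma less_cell: "u \<le> n \<Longrightarrow> u < 2 ^ W"
  using small_vertex by (simp add: small_def)

lemma same_keeps: "same_cells f f' \<Longrightarrow> keeps_cells i f f'"
  by (simp add: same_cells_def keeps_cells_def)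

lemma keeps_trans: "keeps_cells i f f' \<Longrightarrow> keeps_cells i f' f'' \<Longrightarrow> keeps_cells i f f''"
  by (simp add: keeps_cells_def)

lemma queue_same: "same_cells f f' \<Longrightarrow> queue i ys f \<Longrightarrow> i \<in> {5, 6} \<Longrightarrow> queue i ys f'"
  unfolding queue_def
proof (intro allI impI)
  fix k assume *: "same_cells f f'" "\<forall>k<length ys. k < q \<longrightarrow> cell W f (8 * k + i) = ys ! k"
    "i \<in> {5, 6}" "k < length ys" "k < q"
  have "cell W f' (8 * k + i) = cell W f (8 * k + i)"
    using *(1,3,5) by (auto simp: same_cells_def)
  with * show "cell W f' (8 * k + i) = ys ! k" by simp
qed

lemma array_ok_set_queue:
  assumes "array_ok col f" "j < q" "x < 2 ^ W" "i \<in> {5, 6}"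
  shows "array_ok col (set_cell W (8 * j + i) x f)"
proof -
  have "Suc (8 * j + i) * W \<le> D" using cell_bound[of "8 * j + i"] assms(2,4)
    by (auto simp: algebra_simps)
  then have "stored q n D 0 col col (set_cell W (8 * j + i) x f)"
    using assms(1) by (simp add: array_ok_def stored_set_cell)
  moreover have "table_ok (set_cell W (8 * j + i) x f)"
  proof -
    have "8 * j' + l \<noteq> 8 * j + i" if "l < 3" for j' l using that assms(4) by auto presburger+
    from this[of 0] this[of 1] this[of 2] show ?thesis
      using assms by (simp add: table_ok_def array_ok_def cell_set_cell)
  qed
  moreover have "8 * q + 3 \<noteq> 8 * j + i" using assms(4) by auto presburger+
  ultimately show ?thesis using assms by (simp add: array_ok_def cell_set_cell)
qed

lemma search_inv_same:
  assumes "search_inv t i out0 f0 (col, ys) g f out" "i \<in> {5, 6}"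
    and "same_cells f f'" "array_ok col f'"
    and "g' 2 = g 2" "g' 3 = g 3" "g' 14 = g 14" "g' 18 = g 18" "g' 24 = g 24"
  shows "search_inv t i out0 f0 (col, ys) g' f' out"
  using assms queue_same[OF assms(3) _ assms(2)] keeps_trans[OF _ same_keeps[OF assms(3)]]
  by (auto simp: search_inv_def)

lemma search_inv_push:
  assumes "search_inv t i out0 f0 (col, ys) g f out" "i \<in> {5, 6}" "u < n" "col u = 0" "t \<noteq> 0"
    and "same_cells f f'" "array_ok (col(u := t)) f'"
    and f'': "f'' = (if length ys < q then set_cell W (8 * length ys + i) u f' else f')"
    and "g' 2 = q" "g' 3 = W" "g' 14 = t" "g' 24 = i" "g' 18 = length ys + 1"
  shows "search_inv t i out0 f0 (col(u := t), ys @ [u]) g' f'' (out @ [u])"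
proof -
  note inv = assms(1)[unfolded search_inv_def prod.case]
  have u: "u < 2 ^ W" using assms(3) by (intro less_cell) simp
  have "queue i ys f'" using queue_same[OF assms(6) _ assms(2)] inv by simp
  then have "queue i (ys @ [u]) f''"
    using u by (auto simp: queue_def f'' cell_set_cell nth_append less_Suc_eq)
  moreover have "keeps_cells i f0 f''"
  proof (rule keeps_trans[OF keeps_trans])
    show "keeps_cells i f0 f" using inv by simp
    show "keeps_cells i f f'" using assms(6) by (rule same_keeps)
    show "keeps_cells i f' f''"
      using u assms(2) by (auto simp: keeps_cells_def f'' cell_set_cell)
  qed
  moreover have "array_ok (col(u := t)) f''"
    using assms(7) array_ok_set_queue[OF assms(7) _ u assms(2)] by (simp add: f'')
  moreover have "u \<notin> set ys" using inv assms(4) by auto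
  ultimately show ?thesis using inv assms by (auto simp: search_inv_def)
qed

text \<open>Pays for one read, at most \<open>90 * (q + 1)\<close>, one write, at most
  \<open>110 * (q + 1)\<close>, and constantly many further steps.\<close>

definition node_cost :: nat where "node_cost = 300 * (q + 1)"

lemma wp_visit_node:
  assumes inv: "search_inv t i out0 f0 (col, ys) g f out" and i: "i \<in> {5, 6}" and t: "t \<in> {1, 2}"
    and list: "g 22 < length rom" "rom ! g 22 = u" "u < n"
      "g 22 + 1 < length rom" "rom ! (g 22 + 1) \<le> length rom"
    and Q: "\<And>k' g' f' out'. k' + 2 \<le> k + node_cost \<Longrightarrow>
      search_inv t i out0 f0 (if col u = 0 then (col(u := t), ys @ [u]) else (col, ys)) g' f' out' \<Longrightarrow>
      g' 22 = rom ! (g 22 + 1) \<Longrightarrow>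
      (\<And>r. r \<notin> {4, 5, 6, 7, 8, 9, 10, 11, 12, 13, 18, 22, 23} \<Longrightarrow> g' r = g r) \<Longrightarrow>
      Q k' g' f' out'"
  shows "wp visit_node Q k g f out"
proof -
  note inv' = inv[unfolded search_inv_def prod.case]
  have "card (set ys) \<le> card {..<n}" using inv' by (intro card_mono) auto
  then have len: "length ys \<le> n" using inv' by (simp add: distinct_card)
  have b: "u < 2 ^ b" "g 22 + 1 < 2 ^ b" "rom ! (g 22 + 1) < 2 ^ b" "length ys + 1 < 2 ^ b"
    using list small_less[OF small_vertex, of u] small_less[OF small_pointer, of "g 22 + 1"]
      small_less[OF small_pointer, of "rom ! (g 22 + 1)"]
      small_add[OF small_vertex[OF len] small_const[of 1]] by auto
  have tail: "wp (Seq (Arith 22 Add (Reg 22) (Imm 1)) (Read_Input 22 (Reg 22))) Q k' g' f' out'"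
    if "k' + 5 \<le> k + node_cost" "g' 22 = g 22"
      "search_inv t i out0 f0 (if col u = 0 then (col(u := t), ys @ [u]) else (col, ys)) g' f' out'"
      "\<And>r. r \<notin> {4, 5, 6, 7, 8, 9, 10, 11, 12, 13, 18, 22, 23} \<Longrightarrow> g' r = g r"
    for k' g' f' out'
    apply (rule wp_Seq, rule wp_Add, simp, simp, simp add: that b[simplified])
    apply (rule wp_Read, simp, simp add: that list[simplified], simp add: that b[simplified])
    apply (rule Q)
    using that by (simp_all add: search_inv_def split: prod.splits)
  have regs: "g 2 = q" "g 3 = W" "g 14 = t" "g 24 = i" "g 18 = length ys" "array_ok col f"
    using inv' by auto
  show ?thesis
    unfolding visit_node_def seq.simps
    apply (rule wp_Seq, rule wp_Read, simp, simp add: list, simp add: list b)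
    apply (rule wp_Seq, rule wp_read_trit[where col = col], simp add: regs, simp add: regs,
        simp add: regs, simp add: list)
    apply (rule wp_Seq, rule wp_If, simp)
    subgoal for k' g' f'
      apply (rule wp_Skip, rule tail)
         apply (simp add: node_cost_def)
        apply simp
       apply (simp add: list)
       apply (rule search_inv_same[OF inv i])
         apply simp_all
      done
    subgoal premises p for k' g' f'
    proof -
      have g': "g' 6 = col u" "g' 5 = u" "col u = 0"
        "\<And>r. r \<notin> {4, 5, 6, 7, 8, 9, 10, 11, 12, 13} \<Longrightarrow> g' r = g r"
        using p list(2) by auto
      show ?thesis
        apply (rule wp_Seq, rule wp_write_trit[where col = col])
              apply (fact p)
        using t p(5) list(2) apply (auto simp: g' regs list)[5]
        subgoal premises p' for k'' g'' f''
        proof -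
          have g'': "g'' 14 = t" "g'' 5 = u" "g'' 24 = i" "g'' 18 = length ys" "g'' 2 = q" "g'' 3 = W"
            "\<And>r. r \<notin> {4, 5, 6, 7, 8, 9, 10, 11, 12, 13, 18, 22, 23} \<Longrightarrow> g'' r = g r" "g'' 22 = g 22"
            by (simp_all add: p'(2) g' regs)
          have same: "same_cells f f''" using p(6) p'(4) by (rule same_cells_trans)
          have arr: "array_ok (col(u := t)) f''" using p'(3) by (simp add: g' regs)
          have t0: "t \<noteq> 0" using t by auto
          have push: "search_inv t i out0 f0 (if col u = 0 then (col(u := t), ys @ [u]) else (col, ys))
              h F (out @ [u])"
            if "F = (if length ys < q then set_cell W (8 * length ys + i) u f'' else f'')"
              "h 2 = q" "h 3 = W" "h 14 = t" "h 24 = i" "h 18 = Suc (length ys)" for h F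
            using search_inv_push[OF inv i list(3) g'(3) t0 same arr that(1), of h] that(2-) g'(3)
            by simp
          have i8: "i < 8" using i by auto
          have cost: "k'' + 40 \<le> k + node_cost" using p(1) p'(1) by (simp add: node_cost_def)
          show ?thesis
            apply (rule wp_Seq, rule wp_Output, simp)
            apply (rule wp_Seq, rule wp_Lt, simp, simp)
            apply (rule wp_Seq, rule wp_If, simp)
            subgoal
              apply (rule wp_store_cell, simp, simp, simp, simp, simp, simp add: g'',
                  simp add: g'' split: if_splits, simp add: g'' i8)
              apply (rule wp_Add, simp, simp, simp add: g'' b[simplified])
              apply (rule tail)
              using cost apply simp
                apply (simp add: g'')
               apply (simp only: g'' val.simps, rule push)
                    apply (simp_all add: g'' split: if_splits)
              done
            subgoal
              apply (rule wp_Skip)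
              apply (rule wp_Add, simp, simp, simp add: g'' b[simplified])
              apply (rule tail)
              using cost apply simp
                apply (simp add: g'')
               apply (simp only: g'' val.simps, rule push)
                    apply (simp_all add: g'' split: if_splits)
              done
            done
        qed
        done
    qed
    done
qed

end

text \<open>Only white vertices are recoloured. Hence queued vertices keep their colour throughout
  the level, and the omitted colour test would have succeeded.\<close>

lemma scan_keeps_colour: "scan t us (col, ys) = (col', ys') \<Longrightarrow> col x \<noteq> 0 \<Longrightarrow> col' x = col x"
proof (induction us arbitrary: col ys)
  case (Cons u us)
  then show ?case
    using Cons.IH[of "col(u := t)" "ys @ [u]"] by (cases "col u = 0"; cases "x = u") auto
qed simp

context bfs_input
begin

lemma wp_expand:
  assumes inv: "search_inv t i out0 f0 st g f out" and i: "i \<in> {5, 6}" and t: "t \<in> {1, 2}"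
    and x: "g 1 < n"
    and Q: "\<And>k' g' f' out'. k' \<le> k + 3 + node_cost * length (adj (g 1)) \<Longrightarrow>
      search_inv t i out0 f0 (scan t (adj (g 1)) st) g' f' out' \<Longrightarrow>
      (\<And>r. r \<notin> {4, 5, 6, 7, 8, 9, 10, 11, 12, 13, 18, 22, 23} \<Longrightarrow> g' r = g r) \<Longrightarrow>
      Q k' g' f' out'"
  shows "wp expand Q k g f out"
proof -
  \<comment> \<open>Stated by continuation: scanning the rest of the list from the current model
    state gives the result of the complete scan.\<close>
  define I where "I m g' f' out' \<longleftrightarrow> (\<exists>rest st'. linked_list rom n (g' 22) rest \<and>
      set rest \<subseteq> {..<n} \<and> scan t rest st' = scan t (adj (g 1)) st \<and>
      search_inv t i out0 f0 st' g' f' out' \<and> m = node_cost * length rest) \<and>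
      (\<forall>r. r \<notin> {4, 5, 6, 7, 8, 9, 10, 11, 12, 13, 18, 22, 23} \<longrightarrow> g' r = g r)"
    for m :: nat and g' f' out'
  have step: "wp visit_node (\<lambda>k' g' f' out'. \<exists>m'. I m' g' f' out' \<and> k' + 2 + m' \<le> k + m) k g' f' out'"
    if I: "I m g' f' out'" and "val g' (Reg 22) \<noteq> 0" for m k g' f' out'
  proof -
    obtain rest col ys where rest: "linked_list rom n (g' 22) rest" "set rest \<subseteq> {..<n}"
      "scan t rest (col, ys) = scan t (adj (g 1)) st" "search_inv t i out0 f0 (col, ys) g' f' out'"
      "m = node_cost * length rest"
      using I by (auto simp: I_def)
    have "g' 22 \<noteq> 0" using that by simp
    with rest(1) obtain us where us: "rest = rom ! g' 22 # us" "g' 22 + 1 < length rom"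
      "linked_list rom n (rom ! (g' 22 + 1)) us"
      by (rule linked_list_nonzero)
    show ?thesis
    proof (rule wp_visit_node[OF rest(4) i t _ refl])
      show "g' 22 < length rom" "rom ! g' 22 < n" "g' 22 + 1 < length rom"
        "rom ! (g' 22 + 1) \<le> length rom"
        using us rest(2) linked_list_less[OF us(3)] by auto
    next
      fix k' g'' f'' out''
      define st'' where "st'' = (if col (rom ! g' 22) = 0
        then (col(rom ! g' 22 := t), ys @ [rom ! g' 22]) else (col, ys))"
      assume *: "k' + 2 \<le> k + node_cost"
        "search_inv t i out0 f0 (if col (rom ! g' 22) = 0
          then (col(rom ! g' 22 := t), ys @ [rom ! g' 22]) else (col, ys)) g'' f'' out''"
        "g'' 22 = rom ! (g' 22 + 1)"
        "\<And>r. r \<notin> {4, 5, 6, 7, 8, 9, 10, 11, 12, 13, 18, 22, 23} \<Longrightarrow> g'' r = g' r"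
      have "I (node_cost * length us) g'' f'' out''"
        unfolding I_def
      proof (intro conjI allI impI exI[of _ us] exI[of _ st''])
        show "search_inv t i out0 f0 st'' g'' f'' out''" using *(2) by (simp only: st''_def)
        show "scan t us st'' = scan t (adj (g 1)) st"
          using rest(3) by (simp add: us(1) st''_def)
        show "g'' r = g r" if "r \<notin> {4, 5, 6, 7, 8, 9, 10, 11, 12, 13, 18, 22, 23}" for r
          using *(4)[OF that] I that by (simp add: I_def)
      qed (use us rest(2) *(3) in auto)
      moreover have "k' + 2 + node_cost * length us \<le> k + m"
        using *(1) rest(5) us(1) by simp
      ultimately show "\<exists>m'. I m' g'' f'' out'' \<and> k' + 2 + m' \<le> k + m" by blast
    qed
  qed
  have adj: "linked_list rom n (rom ! g 1) (adj (g 1))" "set (adj (g 1)) \<subseteq> {..<n}"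
    using adj_list[OF x] set_adj[OF x] E_subset by auto
  have b: "rom ! g 1 < 2 ^ b" "g 1 < length rom"
    using small_less[OF small_pointer[OF linked_list_less[OF adj(1)]]] x rom_length by auto
  have "search_inv t i out0 f0 st (g(22 := rom ! g 1)) f out"
    using inv by (simp add: search_inv_def)
  then have start: "I (node_cost * length (adj (g 1))) (g(22 := rom ! g 1)) f out"
    unfolding I_def using adj by (intro conjI exI[of _ "adj (g 1)"] exI[of _ st]) auto
  show ?thesis
    unfolding expand_def seq.simps
    apply (rule wp_Seq, rule wp_Read, simp, simp add: b[simplified], simp add: b[simplified])
    apply (rule wp_While[where I = I and m = "node_cost * length (adj (g 1))"], simp)
    using start apply simp
     apply (rule step, assumption, assumption)
    subgoal premises p for m' k' g' f' out'
    proof -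
      obtain rest st' where rest: "linked_list rom n (g' 22) rest"
        "scan t rest st' = scan t (adj (g 1)) st" "search_inv t i out0 f0 st' g' f' out'"
        using p(1) by (auto simp: I_def)
      have "rest = []" using rest(1) p(2) by (simp add: linked_list_zero)
      then show ?thesis using rest p by (intro Q) (auto simp: I_def)
    qed
    done
qed

definition vertex_cost :: "nat \<Rightarrow> nat" where
  "vertex_cost x = 2 * node_cost * (length (adj x) + 1)"

lemma wp_level_step:
  assumes inv: "search_inv t i out0 f0 (col, ys) g f out" and i: "i \<in> {5, 6}" and t: "t \<in> {1, 2}"
    and x: "x < n" and big: "g 21 \<noteq> 0 \<Longrightarrow> g 20 = x"
    and notbig: "g 21 = 0 \<Longrightarrow> g 20 < q \<and> g 17 \<in> {5, 6} \<and> cell W f (8 * g 20 + g 17) = x \<and>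
      col x = g 16"
    and lim: "g 20 < n"
    and Q: "\<And>k' g' f' out'. k' + 2 \<le> k + vertex_cost x \<Longrightarrow>
      search_inv t i out0 f0 (if col x = g 16 then scan t (adj x) (col, ys) else (col, ys))
        g' f' out' \<Longrightarrow>
      g' 20 = g 20 + 1 \<Longrightarrow> g' 25 = of_bool (g 20 + 1 < g 19) \<Longrightarrow>
      (\<And>r. r \<notin> {1, 4, 5, 6, 7, 8, 9, 10, 11, 12, 13, 18, 20, 22, 23, 25} \<Longrightarrow> g' r = g r) \<Longrightarrow>
      Q k' g' f' out'"
  shows "wp level_step Q k g f out"
proof -
  note inv' = inv[unfolded search_inv_def prod.case]
  have regs: "g 2 = q" "g 3 = W" "g 14 = t" "g 24 = i" "g 18 = length ys" "array_ok col f"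
    using inv' by auto
  have b: "g 20 + 1 < 2 ^ b" using lim by (intro small_less small_vertex) simp
  have cost: "node_cost * length (adj x) + node_cost + 300 \<le> vertex_cost x"
  proof -
    have "300 \<le> node_cost" by (simp add: node_cost_def)
    then show ?thesis by (simp add: vertex_cost_def algebra_simps)
  qed
  have tail: "wp (Seq (If_Nonzero (Reg 12) expand Skip)
      (Seq (Arith 20 Add (Reg 20) (Imm 1)) (Arith 25 Lt (Reg 20) (Reg 19)))) Q k' g' f' out"
    if "k' \<le> k + node_cost" "g' 1 = x" "g' 12 = of_bool (col x = g 16)"
      "search_inv t i out0 f0 (col, ys) g' f' out"
      "\<And>r. r \<notin> {1, 4, 5, 6, 7, 8, 9, 10, 11, 12, 13} \<Longrightarrow> g' r = g r" for k' g' f'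
    apply (rule wp_Seq, rule wp_If, simp)
     apply (rule wp_expand[OF that(4) i t], simp add: that x del: One_nat_def)
    subgoal premises p for k'' g'' f'' out''
    proof -
      have g'': "g'' 20 = g 20" "g'' 19 = g 19"
        "\<And>r. r \<notin> {1, 4, 5, 6, 7, 8, 9, 10, 11, 12, 13, 18, 20, 22, 23, 25} \<Longrightarrow> g'' r = g r"
        by (auto simp: p(4) that(5))
      show ?thesis
        apply (rule wp_Seq, rule wp_Add, simp, simp, simp add: g'' b[simplified])
        apply (rule wp_Lt, simp, simp, rule Q)
        using p(2) cost that(1,2) apply (simp del: One_nat_def)
        using p(1,3) that(2,3) apply (simp add: search_inv_def split: prod.splits if_splits)
        by (simp_all add: g'')
    qed
    apply (rule wp_Skip)
    subgoal premises p
    proof -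
      have g'': "g' 20 = g 20" "g' 19 = g 19"
        "\<And>r. r \<notin> {1, 4, 5, 6, 7, 8, 9, 10, 11, 12, 13, 18, 20, 22, 23, 25} \<Longrightarrow> g' r = g r"
        by (auto simp: that(5))
      show ?thesis
        apply (rule wp_Seq, rule wp_Add, simp, simp, simp add: g'' b[simplified])
        apply (rule wp_Lt, simp, simp, rule Q)
        using cost that(1,2) apply (simp del: One_nat_def)
        using p that(3,4) apply (simp add: search_inv_def split: prod.splits if_splits)
        by (simp_all add: g'')
    qed
    done
  show ?thesis
    unfolding level_step_def seq.simps
    apply (rule wp_Seq, rule wp_If, simp)
     apply (rule wp_Seq, rule wp_Move, simp)
     apply (rule wp_Seq, rule wp_Move, simp)
     apply (rule wp_Seq, rule wp_read_trit[where col = col], simp add: regs, simp add: regs,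
        simp add: regs, simp add: lim)
    subgoal premises p for k' g' f'
    proof -
      have 1: "g 20 = x" using big p(1) by simp
      have g': "g' r = g r" if "r \<notin> {1, 4, 5, 6, 7, 8, 9, 10, 11, 12, 13}" for r
        using that by (simp add: p(4))
      have g1: "g' 1 = x" using 1 by (simp add: p(4))
      have g6: "g' 6 = col x" "g' 16 = g 16" using p(3) 1 by (auto simp: g')
      show ?thesis
        apply (rule wp_Eq, simp, simp)
        apply (rule tail)
        using p(2) apply (simp add: node_cost_def)
        using g1 apply simp
          apply (simp add: g6)
         apply (rule search_inv_same[OF inv i p(7) p(5)])
             apply (simp_all add: g')
        done
    qed
    apply (rule wp_Seq, rule wp_load_cell, simp, simp, simp, simp add: regs)
    using notbig apply simp
    using notbig apply auto[1]
    apply (rule wp_Move, simp)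
    apply (rule tail)
    using notbig apply (simp add: node_cost_def)
    using notbig apply simp
    using notbig apply simp
    using inv apply (simp add: search_inv_def)
    apply simp
    done
qed

definition loop_inv :: "nat \<Rightarrow> nat \<Rightarrow> (nat \<Rightarrow> nat) \<Rightarrow> nat list \<Rightarrow> nat list \<Rightarrow>
    (nat \<Rightarrow> nat) \<Rightarrow> (nat \<Rightarrow> bool) \<Rightarrow> nat list \<Rightarrow> bool" where
  "loop_inv s d col cur xs g f out \<longleftrightarrow> bfs_state E s d col cur xs \<and> array_ok col f \<and>
     g 0 = n \<and> g 2 = q \<and> g 3 = W \<and> g 15 = length cur \<and> g 16 = 1 + d mod 2 \<and> g 17 \<in> {5, 6} \<and>
     queue (g 17) cur f \<and> out = xs"

definition todo :: "nat list \<Rightarrow> nat list" where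
  "todo cur = (if q < length cur then [0..<n] else cur)"

lemma rtrancl_less: "(s, v) \<in> E\<^sup>* \<Longrightarrow> s < n \<Longrightarrow> v < n"
  by (induction rule: rtrancl_induct) (use E_subset in auto)

lemma level_set_less: "s < n \<Longrightarrow> level_set E s d \<subseteq> {..<n}"
  using rtrancl_less by (auto simp: level_set_def)

lemma wp_level_loop:
  assumes inv: "loop_inv s d col cur xs g f out" and s: "s < n"
    and Q: "\<And>k' g' f' out' col' ys. k' \<le> k + 40 + sum_list (map vertex_cost (todo cur)) \<Longrightarrow>
      loop_inv s (Suc d) col' ys (xs @ ys) g' f' out' \<Longrightarrow> Q k' g' f' out'"
  shows "wp level_loop Q k g f out"
proof -
  define c where "c = 1 + d mod 2"
  define t where "t = 1 + Suc d mod 2"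
  have ct: "3 - c = t" "c \<le> 3" "t \<in> {1, 2}" "c \<noteq> 0"
    unfolding c_def t_def by (auto; presburger)+
  define i where "i = 11 - g 17"
  have g: "g 0 = n" "g 2 = q" "g 3 = W" "g 15 = length cur" "g 16 = c" "g 17 \<in> {5, 6}" "out = xs"
    and bfs: "bfs_state E s d col cur xs" and arr: "array_ok col f" and que: "queue (g 17) cur f"
    using inv by (auto simp: loop_inv_def c_def)
  have i: "i \<in> {5, 6}" "i \<noteq> g 17" "g 17 \<le> 11" "11 - g 17 = i" using g(6) by (auto simp: i_def)
  have cur: "distinct cur" "set cur = level_set E s d" "col = colour E s d"
    using bfs by (auto simp: bfs_state_def)
  have cur_less: "set cur \<subseteq> {..<n}" using cur level_set_less[OF s] by simp
  then have "card (set cur) \<le> card {..<n}" by (intro card_mono) auto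
  then have len: "length cur \<le> n" using cur(1) by (simp add: distinct_card)
  have todo_less: "set (todo cur) \<subseteq> {..<n}" "length (todo cur) \<le> n"
    using cur_less len by (auto simp: todo_def)
  have cur_col: "col x = c" if "x \<in> set cur" for x
    using that by (auto simp: cur(2,3) colour_def levels_upto_def level_set_def c_def)
  define h where "h = g(14 := t, 24 := i, 18 := 0, 20 := 0, 21 := of_bool (q < length cur),
    19 := length (todo cur))"
  define I where "I m g' f' out' \<longleftrightarrow> (\<exists>col1 ys1. g' 20 \<le> length (todo cur) \<and>
      search_inv t i xs f (col1, ys1) g' f' out' \<and>
      sweep c t adj (drop (g' 20) (todo cur)) (col1, ys1) = sweep c t adj (todo cur) (col, []) \<and>
      (\<forall>x. col x \<noteq> 0 \<longrightarrow> col1 x = col x) \<and>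
      m = sum_list (map vertex_cost (drop (g' 20) (todo cur)))) \<and>
      g' 25 = of_bool (g' 20 < length (todo cur)) \<and>
      (\<forall>r. r \<notin> {1, 4, 5, 6, 7, 8, 9, 10, 11, 12, 13, 18, 20, 22, 23, 25} \<longrightarrow> g' r = h r)"
    for m :: nat and g' f' out'
  have step: "wp level_step (\<lambda>k' g' f' out'. \<exists>m'. I m' g' f' out' \<and> k' + 2 + m' \<le> k + m) k g' f' out'"
    if I: "I m g' f' out'" and "val g' (Reg 25) \<noteq> 0" for m k g' f' out'
  proof -
    obtain col1 ys1 where I1: "search_inv t i xs f (col1, ys1) g' f' out'"
      "sweep c t adj (drop (g' 20) (todo cur)) (col1, ys1) = sweep c t adj (todo cur) (col, [])"
      "\<And>x. col x \<noteq> 0 \<Longrightarrow> col1 x = col x"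
      "m = sum_list (map vertex_cost (drop (g' 20) (todo cur)))"
      using I by (auto simp: I_def)
    have idx: "g' 20 < length (todo cur)" using that by (auto simp: I_def split: if_splits)
    define x where "x = todo cur ! g' 20"
    have drop: "drop (g' 20) (todo cur) = x # drop (g' 20 + 1) (todo cur)"
      using idx by (simp add: x_def Cons_nth_drop_Suc)
    have regs: "g' 21 = of_bool (q < length cur)" "g' 17 = g 17" "g' 16 = c" "g' 19 = length (todo cur)"
      using I by (auto simp: I_def h_def g)
    show ?thesis
    proof (rule wp_level_step[OF I1(1) i(1) ct(3)])
      show "x < n" "g' 20 < n" using idx todo_less subsetD[OF todo_less(1) nth_mem[OF idx]] by (auto simp: x_def)
      show "g' 20 = x" if "g' 21 \<noteq> 0"
        using that idx regs(1) by (auto simp: x_def todo_def split: if_splits)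
      show "g' 20 < q \<and> g' 17 \<in> {5, 6} \<and> cell W f' (8 * g' 20 + g' 17) = x \<and> col1 x = g' 16"
        if "g' 21 = 0"
      proof -
        have nb: "todo cur = cur" "length cur \<le> q" using that regs(1) by (auto simp: todo_def split: if_splits)
        then have 1: "g' 20 < q" "x = cur ! g' 20" using idx by (auto simp: x_def)
        have "cell W f (8 * g' 20 + g 17) = x"
          using que idx 1 nb by (simp add: queue_def)
        moreover have "cell W f' (8 * g' 20 + g 17) = cell W f (8 * g' 20 + g 17)"
          using I1(1) i 1(1) g(6) by (auto simp: search_inv_def keeps_cells_def)
        moreover have "col1 x = c"
          using I1(3)[of x] cur_col[of x] ct(4) idx nb 1(2) by simp
        ultimately show ?thesis using 1 regs g(6) by simp
      qed
    next
      fix k' g'' f'' out''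
      assume *: "k' + 2 \<le> k + vertex_cost x"
        "search_inv t i xs f (if col1 x = g' 16 then scan t (adj x) (col1, ys1) else (col1, ys1))
          g'' f'' out''"
        "g'' 20 = g' 20 + 1" "g'' 25 = of_bool (g' 20 + 1 < g' 19)"
        "\<And>r. r \<notin> {1, 4, 5, 6, 7, 8, 9, 10, 11, 12, 13, 18, 20, 22, 23, 25} \<Longrightarrow> g'' r = g' r"
      obtain col2 ys2 where 2: "(if col1 x = c then scan t (adj x) (col1, ys1) else (col1, ys1)) =
          (col2, ys2)"
        by fastforce
      have "I (sum_list (map vertex_cost (drop (g'' 20) (todo cur)))) g'' f'' out''"
        unfolding I_def
      proof (intro conjI allI impI exI[of _ col2] exI[of _ ys2])
        show "search_inv t i xs f (col2, ys2) g'' f'' out''" using *(2) by (simp only: regs 2)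
        show "sweep c t adj (drop (g'' 20) (todo cur)) (col2, ys2) = sweep c t adj (todo cur) (col, [])"
          using I1(2) by (simp only: drop sweep.simps 2 *(3))
        show "col2 y = col y" if "col y \<noteq> 0" for y
          using 2 I1(3)[OF that] scan_keeps_colour[of t "adj x" col1 ys1 col2 ys2 y] that
          by (auto split: if_splits)
        show "g'' r = h r" if "r \<notin> {1, 4, 5, 6, 7, 8, 9, 10, 11, 12, 13, 18, 20, 22, 23, 25}" for r
          using *(5)[OF that] I that by (simp add: I_def)
      qed (use idx *(3,4) regs in auto)
      moreover have "k' + 2 + sum_list (map vertex_cost (drop (g'' 20) (todo cur))) \<le> k + m"
        using *(1,3) I1(4) by (simp add: drop del: drop_Suc)
      ultimately show "\<exists>m'. I m' g'' f'' out'' \<and> k' + 2 + m' \<le> k + m" by blast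
    qed
  qed
  have start: "I (sum_list (map vertex_cost (todo cur))) (h(25 := of_bool (0 < length (todo cur)))) f out"
  proof -
    have "search_inv t i xs f (col, []) (h(25 := of_bool (0 < length (todo cur)))) f out"
      using arr g by (auto simp: search_inv_def h_def queue_def keeps_cells_def)
    then show ?thesis
      unfolding I_def by (intro conjI exI[of _ col] exI[of _ "[]"]) (simp_all add: h_def)
  qed
  have lim: "length (todo cur) = (if q < length cur then n else length cur)"
    by (simp add: todo_def)
  have finish: "Q k' g' f' out'"
    if I: "I m' g'' f' out'" and z: "val g'' (Reg 25) = 0"
      and k': "k' \<le> k + 40 + sum_list (map vertex_cost (todo cur))"
      and g': "g' = g''(15 := g'' 18, 16 := g'' 14, 17 := g'' 24)" for k' g' g'' f' out' m'
  proof -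
    obtain col1 ys1 where I1: "search_inv t i xs f (col1, ys1) g'' f' out'"
      "sweep c t adj (drop (g'' 20) (todo cur)) (col1, ys1) = sweep c t adj (todo cur) (col, [])"
      using I by (auto simp: I_def)
    have "\<not> g'' 20 < length (todo cur)" using I z by (auto simp: I_def)
    then have "sweep c t adj (todo cur) (col, []) = (col1, ys1)" using I1(2) by simp
    then have "bfs_state E s (Suc d) col1 ys1 (xs @ ys1)"
      using cur_less todo_less set_adj
      by (intro sweep_correct[OF bfs, of "todo cur" adj]) (auto simp: todo_def c_def t_def)
    moreover have "g'' 0 = n" using I by (simp add: I_def h_def g)
    ultimately have "loop_inv s (Suc d) col1 ys1 (xs @ ys1) g' f' out'"
      using I1(1) i(1) by (auto simp: loop_inv_def search_inv_def g' t_def)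
    with k' show ?thesis by (rule Q)
  qed
  show ?thesis
    unfolding level_loop_def seq.simps
    apply (rule wp_Seq, rule wp_Sub, simp, simp, simp add: g ct)
    apply (rule wp_Seq, rule wp_Sub, simp, simp, simp add: i)
    apply (rule wp_Seq, rule wp_Move, simp)
    apply (rule wp_Seq, rule wp_Move, simp)
    apply (rule wp_Seq, rule wp_Lt, simp, simp)
    apply (rule wp_Seq, rule wp_If, simp)
     apply (rule wp_Move, simp)
     apply (rule wp_Seq, rule wp_Lt, simp, simp)
     apply (rule wp_Seq, rule wp_While[where I = I and m = "sum_list (map vertex_cost (todo cur))"], simp)
    using start apply (simp add: h_def g ct i lim split: if_splits)
      apply (rule step, assumption, assumption)
     apply (rule wp_Seq, rule wp_Move, simp)
     apply (rule wp_Seq, rule wp_Move, simp)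
     apply (rule wp_Move, simp)
     apply (erule finish, assumption, simp, simp)
    apply (rule wp_Move, simp)
    apply (rule wp_Seq, rule wp_Lt, simp, simp)
    apply (rule wp_Seq, rule wp_While[where I = I and m = "sum_list (map vertex_cost (todo cur))"], simp)
    using start apply (simp add: h_def g ct i lim split: if_splits)
     apply (rule step, assumption, assumption)
    apply (rule wp_Seq, rule wp_Move, simp)
    apply (rule wp_Seq, rule wp_Move, simp)
    apply (rule wp_Move, simp)
    apply (erule finish, assumption, simp, simp)
    done
qed

end

section \<open>Initialisation\<close>

text \<open>Keeps all intermediate values of the tabulation below the square of a base, hence
  small.\<close>

lemma halve_up_le: "0 < y \<Longrightarrow> (halve_up ^^ m) y \<le> y"
proof -
  assume "0 < y"
  have "(halve_up ^^ m) y * 2 ^ m < y + 2 ^ m" by (rule halve_up_less)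
  also have "\<dots> \<le> (y + 1) * 2 ^ m" by simp
  finally have "(halve_up ^^ m) y < y + 1" by (simp only: mult_less_cancel2)
  then show ?thesis by simp
qed

context bfs_ram
begin

lemma wp_init_params:
  assumes g: "g 0 = n" and min: "\<And>i. 1 \<le> i \<Longrightarrow> i < q \<Longrightarrow> 2 ^ i < n"
    and Q: "\<And>k' g'. k' \<le> k + 20 + 10 * q \<Longrightarrow> g' 2 = q \<Longrightarrow> g' 24 = 2 ^ (q + 1) \<Longrightarrow> g' 3 = W \<Longrightarrow>
      (\<And>r. r \<notin> {2, 3, 23, 24} \<Longrightarrow> g' r = g r) \<Longrightarrow> Q k' g' f out"
  shows "wp init_params Q k g f out"
proof -
  define I where "I m g' f' out' \<longleftrightarrow> 1 \<le> g' 2 \<and> g' 2 \<le> q \<and> g' 24 = 2 ^ g' 2 \<and>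
      g' 23 = of_bool (g' 24 < n) \<and> (\<forall>r. r \<notin> {2, 23, 24} \<longrightarrow> g' r = g r) \<and> f' = f \<and>
      out' = out \<and> m = 8 * (q - g' 2)" for m :: nat and g' f' out'
  have step: "wp (Seq (Arith 24 Add (Reg 24) (Reg 24)) (Seq (Arith 2 Add (Reg 2) (Imm 1))
        (Arith 23 Lt (Reg 24) (Reg 0))))
      (\<lambda>k' g' f' out'. \<exists>m'. I m' g' f' out' \<and> k' + 2 + m' \<le> k + m) k g' f' out'"
    if I: "I m g' f' out'" and "val g' (Reg 23) \<noteq> 0" for m k g' f' out'
  proof -
    have "2 ^ g' 2 < n" using that by (auto simp: I_def split: if_splits)
    then have "2 ^ g' 2 < (2 :: nat) ^ q" using n_le by linarith
    then have less: "g' 2 < q" by simp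
    have eq: "g' 24 = 2 ^ g' 2" using I by (simp add: I_def)
    have "g' 24 \<le> 4 * 2 ^ q * 2 ^ q"
    proof -
      have "g' 24 \<le> 2 ^ q * 1" using less by (simp add: eq)
      also have "\<dots> \<le> 2 ^ q * (4 * 2 ^ q)" by (intro mult_le_mono2) simp
      finally show ?thesis by (simp add: mult_ac)
    qed
    then have b: "g' 24 + g' 24 < 2 ^ b" by (intro small_add small_square)
    have b2: "Suc (g' 2) < 2 ^ b" using less by (intro small_less small_le[OF small_q]) simp
    show ?thesis
      apply (rule wp_Seq, rule wp_Add, simp, simp, simp add: b)
      apply (rule wp_Seq, rule wp_Add, simp, simp, simp add: b2)
      apply (rule wp_Lt, simp, simp)
      apply (rule exI[of _ "8 * (q - Suc (g' 2))"])
      using I less g by (auto simp: I_def)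
  qed
  have P: "(2 :: nat) ^ q + 2 ^ q < 2 ^ b"
    by (intro small_add small_square) simp_all
  have "small 15" by (simp add: small_const)
  then have b15: "q * 15 < 2 ^ b" by (intro small_mult small_q)
  show ?thesis
    unfolding init_params_def seq.simps
    apply (rule wp_Seq, rule wp_Move, simp)
    apply (rule wp_Seq, rule wp_Move, simp)
    apply (rule wp_Seq, rule wp_Lt, simp, simp)
    apply (rule wp_Seq, rule wp_While[where I = I and m = "8 * (q - 1)"], simp)
    using g q_pos apply (simp add: I_def)
     apply (rule step, assumption, assumption)
    subgoal premises p for m' k' g' f' out'
    proof -
      have "\<not> 2 ^ g' 2 < n" using p(1,2) by (auto simp: I_def)
      then have 1: "g' 2 = q" using p(1) min[of "g' 2"] by (force simp: I_def)
      then have 2: "g' 24 = 2 ^ q" "f' = f" "out' = out"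
        "\<And>r. r \<notin> {2, 23, 24} \<Longrightarrow> g' r = g r" "k' \<le> k + 8 + 8 * q"
        using p by (auto simp: I_def)
      show ?thesis
        unfolding 2(2,3)
        apply (rule wp_Seq, rule wp_Add, simp, simp, simp add: 2 P)
        apply (rule wp_Mul, simp, simp, simp add: 1 b15)
        apply (rule Q)
        using 2(5) by (simp_all add: 1 2(1-4) W_def)
    qed
    done
qed

lemma wp_data_start:
  assumes "g 2 = q" "g 3 = W" "r \<notin> {2, 3}"
    and Q: "\<And>k'. k' \<le> k + 5 \<Longrightarrow> Q k' (g(r := D)) f out"
  shows "wp (data_start r) Q k g f out"
proof -
  have D: "D < 2 ^ b" using D_le_S by (intro small_less small_S)
  have "8 * (q + 1) * 1 \<le> 8 * (q + 1) * W" using W_pos by (intro mult_le_mono2) simp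
  then have "8 * (q + 1) \<le> D" unfolding D_def by (simp only: mult_1_right)
  then have "8 * (q + 1) < 2 ^ b" using D by (rule le_less_trans)
  moreover have "q + 1 < 2 ^ b" using small_add[OF small_q small_const[of 1]] by simp
  ultimately have b: "Suc q < 2 ^ b" "Suc q * 8 < 2 ^ b" "Suc q * 8 * W < 2 ^ b"
    using D by (simp_all only: D_def mult.commute[of 8] Suc_eq_plus1)
  show ?thesis
    unfolding data_start_def seq.simps
    apply (rule wp_Seq, rule wp_Add, simp, simp, simp add: assms b)
    apply (rule wp_Seq, rule wp_Mul, simp, simp)
    using b(2) apply (simp add: assms)
    apply (rule wp_Mul, simp, simp)
    using b(3) assms(3) apply (simp add: assms)
    using Q[of "Suc (Suc (Suc (Suc (Suc k))))"] assms(3)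
    by (simp add: assms D_def mult.commute[of _ 8])
qed

lemma wp_table_level:
  assumes g: "g 0 = n" "g 2 = q" "g 3 = W" "g 24 = 2 ^ (q + 1)" "g 7 < q"
    "g 9 = base q (g 7)" "g 10 = addr q n D (g 7)"
    and Q: "\<And>k' g' f'. k' \<le> k + 90 + 10 * q \<Longrightarrow> g' 7 = g 7 + 1 \<Longrightarrow> g' 9 = base q (g 7 + 1) \<Longrightarrow>
      g' 10 = addr q n D (g 7 + 1) \<Longrightarrow> g' 23 = of_bool (g 7 + 1 < q) \<Longrightarrow>
      (\<And>r. r \<notin> {4, 7, 8, 9, 10, 11, 12, 13, 23} \<Longrightarrow> g' r = g r) \<Longrightarrow>
      f' = set_cell W (8 * g 7 + 1) (width q (g 7)) (set_cell W (8 * g 7 + 2) (addr q n D (g 7))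
        (set_cell W (8 * g 7) (base q (g 7)) f)) \<Longrightarrow> Q k' g' f' out"
  shows "wp table_level Q k g f out"
proof -
  define j where "j = g 7"
  define y where "y = base q j * base q j"
  have j: "g 7 = j" "j < q" using g by (simp_all add: j_def)
  have y0: "0 < y" using base_pos by (simp add: y_def)
  have width: "shift q y = width q j" by (simp add: width_def y_def)
  have small_hv: "small ((halve_up ^^ m) y)" for m
    using halve_up_le[OF y0, of m] base_square[of j] unfolding y_def by (intro small_square) simp
  have small_y: "y < 2 ^ b" using small_less[OF small_hv[of 0]] by simp
  \<comment> \<open>\<open>h\<close> stands for registers and memory at loop entry, because the
    value left in the scratch register 4 is only fixed there.\<close>
  define I where "I h m g' f' out' \<longleftrightarrow> g' 8 \<le> width q j \<and> g' 13 = (halve_up ^^ g' 8) y \<and>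
      g' 12 = of_bool (2 ^ (q + 1) < g' 13) \<and> (\<forall>r. r \<notin> {8, 12, 13} \<longrightarrow> g' r = fst h r) \<and>
      f' = snd h \<and> out' = out \<and> m = 9 * (width q j - g' 8)"
    for h and m :: nat and g' :: "nat \<Rightarrow> nat" and f' :: "nat \<Rightarrow> bool" and out'
  have step: "wp halving (\<lambda>k' g' f' out'. \<exists>m'. I h m' g' f' out' \<and> k' + 2 + m' \<le> k + m) k g' f' out'"
    if I: "I h m g' f' out'" and "val g' (Reg 12) \<noteq> 0" and h: "fst h 24 = 2 ^ (q + 1)"
    for h m k g' f' out'
  proof -
    have "2 ^ (q + 1) < (halve_up ^^ g' 8) y" using that by (auto simp: I_def split: if_splits)
    then have "g' 8 \<noteq> width q j" using shift_le[of q y] width by auto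
    then have less: "g' 8 < width q j" using I by (simp add: I_def)
    have 13: "g' 13 = (halve_up ^^ g' 8) y" using I by (simp add: I_def)
    have b: "Suc ((halve_up ^^ g' 8) y) < 2 ^ b" "Suc (g' 8) < 2 ^ b"
      using small_add[OF small_hv small_const[of 1], of "g' 8"] less
        small_less[OF small_le[OF small_width[of j]], of "Suc (g' 8)"] by auto
    have suc: "(halve_up ^^ Suc (g' 8)) y = Suc ((halve_up ^^ g' 8) y) div 2"
      by (simp add: halve_up_def)
    show ?thesis
      unfolding halving_def seq.simps
      apply (rule wp_Seq, rule wp_Add, simp, simp, simp add: 13 b)
      apply (rule wp_Seq, rule wp_Shr, simp, simp)
      apply (rule wp_Seq, rule wp_Add, simp, simp, simp add: b)
      apply (rule wp_Lt, simp, simp)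
      apply (rule exI[of _ "9 * (width q j - Suc (g' 8))"])
      using I less h 13 suc by (auto simp: I_def simp del: funpow.simps)
  qed
  have "n div 2 ^ Suc j + 1 \<le> n + 1" by simp
  then have 1: "n div 2 ^ Suc j + 1 < 2 ^ b"
    using small_add[OF small_le[OF small_square[of "2 ^ q"] n_le] small_const[of 1]]
    by (rule le_less_trans) simp_all
  have "addr q n D (Suc j) \<le> S" unfolding S_eq' using j by (intro addr_mono) simp
  then have 2: "addr q n D j + (n div 2 ^ Suc j + 1) * width q j < 2 ^ b"
    using small_less[OF small_S] by (simp add: addr_Suc mult.commute)
  then have 3: "(n div 2 ^ Suc j + 1) * width q j < 2 ^ b" by linarith
  have 4: "Suc j < 2 ^ b" using j by (intro small_less small_le[OF small_q]) simp
  note bb = 1[simplified] 2[simplified] 3[simplified] 4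
  show ?thesis
    unfolding table_level_def seq.simps
    apply (rule wp_Seq, rule wp_store_cell, simp, simp, simp, simp, simp, simp add: g, use g in simp, simp)
    apply (rule wp_Seq, rule wp_store_cell, simp, simp, simp, simp, simp, simp add: g, use g in simp, simp)
    apply (rule wp_Seq, rule wp_Mul, simp, simp, simp add: g j small_y[unfolded y_def])
    apply (rule wp_Seq, rule wp_Move, simp)
    apply (rule wp_Seq, rule wp_Lt, simp, simp)
    subgoal for k' v k'' v'
      apply (rule wp_Seq, rule wp_While[where m = "9 * width q j" and I = "I (g(4 := v'),
          set_cell W (8 * j + 2) (addr q n D j) (set_cell W (8 * j) (base q j) f))"], simp)
      using g j apply (simp add: I_def y_def)
       apply (rule step, assumption, assumption, simp add: g)
      subgoal premises p for m' k''' g' f' out'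
      proof -
        have "\<not> 2 ^ (q + 1) < (halve_up ^^ g' 8) y" using p(3,4) by (auto simp: I_def)
        then have "\<not> g' 8 < width q j" using shift_greater[of "g' 8" q y] width by auto
        then have 8: "g' 8 = width q j" using p(3) by (simp add: I_def)
        then have 13: "g' 13 = base q (Suc j)"
          using p(3) by (simp add: I_def y_def width_def)
        have r: "g' 7 = j" "g' 10 = addr q n D j" "g' 0 = n" "g' 2 = q" "g' 3 = W"
          "\<And>r. r \<notin> {4, 7, 8, 9, 10, 11, 12, 13, 23} \<Longrightarrow> g' r = g r"
          using p(3) j g by (simp_all add: I_def)
        have f': "f' = set_cell W (8 * j + 2) (addr q n D j) (set_cell W (8 * j) (base q j) f)"
          "out' = out" using p(3) by (simp_all add: I_def)
        have cost: "k''' \<le> k + 60 + 9 * q"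
          using p(1,2,5) width_le[OF q_pos, of j] by simp
        show ?thesis
          apply (rule wp_Seq, rule wp_store_cell, simp, simp, simp, simp, simp, simp add: r,
              use r j in simp, simp)
          apply (rule wp_Seq, rule wp_Move, simp)
          apply (rule wp_Seq, rule wp_Add, simp, simp, simp add: r bb)
          apply (rule wp_Seq, rule wp_Shr, simp, simp)
          apply (rule wp_Seq, rule wp_Add, simp, simp, simp add: r bb)
          apply (rule wp_Seq, rule wp_Mul, simp, simp, simp add: r 8 bb)
          apply (rule wp_Seq, rule wp_Add, simp, simp, simp add: r 8 bb)
          apply (rule wp_Lt, simp, simp)
          unfolding f'(2)
          apply (rule Q)
          using cost apply simp
               apply (simp_all add: r 8 13 j f' addr_Suc mult.commute del: base.simps)
          done
      qed
      done
    done
qed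

lemma wp_init_table:
  assumes g: "g 0 = n" "g 2 = q" "g 3 = W" "g 24 = 2 ^ (q + 1)"
    and Q: "\<And>k' g' f'. k' \<le> k + 20 + 100 * (q + 1) * (q + 1) \<Longrightarrow> table_ok f' \<Longrightarrow> g' 10 = S \<Longrightarrow>
      (\<And>r. r \<notin> {4, 7, 8, 9, 10, 11, 12, 13, 23} \<Longrightarrow> g' r = g r) \<Longrightarrow> Q k' g' f' out"
  shows "wp init_table Q k g f out"
proof -
  define C where "C = 92 + 10 * q"
  define I where "I m g' f' out' \<longleftrightarrow> g' 7 \<le> q \<and> g' 9 = base q (g' 7) \<and> g' 10 = addr q n D (g' 7) \<and>
      g' 23 = of_bool (g' 7 < q) \<and> (\<forall>j<g' 7. cell W f' (8 * j) = base q j \<and>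
        cell W f' (8 * j + 1) = width q j \<and> cell W f' (8 * j + 2) = addr q n D j) \<and>
      (\<forall>r. r \<notin> {4, 7, 8, 9, 10, 11, 12, 13, 23} \<longrightarrow> g' r = g r) \<and> out' = out \<and>
      m = C * (q - g' 7)"
    for m :: nat and g' :: "nat \<Rightarrow> nat" and f' :: "nat \<Rightarrow> bool" and out'
  have step: "wp table_level (\<lambda>k' g' f' out'. \<exists>m'. I m' g' f' out' \<and> k' + 2 + m' \<le> k + m) k g' f' out'"
    if I: "I m g' f' out'" and "val g' (Reg 23) \<noteq> 0" for m k g' f' out'
  proof -
    have less: "g' 7 < q" using that by (auto simp: I_def split: if_splits)
    define j where "j = g' 7"
    have j: "g' 7 = j" "j < q" using less by (simp_all add: j_def)
    have small: "base q j < 2 ^ W" "width q j < 2 ^ W" "addr q n D j < 2 ^ W"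
      using small_base small_width small_S[of "addr q n D j"] addr_mono[of j q q n D] j
      by (auto simp: small_def S_eq')
    show ?thesis
    proof (rule wp_table_level)
      fix k' g'' f''
      assume *: "k' \<le> k + 90 + 10 * q" "g'' 7 = g' 7 + 1" "g'' 9 = base q (g' 7 + 1)"
        "g'' 10 = addr q n D (g' 7 + 1)" "g'' 23 = of_bool (g' 7 + 1 < q)"
        "\<And>r. r \<notin> {4, 7, 8, 9, 10, 11, 12, 13, 23} \<Longrightarrow> g'' r = g' r"
        "f'' = set_cell W (8 * g' 7 + 1) (width q (g' 7)) (set_cell W (8 * g' 7 + 2)
          (addr q n D (g' 7)) (set_cell W (8 * g' 7) (base q (g' 7)) f'))"
      have cells: "cell W f'' (8 * i) = base q i" "cell W f'' (8 * i + 1) = width q i"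
        "cell W f'' (8 * i + 2) = addr q n D i" if "i < g'' 7" for i
      proof -
        have ne: "8 * i \<noteq> 8 * j + 1" "8 * i \<noteq> 8 * j + 2" "8 * i + 1 \<noteq> 8 * j + 2"
          "8 * i + 1 \<noteq> 8 * j" "8 * i + 2 \<noteq> 8 * j + 1" "8 * i + 2 \<noteq> 8 * j"
          by presburger+
        have "i = j \<or> i < j" using that *(2) j(1) by auto
        then show "cell W f'' (8 * i) = base q i" "cell W f'' (8 * i + 1) = width q i"
          "cell W f'' (8 * i + 2) = addr q n D i"
          using I ne small by (auto simp: *(7) j(1) I_def cell_set_cell)
      qed
      have "I (C * (q - g'' 7)) g'' f'' out'"
        unfolding I_def
      proof (intro conjI allI impI)
        show "g'' r = g r" if "r \<notin> {4, 7, 8, 9, 10, 11, 12, 13, 23}" for r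
          using *(6)[OF that] I that by (simp add: I_def)
      qed (use I less * cells in \<open>auto simp: I_def simp del: base.simps\<close>)
      moreover have "q - g' 7 = Suc (q - g'' 7)" using less *(2) by simp
      then have "C * (q - g'' 7) + C = m" using I by (simp add: I_def)
      then have "k' + 2 + C * (q - g'' 7) \<le> k + m" using *(1) by (simp add: C_def)
      ultimately show "\<exists>m'. I m' g'' f'' out' \<and> k' + 2 + m' \<le> k + m" by blast
    qed (use I less g in \<open>auto simp: I_def\<close>)
  qed
  have "C * q \<le> 100 * (q + 1) * (q + 1)" by (simp add: C_def algebra_simps)
  note cost = this
  show ?thesis
    unfolding init_table_def seq.simps
    apply (rule wp_Seq, rule wp_Move, simp)
    apply (rule wp_Seq, rule wp_Move, simp)
    apply (rule wp_Seq, rule wp_data_start, simp add: g, simp add: g, simp)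
    apply (rule wp_Seq, rule wp_Lt, simp, simp)
    apply (rule wp_While[where m = "C * q" and I = I], simp)
    using g apply (simp add: I_def addr_def)
     apply (rule step, assumption, assumption)
    subgoal premises p for k' m' k'' g' f' out'
    proof -
      have 7: "g' 7 = q" using p(2,3) by (auto simp: I_def split: if_splits)
      have 1: "out' = out" "table_ok f'" "g' 10 = S"
        "\<And>r. r \<notin> {4, 7, 8, 9, 10, 11, 12, 13, 23} \<Longrightarrow> g' r = g r"
        using p(2) 7 by (simp_all add: I_def table_ok_def S_eq')
      have "k'' \<le> k + 20 + 100 * (q + 1) * (q + 1)" using p(1,4) cost by linarith
      then show ?thesis unfolding 1(1) by (rule Q[OF _ 1(2-4)])
    qed
    done
qed

lemma wp_init_zero:
  assumes g: "g 2 = q" "g 3 = W" "g 10 = S" and table: "table_ok f"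
    and Q: "\<And>k' g' f'. k' \<le> k + 30 + 8 * S \<Longrightarrow> array_ok (\<lambda>_. 0) f' \<Longrightarrow>
      (\<And>r. r \<notin> {4, 12, 23} \<Longrightarrow> g' r = g r) \<Longrightarrow> Q k' g' f' out"
  shows "wp init_zero Q k g f out"
proof -
  define I where "I m g' f' out' \<longleftrightarrow> D \<le> g' 12 \<and> g' 12 \<le> S \<and> g' 23 = of_bool (g' 12 < S) \<and>
      (\<forall>i. D \<le> i \<longrightarrow> i < g' 12 \<longrightarrow> \<not> f' i) \<and> (\<forall>i<8 * (q + 1). cell W f' i = cell W f i) \<and>
      (\<forall>r. r \<notin> {4, 12, 23} \<longrightarrow> g' r = g r) \<and> out' = out \<and> m = 7 * (S - g' 12)"
    for m :: nat and g' :: "nat \<Rightarrow> nat" and f' :: "nat \<Rightarrow> bool" and out'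
  have step: "wp (Seq (Store (Reg 12) (Imm 1) (Imm 0)) (Seq (Arith 12 Add (Reg 12) (Imm 1))
        (Arith 23 Lt (Reg 12) (Reg 10))))
      (\<lambda>k' g' f' out'. \<exists>m'. I m' g' f' out' \<and> k' + 2 + m' \<le> k + m) k g' f' out'"
    if I: "I m g' f' out'" and "val g' (Reg 23) \<noteq> 0" for m k g' f' out'
  proof -
    have less: "g' 12 < S" using that by (auto simp: I_def split: if_splits)
    have b: "Suc (g' 12) < 2 ^ b" using less by (intro small_less small_S) simp
    have cells: "cell W (set_field (g' 12) (Suc 0) 0 f') i = cell W f i" if "i < 8 * (q + 1)" for i
      using that I by (simp add: cell_set_data I_def)
    show ?thesis
      apply (rule wp_Seq, rule wp_Store, simp, simp, simp)
      using four_le_b apply simp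
      using less apply simp
      apply (rule wp_Seq, rule wp_Add, simp, simp, simp add: b)
      apply (rule wp_Lt, simp, simp)
      apply (rule exI[of _ "7 * (S - Suc (g' 12))"])
      using I less g cells by (auto simp: I_def set_field_def)
  qed
  have fin: "array_ok (\<lambda>_. 0) (set_cell W (8 * q + 3) 0 f')"
    if "\<And>i. D \<le> i \<Longrightarrow> i < S \<Longrightarrow> \<not> f' i" "\<And>i. i < 8 * (q + 1) \<Longrightarrow> cell W f' i = cell W f i" for f'
  proof -
    have "table_ok f'" using table that(2) by (intro same_cells_table[of f f']) (auto simp: same_cells_def)
    then have "table_ok (set_cell W (8 * q + 3) 0 f')"
      by (intro same_cells_table[OF same_cells_set_cell]) simp_all
    moreover have "stored q n D 0 (\<lambda>_. 0) (\<lambda>_. 0) f'"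
      using that(1) by (intro stored_zero) (simp add: S_eq')
    moreover have "Suc (8 * q + 3) * W \<le> D" using cell_bound[of "8 * q + 3"] by (simp add: algebra_simps)
    moreover have "node q (\<lambda>_. 0) q 0 = 0"
      by (rule node_zero)
    ultimately show ?thesis by (simp add: array_ok_def stored_set_cell cell_set_cell)
  qed
  show ?thesis
    unfolding init_zero_def seq.simps
    apply (rule wp_Seq, rule wp_data_start, simp add: g, simp add: g, simp)
    apply (rule wp_Seq, rule wp_Lt, simp, simp)
    apply (rule wp_Seq, rule wp_While[where m = "7 * (S - D)" and I = I], simp)
    using g D_le_S apply (simp add: I_def)
     apply (rule step, assumption, assumption)
    subgoal premises p for k' m' k'' g' f' out'
    proof -
      have 12: "g' 12 = S" using p(2,3) by (auto simp: I_def split: if_splits)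
      have 1: "out' = out" "g' 2 = q" "g' 3 = W" "\<And>r. r \<notin> {4, 12, 23} \<Longrightarrow> g' r = g r"
        "array_ok (\<lambda>_. 0) (set_cell W (8 * q + 3) 0 f')"
        using p(2) 12 g fin[of f'] by (simp_all add: I_def)
      show ?thesis
        apply (rule wp_store_cell, simp, simp, simp, simp, simp, simp add: 1, simp add: 1, simp)
        unfolding 1(1)
        apply (rule Q)
        using p(1,4) apply simp
        using 1 by simp_all
    qed
    done
qed

end

context bfs_input
begin

lemma wp_init_search:
  assumes g: "g 0 = n" "g 1 = s" "g 2 = q" "g 3 = W" "s < n" and arr: "array_ok (\<lambda>_. 0) f"
    and Q: "\<And>k' g' f'. k' \<le> k + 50 + 200 * (q + 1) \<Longrightarrow>
      loop_inv s 0 ((\<lambda>_. 0)(s := 1)) [s] [s] g' f' [s] \<Longrightarrow> Q k' g' f' [s]"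
  shows "wp init_search Q k g f []"
proof -
  have s: "s < 2 ^ W" using g by (intro less_cell) simp
  show ?thesis
    unfolding init_search_def seq.simps
    apply (rule wp_Seq, rule wp_Output, simp)
    apply (rule wp_Seq, rule wp_Move, simp)
    apply (rule wp_Seq, rule wp_Move, simp)
    apply (rule wp_Seq, rule wp_read_trit[where col = "\<lambda>_. 0"], rule arr, simp add: g, simp add: g,
        use g in simp)
    subgoal premises p for k1 g1 f1
      apply (rule wp_Seq, rule wp_write_trit[where col = "\<lambda>_. 0"])
            apply (fact p)
           apply (use p(3) g in \<open>simp_all add: p(3)\<close>)[4]
      using p(3,5) apply simp
      subgoal premises p' for k2 g2 f2
      proof -
        have r: "g2 0 = n" "g2 1 = s" "g2 2 = q" "g2 3 = W"
          using g by (simp_all add: p'(2) p(3))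
        have arr2: "array_ok ((\<lambda>_. 0)(s := 1)) f2" using p'(3) g by (simp add: p(3))
        have arr3: "array_ok ((\<lambda>_. 0)(s := 1)) (set_cell W 5 s f2)"
          using array_ok_set_queue[OF arr2 _ s, of 0 5] q_pos by simp
        show ?thesis
          apply (rule wp_Seq, rule wp_Move, simp)
          apply (rule wp_Seq, rule wp_store_cell, simp, simp, simp, simp, simp, simp add: r, simp, simp)
          apply (rule wp_Seq, rule wp_Move, simp)
          apply (rule wp_Seq, rule wp_Move, simp)
          apply (rule wp_Move, simp)
          using g(2) apply simp
          apply (rule Q)
          using p(1) p'(1) apply simp
          using r arr3 s bfs_state_start[of E s]
          by (auto simp: loop_inv_def queue_def cell_set_cell)
      qed
      done
    done
qed

section \<open>Amortised running time\<close>

definition sweep_cost :: nat where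
  "sweep_cost = (\<Sum>x<n. 600 * (length (adj x) + 1))"

text \<open>The budget of a vertex: its own expansion, the overhead of a level, and a share of
  \<open>1 / (q + 1)\<close> in one full sweep, by \<open>sum_vertex_cost\<close>.\<close>

definition weight :: "nat \<Rightarrow> nat" where
  "weight v = vertex_cost v + 50 + sweep_cost"

text \<open>Its total weight is the potential of the outer loop; each level spends the weights of
  its own vertices.\<close>

definition remaining :: "nat \<Rightarrow> nat \<Rightarrow> nat set" where
  "remaining s d = {v. (s, v) \<in> E\<^sup>* \<and> v < n \<and> d \<le> level E s v}"

lemma sum_vertex_cost: "(\<Sum>x<n. vertex_cost x) = (q + 1) * sweep_cost"
  unfolding sweep_cost_def sum_distrib_left
  by (intro sum.cong) (simp_all add: vertex_cost_def node_cost_def algebra_simps)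

text \<open>
  A level of more than \<open>q\<close> vertices can afford a sweep over the whole graph with array accesses
  in time \<open>O(q)\<close>, since there are at most \<open>n / q\<close> such levels.
\<close>

lemma todo_cost:
  assumes "distinct cur" "cur \<noteq> []"
  shows "sum_list (map vertex_cost (todo cur)) + 50 \<le> (\<Sum>v\<in>set cur. weight v)"
proof -
  have card: "card (set cur) = length cur" "1 \<le> length cur"
    using assms by (auto simp: distinct_card Suc_le_eq)
  have w: "(\<Sum>v\<in>set cur. weight v) =
      (\<Sum>v\<in>set cur. vertex_cost v) + length cur * 50 + length cur * sweep_cost"
    by (simp add: weight_def sum.distrib card)
  show ?thesis
  proof (cases "q < length cur")
    case True
    \<comment> \<open>More than \<open>q\<close> means at least \<open>q + 1\<close> vertices, so
      their shares buy the whole sweep.\<close>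
    have "(q + 1) * sweep_cost \<le> length cur * sweep_cost" using True by (intro mult_le_mono1) simp
    then show ?thesis
      using True card(2) sum_vertex_cost
      by (simp add: w todo_def atLeast0LessThan interv_sum_list_conv_sum_set_nat)
  next
    case False
    then have "sum_list (map vertex_cost (todo cur)) = (\<Sum>v\<in>set cur. vertex_cost v)"
      using assms(1) by (simp add: todo_def sum_list_distinct_conv_sum_set)
    then show ?thesis using card(2) by (simp add: w)
  qed
qed

lemma sum_remaining:
  assumes "s < n"
  shows "(\<Sum>v\<in>remaining s d. weight v) =
    (\<Sum>v\<in>level_set E s d. weight v) + (\<Sum>v\<in>remaining s (Suc d). weight v)"
proof -
  have "remaining s d = level_set E s d \<union> remaining s (Suc d)"
    using level_set_less[OF assms, of d] by (auto simp: remaining_def level_set_def)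
  moreover have "level_set E s d \<inter> remaining s (Suc d) = {}"
    by (auto simp: remaining_def level_set_def)
  moreover have "finite (level_set E s d)" "finite (remaining s (Suc d))"
    using finite_subset[OF level_set_less[OF assms]]
    by (auto intro!: finite_subset[of "remaining s (Suc d)" "{..<n}"] simp: remaining_def)
  ultimately show ?thesis by (simp add: sum.union_disjoint)
qed

lemma wp_bfs_program:
  assumes g: "g 0 = n" "g 1 = s" "s < n" and min: "\<And>i. 1 \<le> i \<Longrightarrow> i < q \<Longrightarrow> 2 ^ i < n"
  shows "wp bfs_program (\<lambda>k g f xs. distinct xs \<and> set xs = {v. (s, v) \<in> E\<^sup>*} \<and>
      sorted (map (level E s) xs) \<and>
      k \<le> 1000 * (q + 1) * (q + 1) + 8 * S + (\<Sum>v<n. weight v)) 0 g f []"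
proof -
  define I where "I m g' f' out' \<longleftrightarrow> (\<exists>d col cur xs. loop_inv s d col cur xs g' f' out' \<and>
      m = (\<Sum>v\<in>remaining s d. weight v))"
    for m :: nat and g' f' out'
  have step: "wp level_loop (\<lambda>k' g' f' out'. \<exists>m'. I m' g' f' out' \<and> k' + 2 + m' \<le> k + m) k g' f' out'"
    if I: "I m g' f' out'" and "val g' (Reg 15) \<noteq> 0" for m k g' f' out'
  proof -
    obtain d col cur xs where inv: "loop_inv s d col cur xs g' f' out'"
      and m: "m = (\<Sum>v\<in>remaining s d. weight v)"
      using I by (auto simp: I_def)
    have cur: "cur \<noteq> []" "distinct cur" "set cur = level_set E s d"
      using inv that by (auto simp: loop_inv_def bfs_state_def)
    show ?thesis
    proof (rule wp_level_loop[OF inv g(3)])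
      fix k' g'' f'' out'' col' ys
      assume *: "k' \<le> k + 40 + sum_list (map vertex_cost (todo cur))"
        "loop_inv s (Suc d) col' ys (xs @ ys) g'' f'' out''"
      have "I (\<Sum>v\<in>remaining s (Suc d). weight v) g'' f'' out''"
        using *(2) by (auto simp: I_def)
      moreover have "k' + 2 + (\<Sum>v\<in>remaining s (Suc d). weight v) \<le> k + m"
        using *(1) todo_cost[OF cur(2,1)] sum_remaining[OF g(3), of d] by (simp add: m cur(3))
      ultimately show "\<exists>m'. I m' g'' f'' out'' \<and> k' + 2 + m' \<le> k + m" by blast
    qed
  qed
  have init_cost: "200 + 10 * q + 100 * (q + 1) * (q + 1) + 200 * (q + 1) \<le> 1000 * (q + 1) * (q + 1)"
    by (simp add: algebra_simps)
  have rem: "(\<Sum>v\<in>remaining s 0. weight v) \<le> (\<Sum>v<n. weight v)"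
    by (intro sum_mono2) (auto simp: remaining_def)
  show ?thesis
    unfolding bfs_program_def seq.simps
    apply (rule wp_Seq, rule wp_init_params, rule g, erule min, assumption)
    subgoal premises p1 for k1 g1
      apply (rule wp_Seq, rule wp_init_table)
          apply (use g p1 in \<open>simp_all\<close>)[4]
      subgoal premises p2 for k2 g2 f2
        apply (rule wp_Seq, rule wp_init_zero)
            apply (use p1 p2 in \<open>simp_all\<close>)[4]
        subgoal premises p3 for k3 g3 f3
          apply (rule wp_Seq, rule wp_init_search[where s = s])
                apply (use g p1 p2 p3 in \<open>simp_all\<close>)[6]
          subgoal premises p4 for k4 g4 f4
            apply (rule wp_While[where I = I and m = "\<Sum>v\<in>remaining s 0. weight v"], simp)
            using p4(2) apply (auto simp: I_def)[1]
             apply (rule step, assumption, assumption)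
            subgoal premises p5 for m' k5 g5 f5 out5
            proof -
              obtain d col cur xs where inv: "loop_inv s d col cur xs g5 f5 out5"
                using p5(1) by (auto simp: I_def)
              then have "cur = []" using p5(2) by (simp add: loop_inv_def)
              then have "level_set E s d = {}" using inv by (simp add: loop_inv_def bfs_state_def)
              from levels_upto_empty[OF this] inv
              have "distinct out5" "set out5 = {v. (s, v) \<in> E\<^sup>*}" "sorted (map (level E s) out5)"
                by (auto simp: loop_inv_def bfs_state_def)
              moreover have "k5 \<le> 1000 * (q + 1) * (q + 1) + 8 * S + (\<Sum>v<n. weight v)"
                using p1(1) p2(1) p3(1) p4(1) p5(3) rem init_cost by linarith
              ultimately show ?thesis by simp
            qed
            done
          done
        done
      done
    done
qed

end

section \<open>Time and space bounds\<close>

text \<open>The records take at most \<open>240 * q * q\<close> bits, and the one extra field per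
  level adds at most \<open>4 * q * q\<close>.\<close>

lemma (in bfs_ram) S_le:
  "real S \<le> n * log 2 3 + 4 + 244 * q * q"
proof -
  have "(\<Sum>i<q. width q i * (n div 2 ^ (i + 1) + 1)) =
      (\<Sum>i<q. width q i * (n div 2 ^ (i + 1))) + (\<Sum>i<q. width q i)"
    by (simp add: sum.distrib)
  then have "real S = real D + real (\<Sum>i<q. width q i * (n div 2 ^ (i + 1))) + real (\<Sum>i<q. width q i)"
    by (simp add: S_eq' addr_def)
  moreover have "D \<le> 240 * q * q" using q_pos by (simp add: D_def W_def)
  moreover have "(\<Sum>i<q. width q i) \<le> 4 * q * q"
    using sum_bounded_above[of "{..<q}" "width q" "4 * q"] width_le[OF q_pos] q_pos
    by (simp add: le_trans[of _ "q + 3" "4 * q"])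
  ultimately show ?thesis
    using sum_width_le[OF n_le] by (simp del: of_nat_sum add: of_nat_le_iff[symmetric, where 'a = real])
qed

text \<open>With \<open>2 ^ q <= 2 * n\<close> this gives \<open>q * q <= 4 * n\<close>, so
  quadratic terms in \<open>q\<close> are linear in \<open>n\<close>.\<close>

lemma square_le_power: "q * q \<le> 2 * 2 ^ (q :: nat)"
proof (cases "q < 4")
  case True
  then have "q \<in> {0, 1, 2, 3}" by auto
  then show ?thesis by auto
next
  case False
  then have "4 \<le> q" by simp
  then show ?thesis
  proof (induction q rule: dec_induct)
    case (step q)
    have "2 * q + 1 \<le> q * q" using step.hyps mult_le_mono1[of 4 q q] by linarith
    with step.IH show ?case by simp
  qed simp
qed

text \<open>\<open>q >= 1\<close> is imposed because even \<open>n = 1\<close> needs a tree whose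
  bases, starting at 3, stay within \<open>2 ^ (q + 1)\<close>.\<close>

lemma exponent_exists:
  fixes n :: nat
  assumes "0 < n"
  obtains q where "1 \<le> q" "n \<le> 2 ^ q" "\<And>i. 1 \<le> i \<Longrightarrow> i < q \<Longrightarrow> 2 ^ i < n"
    "real q \<le> log 2 n + 1" "2 ^ q \<le> 2 * n"
proof -
  define q where "q = (LEAST q. 1 \<le> q \<and> n \<le> 2 ^ q)"
  have "1 \<le> n \<and> n \<le> 2 ^ n" using assms less_exp[of n] by simp
  then have q: "1 \<le> q \<and> n \<le> 2 ^ q" unfolding q_def by (rule LeastI)
  have min: "2 ^ i < n" if "1 \<le> i" "i < q" for i
    using not_less_Least[of i "\<lambda>q. 1 \<le> q \<and> n \<le> 2 ^ q"] that by (auto simp: q_def)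
  have half: "2 ^ (q - 1) \<le> n"
  proof (cases "q = 1")
    case False
    then have "1 \<le> q - 1" "q - 1 < q" using q by linarith+
    then show ?thesis using min by (simp add: less_imp_le)
  qed (use assms in simp)
  have "log 2 (2 ^ (q - 1)) \<le> log 2 n"
    using of_nat_mono[OF half, where 'a = real] assms by (subst log_le_cancel_iff) auto
  then have "real q \<le> log 2 n + 1" using q by (simp add: of_nat_diff)
  moreover have "(2 :: nat) ^ q = 2 * 2 ^ (q - 1)" using q by (simp flip: power_Suc)
  then have "2 ^ q \<le> 2 * n" using half by simp
  ultimately show thesis using that q min by blast
qed

text \<open>With at least two vertices each vertex is an endpoint of an arc, and counting endpoints
  avoids a spanning tree; the \<open>+ 1\<close> is the single vertex.\<close>

lemma connected_card:
  assumes "pair_wf_digraph G" "finite (parcs G)" "Digraph_Component.connected (with_proj G)"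
    and "finite (pverts G)"
  shows "card (pverts G) \<le> 2 * card (parcs G) + 1"
proof (cases "card (pverts G) \<le> 1")
  case False
  have "pverts G \<subseteq> fst ` parcs G \<union> snd ` parcs G"
  proof
    fix v assume v: "v \<in> pverts G"
    have "pverts G \<noteq> {v}" using False by auto
    then obtain v' where v': "v' \<in> pverts G" "v' \<noteq> v" using v by blast
    have "v \<rightarrow>\<^sup>*\<^bsub>mk_symmetric (with_proj G)\<^esub> v'"
      using assms(3) v v'(1)
      by (auto simp: Digraph_Component.connected_def strongly_connected_def mk_symmetric_def)
    then obtain x where "(v, x) \<in> arcs_ends (with_proj (mk_symmetric (with_proj G)))"
      using v'(2) by (cases rule: pre_digraph.converse_reachable_cases[consumes 1]) auto
    then show "v \<in> fst ` parcs G \<union> snd ` parcs G"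
      by (force simp: arcs_ends_conv mk_symmetric_def)
  qed
  then have "card (pverts G) \<le> card (fst ` parcs G \<union> snd ` parcs G)"
    using assms(2) by (intro card_mono) auto
  also have "\<dots> \<le> card (fst ` parcs G) + card (snd ` parcs G)" by (rule card_Un_le)
  also have "\<dots> \<le> 2 * card (parcs G)"
    using card_image_le[OF assms(2), of fst] card_image_le[OF assms(2), of snd] by simp
  finally show ?thesis by simp
qed simp

text \<open>In the undirected reading each edge is the image of at most two arcs, so both readings
  of \<open>m\<close> are treated alike from here on.\<close>

lemma card_arcs_le:
  assumes "graph_with_edge_count G m"
  shows "pair_fin_digraph G" "card (parcs G) \<le> 2 * m"
proof -
  show fin: "pair_fin_digraph G"
  proof (cases "pair_fin_digraph G")
    case False
    then have "pair_pseudo_graph G" using assms unfolding graph_with_edge_count_def by simp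
    then show ?thesis by (rule pair_pseudo_graph.axioms(1))
  qed
  then have finite: "finite (parcs G)" by (rule pair_fin_digraph.pair_finite_arcs)
  show "card (parcs G) \<le> 2 * m"
  proof (cases "m = card (parcs G)")
    case False
    then have m: "m = card (undirected_edges G)" using assms by (auto simp: graph_with_edge_count_def)
    have "parcs G \<subseteq> (\<Union>e\<in>undirected_edges G. {p. {fst p, snd p} = e})"
      unfolding undirected_edges_def by force
    moreover have pairs: "finite {p. {fst p, snd p} = e} \<and> card {p. {fst p, snd p} = e} \<le> 2"
      if e: "e \<in> undirected_edges G" for e
    proof -
      from e obtain p where "e = (\<lambda>(u, v). {u, v}) p"
        unfolding undirected_edges_def by (rule imageE)
      then have "e = {fst p, snd p}" by (simp only: case_prod_unfold)
      then obtain u v where "e = {u, v}" ..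
      then have eq: "{p. {fst p, snd p} = e} = {(u, v), (v, u)}" by (auto simp: doubleton_eq_iff)
      show ?thesis unfolding eq using card_length[of "[(u, v), (v, u)]"] by (simp only: list.set list.size) simp
    qed
    moreover have fin': "finite (undirected_edges G)" using finite by (simp add: undirected_edges_def)
    ultimately have "card (parcs G) \<le> card (\<Union>e\<in>undirected_edges G. {p. {fst p, snd p} = e})"
      by (intro card_mono) simp_all
    also have "\<dots> \<le> (\<Sum>e\<in>undirected_edges G. card {p. {fst p, snd p} = e})"
      using fin' by (rule card_UN_le)
    also have "\<dots> \<le> (\<Sum>e\<in>undirected_edges G. 2)"
      using pairs by (intro sum_mono) simp
    finally have "card (parcs G) \<le> (\<Sum>e\<in>undirected_edges G. 2)" .
    then show ?thesis by (simp add: m)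
  qed simp
qed

lemma sum_out_degrees:
  fixes n :: nat
  assumes "finite E" "E \<subseteq> {..<n} \<times> {..<n}"
    and "\<And>u. u < n \<Longrightarrow> distinct (adj u) \<and> set (adj u) = {v. (u, v) \<in> E}"
  shows "(\<Sum>u<n. length (adj u)) = card E"
proof -
  have "length (adj u) = card {v. (u, v) \<in> E}" if "u < n" for u
    using assms(3)[OF that] by (metis distinct_card)
  then have deg: "(\<Sum>u<n. length (adj u)) = (\<Sum>u<n. card {v. (u, v) \<in> E})" by simp
  have fin: "finite {v. (u, v) \<in> E}" for u
    using finite_imageI[OF assms(1), of snd] by (rule rev_finite_subset) force
  have "(\<Sum>u<n. card {v. (u, v) \<in> E}) = card (SIGMA u:{..<n}. {v. (u, v) \<in> E})"
    using fin by (subst card_SigmaI) auto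
  also have "(SIGMA u:{..<n}. {v. (u, v) \<in> E}) = E" using assms(2) by auto
  finally show ?thesis using deg by simp
qed

lemma time_bound:
  fixes q n m e S X :: nat
  assumes "1 \<le> q" "q * q \<le> 4 * n" "1 \<le> n" "S \<le> 2 * n + 4 + 244 * q * q"
    and "e \<le> 2 * m" "n \<le> 2 * e + 1"
  shows "1000 * (q + 1) * (q + 1) + 8 * S + ((q + 1) * (600 * (n + e)) + 50 * n + n * (600 * (n + e)))
    \<le> 200000 * (m * n + 1)"
proof -
  have qq: "q \<le> q * q" using assms(1) by simp
  have "(q + 1) * (q + 1) \<le> (2 * q) * (2 * q)" using assms(1) by (intro mult_le_mono) auto
  then have "(q + 1) * (q + 1) \<le> 4 * (q * q)" by simp
  then have 1: "(q + 1) * (q + 1) \<le> 16 * n" using assms(2) by linarith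
  have 2: "q + 1 \<le> 5 * n" using qq assms(2,3) by linarith
  have "(q + 1) * (600 * (n + e)) \<le> 5 * n * (600 * (n + e))" using 2 by (rule mult_le_mono1)
  then have 3: "(q + 1) * (600 * (n + e)) + n * (600 * (n + e)) \<le> 3600 * (n * (n + e))"
    by (simp add: algebra_simps)
  have 4: "n \<le> n * (n + e)" using assms(3) by simp
  have 5: "n + e \<le> 6 * m + 1" using assms(5,6) by linarith
  have "n * (n + e) \<le> n * (6 * m + 1)" using 5 by (rule mult_le_mono2)
  also have "n * (6 * m + 1) = 6 * (m * n) + n" by (simp add: algebra_simps)
  finally have "n * (n + e) \<le> 6 * (m * n) + n" .
  \<comment> \<open>Without edges the hypotheses force \<open>n = 1\<close>, and the summand 1 is
    there for this case.\<close>
  moreover have "n \<le> m * n + 1"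
  proof (cases "m = 0")
    case False
    then have "n \<le> m * n" by simp
    then show ?thesis by (rule order_trans) simp
  qed (use assms in simp)
  ultimately have "n * (n + e) \<le> 6 * (m * n) + (m * n + 1)" by (meson add_left_mono order_trans)
  also have "\<dots> \<le> 7 * (m * n + 1)" by simp
  finally have 6: "n * (n + e) \<le> 7 * (m * n + 1)" .
  \<comment> \<open>Naming the products as atoms leaves a linear problem.\<close>
  define a b c d where "a = (q + 1) * (q + 1)" and "b = (q + 1) * (600 * (n + e))"
    and "c = n * (600 * (n + e))" and "d = n * (n + e)"
  define l where "l = m * n"
  have "1000 * a + 8 * S + (b + 50 * n + c) \<le> 200000 * (l + 1)"
    using 1 3 4 6 assms(2-4)
    unfolding a_def[symmetric] b_def[symmetric] c_def[symmetric] d_def[symmetric] l_def[symmetric]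
      mult.assoc[of 244] by linarith
  then show ?thesis unfolding a_def b_def c_def l_def mult.assoc .
qed

theorem theorem7:
  shows "\<exists>(P :: com) (\<kappa> :: nat) (c :: nat).
    \<forall>(G :: nat pair_pre_digraph) (n :: nat) (m :: nat) (s :: nat)
      (rom :: nat list) (w :: nat) (f :: nat \<Rightarrow> bool).
      graph_with_edge_count G m \<and> Digraph_Component.connected (with_proj G) \<and>
      adjacency_list G n rom \<and> s \<in> pverts G \<and>
      real \<kappa> * log 2 (real n + 1) \<le> real w \<longrightarrow>
      (\<exists>(t :: nat) (space :: nat) (xs :: nat list).
        halts_within w rom P (init_state n s f) t space xs \<and>
        bfs_order G s xs \<and>
        real space \<le> real n * log 2 3 + real c * ((log 2 (real n))\<^sup>2 + 1) \<and>
        t \<le> c * (m * n + 1))"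
proof -
  define R where "R = card (regs_of bfs_program)"
  have "\<exists>t space xs. halts_within w rom bfs_program (init_state n s f) t space xs \<and>
      bfs_order G s xs \<and>
      real space \<le> real n * log 2 3 + real (200000 + 72 * R) * ((log 2 (real n))\<^sup>2 + 1) \<and>
      t \<le> (200000 + 72 * R) * (m * n + 1)"
    if count: "graph_with_edge_count G m" and conn: "Digraph_Component.connected (with_proj G)"
      and adj_list: "adjacency_list G n rom" and s: "s \<in> pverts G"
      and w: "real 72 * log 2 (real n + 1) \<le> real w"
    for G n m s rom w f
  proof -
    interpret pair_fin_digraph G using count by (rule card_arcs_le)
    define E where "E = parcs G"
    have verts: "pverts G = {..<n}" and len: "length rom = n + 2 * card E"
      using adj_list by (auto simp: adjacency_list_def E_def)
    have sn: "s < n" "0 < n" using s verts by auto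
    have E: "finite E" "E \<subseteq> {..<n} \<times> {..<n}"
      using pair_finite_arcs arc_fst_in_verts arc_snd_in_verts by (force simp: E_def verts)+
    have E2: "card E \<le> 2 * m" "n \<le> 2 * card E + 1"
      using card_arcs_le(2)[OF count] connected_card[of G] conn pair_wf_digraph_axioms
      by (simp_all add: E_def verts pair_finite_arcs)
    have "\<forall>u\<in>{..<n}. \<exists>vs. linked_list rom n (rom ! u) vs \<and> distinct vs \<and> set vs = {v. (u, v) \<in> E}"
      using adj_list by (auto simp: adjacency_list_def E_def)
    then obtain adj where adj: "\<And>u. u < n \<Longrightarrow> linked_list rom n (rom ! u) (adj u)"
      "\<And>u. u < n \<Longrightarrow> distinct (adj u) \<and> set (adj u) = {v. (u, v) \<in> E}"
      by (auto dest!: bchoice)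
    obtain q where q: "1 \<le> q" "n \<le> 2 ^ q" "\<And>i. 1 \<le> i \<Longrightarrow> i < q \<Longrightarrow> 2 ^ i < n"
      "real q \<le> log 2 n + 1" "2 ^ q \<le> 2 * n"
      using exponent_exists[OF sn(2)] by blast
    \<comment> \<open>\<open>q <= log 2 n + 1 <= 2 * log 2 (n + 1)\<close>, so registers of
      \<open>36 * q\<close> bits fit into words of \<open>72 * log 2 (n + 1)\<close> bits; this is
      the origin of 72 for \<open>\<kappa>\<close>.\<close>
    have "log 2 n \<le> log 2 (real n + 1)" "1 \<le> log 2 (real n + 1)"
      using sn(2) by (auto simp: le_log_iff)
    then have "real (36 * q) \<le> real w" using q(4) w unfolding of_nat_mult of_nat_numeral by linarith
    then have b_le: "36 * q \<le> w" by simp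
    have "card E \<le> n * n" using card_mono[OF _ E(2)] by (simp add: card_cartesian_product)
    moreover have "n \<le> n * n" using sn by simp
    moreover have "n * n \<le> 2 ^ q * 2 ^ q" using q(2) by (intro mult_le_mono)
    ultimately have rom_len: "length rom \<le> 4 * 2 ^ q * 2 ^ q"
      unfolding len mult.assoc by linarith
    define S where "S = addr q n (8 * (q + 1) * (15 * q)) q"
    interpret bfs_input w S rom "36 * q" q n E adj
      using b_le q sn adj E rom_len len by unfold_locales (auto simp: S_def)
    define g where "g = (\<lambda>_ :: nat. 0 :: nat)(0 := n, 1 := s)"
    have "bounded g"
      using small_less[OF small_vertex, of n] small_less[OF small_vertex, of s] sn
      by (auto simp: bounded_def g_def)
    then obtain t g' f' xs where
      run: "run t (bfs_program, \<lparr>regs = g, work = f, outp = []\<rparr>) \<lparr>regs = g', work = f', outp = xs\<rparr>"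
      and xs: "distinct xs" "set xs = {v. (s, v) \<in> E\<^sup>*}" "sorted (map (level E s) xs)"
      and t: "t \<le> 1000 * (q + 1) * (q + 1) + 8 * S + (\<Sum>v<n. weight v)"
      using wp_bfs_program[of g s f] sn q(3) by (auto simp: wp_def g_def)
    have init: "init_state n s f = \<lparr>regs = g, work = f, outp = []\<rparr>"
      by (simp add: init_state_def g_def)
    have halts: "halts_within w rom bfs_program (init_state n s f) t (R * (36 * q) + S) xs"
      unfolding halts_within_def
    proof (rule exI[of _ S], rule exI[of _ "36 * q"], intro conjI allI impI ballI)
      show "\<exists>\<sigma>'. steps w S rom t (bfs_program, init_state n s f) = Some (Skip, \<sigma>') \<and> outp \<sigma>' = xs"
        using run_steps[OF run] by (simp add: init)
      show "regs \<sigma>' r < 2 ^ (36 * q)"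
        if "i \<le> t" "steps w S rom i (bfs_program, init_state n s f) = Some (c', \<sigma>')" for i c' \<sigma>' r
        using run_bounded[OF run that(1) that(2)[unfolded init]] by (simp add: bounded_def)
    qed (simp add: R_def)
    have bfs: "bfs_order G s xs"
      using s xs unfolding E_def by (rule bfs_order_levels)
    have L: "0 \<le> log 2 n" using sn by simp
    have "(real q)\<^sup>2 \<le> (log 2 n + 1)\<^sup>2" using q(4) by (intro power_mono) auto
    also have "\<dots> \<le> 2 * ((log 2 n)\<^sup>2 + 1)"
      using zero_le_power2[of "log 2 n - 1"] by (simp add: power2_eq_square algebra_simps)
    finally have q2: "real (q * q) \<le> 2 * ((log 2 n)\<^sup>2 + 1)" by (simp add: power2_eq_square)
    have "1 * 1 \<le> q * q" using q(1) by (intro mult_le_mono)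
    then have q1: "1 \<le> real (q * q)" "real q \<le> real (q * q)" using q(1) by (simp_all del: of_nat_mult)
    have "real (R * (36 * q) + S) \<le> real (36 * R) * real (q * q) + (n * log 2 3 + 4 + 244 * real (q * q))"
      using S_le mult_left_mono[OF q1(2), of "real (36 * R)"] by simp
    also have "\<dots> \<le> n * log 2 3 + real (36 * R + 248) * real (q * q)"
      using q1(1) by (simp add: algebra_simps)
    also have "\<dots> \<le> n * log 2 3 + real (36 * R + 248) * (2 * ((log 2 n)\<^sup>2 + 1))"
      using q2 by (intro add_left_mono mult_left_mono) auto
    also have "\<dots> = n * log 2 3 + real (496 + 72 * R) * ((log 2 n)\<^sup>2 + 1)"
      by (simp add: algebra_simps)
    \<comment> \<open>Space alone would allow 496; the larger constant is the one needed for
      time.\<close>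
    also have "\<dots> \<le> n * log 2 3 + real (200000 + 72 * R) * ((log 2 n)\<^sup>2 + 1)"
      by (intro add_left_mono mult_right_mono) auto
    finally have space: "real (R * (36 * q) + S) \<le>
        n * log 2 3 + real (200000 + 72 * R) * ((log 2 n)\<^sup>2 + 1)" .
    have "log 2 3 \<le> (2 :: real)" by (simp add: log_le_iff)
    then have "real n * log 2 3 \<le> real n * 2" by (intro mult_left_mono) auto
    then have "real S \<le> real (2 * n + 4 + 244 * q * q)" using S_le by simp
    then have S_le': "S \<le> 2 * n + 4 + 244 * q * q" by (simp only: of_nat_le_iff)
    have sweep: "sweep_cost = 600 * (n + card E)"
      using sum_out_degrees[OF E adj(2)] by (simp add: sweep_cost_def sum.distrib flip: sum_distrib_left)
    have "(\<Sum>v<n. weight v) = (q + 1) * (600 * (n + card E)) + 50 * n + n * (600 * (n + card E))"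
      using sum_vertex_cost by (simp add: weight_def sum.distrib sweep)
    then have "t \<le> 200000 * (m * n + 1)"
      using t time_bound[OF q(1) _ _ S_le' E2] square_le_power[of q] q(5) sn(2) by simp
    then have "t \<le> (200000 + 72 * R) * (m * n + 1)"
      by (rule order_trans) (intro mult_le_mono1, simp)
    with halts bfs space show ?thesis by blast
  qed
  then show ?thesis
    by (intro exI[of _ bfs_program] exI[of _ 72] exI[of _ "200000 + 72 * R"]) blast
qed

end
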